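(* Let $z\in\mathbb{C}$ with $-\frac{1}{2}<\mathrm{Re}(z)<\frac{1}{2}$, let $w\in\mathbb{C}$ and $x>0$, and let $\alpha,\beta$ be two positive numbers such that $\alpha\beta=1$. Then the functions $e^{-\frac{w^2}{2}}K_{z,iw}(2\alpha x)$ and $\beta K_{z,w}(2\beta x)$ form a pair of reciprocal functions in the Koshliakov kernel, that is, $$e^{-\frac{w^2}{2}}K_{z,iw}(2\alpha x)=2\int_{0}^{\infty}\beta\,K_{z,w}(2\beta t)\left(\cos(\pi z)M_{2z}(4\sqrt{xt})-\sin(\pi z)J_{2z}(4\sqrt{xt})\right)dt,$$ $$\beta\,K_{z,w}(2\beta x)=2\int_{0}^{\infty}e^{-\frac{w^2}{2}}K_{z,iw}(2\alpha t)\left(\cos(\pi z)M_{2z}(4\sqrt{xt})-\sin(\pi z)J_{2z}(4\sqrt{xt})\right)dt.$$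
   Context: The generalized modified Bessel function is defined, for $z,w\in\mathbb{C}$, by $$K_{z,w}(x):=\frac{1}{2\pi i}\int_{c-i\infty}^{c+i\infty}\Gamma\left(\tfrac{s-z}{2}\right)\Gamma\left(\tfrac{s+z}{2}\right)\,{}_1F_1\left(\tfrac{s-z}{2};\tfrac12;-\tfrac{w^2}{4}\right){}_1F_1\left(\tfrac{s+z}{2};\tfrac12;-\tfrac{w^2}{4}\right)2^{s-2}x^{-s}\,ds,$$ where $c=\mathrm{Re}(s)>|\mathrm{Re}(z)|$ (for $w=0$ it is the ordinary modified Bessel function $K_z(x)$). Here ${}_1F_1(a;c;u)=\sum_{n\ge0}\frac{(a)_n u^n}{(c)_n n!}$ with $(a)_n=a(a+1)\cdots(a+n-1)$. $J_\nu$, $Y_\nu$ are the Bessel functions of the first and second kinds and $K_\nu$ is the modified Bessel function of the second kind (single subscript), with the usual limits at integer orders; $M_\nu(x):=\frac{2}{\pi}K_\nu(x)-Y_\nu(x)$. *)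

theory Defs
  imports "HOL-Analysis.Analysis"
begin

definition kummer_1F1 :: "complex \<Rightarrow> complex \<Rightarrow> complex \<Rightarrow> complex" where
  "kummer_1F1 a c u = (\<Sum>n. pochhammer a n * u ^ n / (pochhammer c n * fact n))"

(* Principal branch of the power.  The reciprocal Gamma function is entire, so the two series make
   sense for every order nu, including the negative integers.  The argument is meant to be nonzero:
   since 0 powr a = 0, the value at 0 is 0 even for order 0. *)

definition bessel_J :: "complex \<Rightarrow> complex \<Rightarrow> complex" where
  "bessel_J \<nu> x =
     (x / 2) powr \<nu> * (\<Sum>m. (-1) ^ m * rGamma (\<nu> + of_nat m + 1) / fact m * (x / 2) ^ (2 * m))"

definition bessel_I :: "complex \<Rightarrow> complex \<Rightarrow> complex" where
  "bessel_I \<nu> x =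
     (x / 2) powr \<nu> * (\<Sum>m. rGamma (\<nu> + of_nat m + 1) / fact m * (x / 2) ^ (2 * m))"

definition bessel_Y :: "complex \<Rightarrow> complex \<Rightarrow> complex" where
  "bessel_Y \<nu> x =
     (let f = (\<lambda>\<mu>. (bessel_J \<mu> x * cos (of_real pi * \<mu>) - bessel_J (- \<mu>) x) / sin (of_real pi * \<mu>))
      in if \<nu> \<in> \<int> then Lim (at \<nu>) f else f \<nu>)"

definition bessel_K :: "complex \<Rightarrow> complex \<Rightarrow> complex" where
  "bessel_K \<nu> x =
     (let f = (\<lambda>\<mu>. of_real pi / 2 * (bessel_I (- \<mu>) x - bessel_I \<mu> x) / sin (of_real pi * \<mu>))
      in if \<nu> \<in> \<int> then Lim (at \<nu>) f else f \<nu>)"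

definition bessel_M :: "complex \<Rightarrow> complex \<Rightarrow> complex" where
  "bessel_M \<nu> x = 2 / of_real pi * bessel_K \<nu> x - bessel_Y \<nu> x"

definition gen_bessel_integrand :: "complex \<Rightarrow> complex \<Rightarrow> real \<Rightarrow> complex \<Rightarrow> complex" where
  "gen_bessel_integrand z w x s =
     Gamma ((s - z) / 2) * Gamma ((s + z) / 2)
     * kummer_1F1 ((s - z) / 2) (1 / 2) (- (w\<^sup>2 / 4))
     * kummer_1F1 ((s + z) / 2) (1 / 2) (- (w\<^sup>2 / 4))
     * 2 powr (s - 2) * of_real x powr (- s)"

(* K_{z,w}(x) for x > 0, with the abscissa c of the vertical line kept as a parameter; it is meant
   for c > |Re z|, where the value does not depend on c.  The line is s = c + i t with ds = i dt. *)

definition gen_bessel_K :: "real \<Rightarrow> complex \<Rightarrow> complex \<Rightarrow> real \<Rightarrow> complex" where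
  "gen_bessel_K c z w x =
     1 / (2 * of_real pi * \<i>) * (LINT t|lborel. gen_bessel_integrand z w x (Complex c t) * \<i>)"

definition koshliakov_kernel :: "complex \<Rightarrow> real \<Rightarrow> complex" where
  "koshliakov_kernel z y =
     cos (of_real pi * z) * bessel_M (2 * z) (of_real (4 * sqrt y))
     - sin (of_real pi * z) * bessel_J (2 * z) (of_real (4 * sqrt y))"

end

theory Submission
  imports Defs "HOL-Complex_Analysis.Complex_Analysis" "HOL-Probability.Characteristic_Functions"
    "HOL-Real_Asymp.Real_Asymp"
begin

text \<open>
The Koshliakov transform is the multiplicative convolution of two cosine transforms. If
$P(v) = e^{-v^2}\cos(wv)$, then $\Gamma(a/2)\,{}_1F_1(a/2;\frac12;-w^2/4)$ is twice the Mellin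
transform of $P$. So the Mellin--Barnes integral that defines $K_{z,w}$ is the inverse Mellin transform
of a product, and
\[ K_{z,w}(2x) = x^{-z}\int_0^\infty P(v)\,P(x/v)\,v^{2z-1}\,dv \]
(lemma \<open>gen_bessel_K_eq_bessel_conv\<close>). On the other hand the kernel $\kappa_z$ satisfies, in the sense of a limit
with vanishing damping,
\[ \int_0^\infty \cos(2\tau v)\cos(2u/v)\,v^{2z-1}\,dv = \frac{\pi}{2}\,(u/\tau)^z\,\kappa_z(\tau u) . \]
Integrating this against $P(\tau)P(s)$ with $u = as$ replaces both cosines by cosine transforms of $P$. The cosine transform
of $e^{-v^2}\cos(wv)$ is a multiple of $e^{-w^2/4}e^{-y^2}\cosh(wy)$, which is $P$ with $iw$ in place of $w$.
The two factors $e^{-w^2/4}$ combine to $e^{-w^2/2}$, and the remaining integral is the one that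
represents $K_{z,iw}(2a)$. The second relation of the pair is the first with $iw$ for $w$ and with $\alpha$, $\beta$ exchanged.

To avoid conditionally convergent integrals the cosines are damped by $e^{-\epsilon(v+1/v)}$. The damped
integral is a sum of four Laplace integrals $\int_0^\infty e^{-pv-q/v}v^{2z-1}\,dv$ with
$p = \epsilon \pm 2i\tau$ and $q = \epsilon \pm 2iu$. These have a closed form in power series
(lemma \<open>laplace_pair_eq_series\<close>): for $p = 1$ and small $q > 0$ both sides solve the same singular linear
system with the same limit at 0, and analytic continuation in $q$ and $p$ covers the general case. The
four-term sum converges to the kernel (lemma \<open>laplace_pair_tendsto_boundary\<close>) and is dominated uniformly in
$\epsilon$ (lemma \<open>laplace_pair_bound\<close>), because the series grows only like an exponential of $\sqrt{|pq|}$,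
while $P$ decays like a Gaussian.

This gives the identity for $0 < \mathrm{Re}\,z < \frac12$. It extends to $\mathrm{Re}\,z < 0$ because both sides
are even in $z$, and to $\mathrm{Re}\,z = 0$ by continuity; the latter includes $z = 0$, where the Bessel functions are
defined by limits. Continuity needs bounds on the kernel that are uniform in $z$, and
the maximum modulus principle supplies them.
\<close>

section \<open>Integrals in exponential coordinates\<close>

lemma lborel_integral_reflect:
  fixes f :: "real \<Rightarrow> 'a :: {banach, second_countable_topology}"
  shows "(LBINT y. f (a - y)) = (LBINT y. f y)"
  using lborel_integral_real_affine[of "-1" f a] by simp

lemma lborel_integrable_reflect:
  fixes f :: "real \<Rightarrow> 'a :: {banach, second_countable_topology}"
  shows "integrable lborel (\<lambda>y. f (a - y)) \<longleftrightarrow> integrable lborel f"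
  using lborel_integrable_real_affine_iff[of "-1" f a] by simp

lemma lborel_integral_shift:
  fixes f :: "real \<Rightarrow> 'a :: {banach, second_countable_topology}"
  shows "(LBINT y. f (a + y)) = (LBINT y. f y)"
  using lborel_integral_real_affine[of 1 f a] by simp

lemma lborel_integrable_shift:
  fixes f :: "real \<Rightarrow> 'a :: {banach, second_countable_topology}"
  shows "integrable lborel (\<lambda>y. f (a + y)) \<longleftrightarrow> integrable lborel f"
  using lborel_integrable_real_affine_iff[of 1 f a] by simp

text \<open>Throughout, integrals over the positive half-line are transported to the whole line by $t = e^y$.
Multiplicative scalings and the inversion $t \mapsto c/t$ then become shifts and reflections, and
complex powers become exponentials without branches.\<close>
lemma set_integral_exp_substitution:
  fixes f :: "real \<Rightarrow> complex"
  assumes meas: "(\<lambda>y. f (exp y)) \<in> borel_measurable borel"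
  shows "set_integrable lborel {0<..} f \<longleftrightarrow> integrable lborel (\<lambda>y. of_real (exp y) * f (exp y))" (is ?int)
    and "(LINT t:{0<..}|lborel. f t) = (LBINT y. of_real (exp y) * f (exp y))" (is ?eq)
proof -
  have m1: "(\<lambda>t. indicator {0<..} t *\<^sub>R f t) \<in> borel_measurable lborel"
  proof -
    have "(\<lambda>t. indicator {0<..} t *\<^sub>R f t) = (\<lambda>t. indicator {0<..} t *\<^sub>R f (exp (ln t)))"
      by (auto simp: fun_eq_iff indicator_def)
    moreover have "(\<lambda>t. f (exp (ln t))) \<in> borel_measurable borel"
      by (rule measurable_compose[OF _ meas]) measurable
    ultimately show ?thesis by simp
  qed
  have m2: "(\<lambda>y. of_real (exp y) * f (exp y)) \<in> borel_measurable lborel"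
    using meas by measurable
  have img: "exp ` (UNIV :: real set) = {0<..}"
    by (auto simp: image_iff) (metis exp_ln)
  have cov: "(\<lambda>x. \<bar>exp x\<bar> *\<^sub>R f (exp x)) absolutely_integrable_on UNIV \<and> integral UNIV (\<lambda>x. \<bar>exp x\<bar> *\<^sub>R f (exp x)) = b
          \<longleftrightarrow> f absolutely_integrable_on exp ` UNIV \<and> integral (exp ` UNIV) f = b" for b
    by (rule has_absolute_integral_change_of_variables_real) (auto intro!: derivative_eq_intros injI)
  have c1: "f absolutely_integrable_on {0<..} \<longleftrightarrow> set_integrable lborel {0<..} f"
    unfolding set_integrable_def by (rule integrable_completion[OF m1])
  have c2: "(\<lambda>x. \<bar>exp x\<bar> *\<^sub>R f (exp x)) absolutely_integrable_on UNIV \<longleftrightarrow> integrable lborel (\<lambda>y. of_real (exp y) * f (exp y))"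
    unfolding set_integrable_def using integrable_completion[OF m2] by (simp add: scaleR_conv_of_real)
  show ?int using cov c1 c2 img by metis
  show ?eq
  proof (cases "set_integrable lborel {0<..} f")
    case True
    have "(LINT t:{0<..}|lborel. f t) = integral {0<..} f"
      by (rule set_borel_integral_eq_integral(2)[OF True])
    also have "\<dots> = integral UNIV (\<lambda>x. \<bar>exp x\<bar> *\<^sub>R f (exp x))"
      using cov[of "integral {0<..} f"] True c1 by (simp add: img)
    also have "\<dots> = (LINT x:UNIV|lborel. \<bar>exp x\<bar> *\<^sub>R f (exp x))"
      using True \<open>?int\<close> by (intro set_borel_integral_eq_integral(2)[symmetric])
         (simp add: set_integrable_def scaleR_conv_of_real)
    finally show ?thesis by (simp add: set_lebesgue_integral_def scaleR_conv_of_real)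
  next
    case False
    with \<open>?int\<close> show ?thesis
      by (simp add: set_lebesgue_integral_def set_integrable_def not_integrable_integral_eq)
  qed
qed

lemma integrable_product_lborel:
  fixes f :: "'a::euclidean_space \<Rightarrow> 'c :: {real_normed_field, banach, second_countable_topology}"
    and g :: "'b::euclidean_space \<Rightarrow> 'c"
  assumes [measurable]: "integrable lborel f" "integrable lborel g"
  shows "integrable (lborel \<Otimes>\<^sub>M lborel) (\<lambda>(x, y). f x * g y)"
proof (rule lborel_pair.Fubini_integrable)
  show "(\<lambda>(x, y). f x * g y) \<in> borel_measurable (lborel \<Otimes>\<^sub>M lborel)"
    by measurable
  show "integrable lborel (\<lambda>x. LBINT y. norm (case (x, y) of (x, y) \<Rightarrow> f x * g y))"
    using assms by (simp add: norm_mult)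
  show "AE x in lborel. integrable lborel (\<lambda>y. case (x, y) of (x, y) \<Rightarrow> f x * g y)"
    using assms by simp
qed

lemma integral_product_lborel:
  fixes f :: "'a::euclidean_space \<Rightarrow> 'c :: {real_normed_field, banach, second_countable_topology}"
    and g :: "'b::euclidean_space \<Rightarrow> 'c"
  assumes "integrable lborel f" "integrable lborel g"
  shows "(\<integral>(x, y). f x * g y \<partial>(lborel \<Otimes>\<^sub>M lborel)) = (LBINT x. f x) * (LBINT y. g y)"
  using lborel_pair.integral_fst'[OF integrable_product_lborel[OF assms]] assms
  by simp

lemma Gamma_exp_integral:
  assumes "Re a > 0"
  shows "integrable lborel (\<lambda>y. exp (a * of_real y - of_real (exp y)))"
    and "(LBINT y. exp (a * of_real y - of_real (exp y))) = Gamma a"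
proof -
  let ?f = "\<lambda>t::real. complex_of_real t powr (a - 1) / of_real (exp t)"
  have eq: "of_real (exp y) * ?f (exp y) = exp (a * of_real y - of_real (exp y))" for y
    by (simp add: powr_of_real[symmetric] powr_def exp_of_real Ln_of_real exp_diff algebra_simps
          flip: exp_of_real exp_add exp_diff)
  have meas: "(\<lambda>y. ?f (exp y)) \<in> borel_measurable borel"
  proof -
    have "(\<lambda>y. ?f (exp y)) = (\<lambda>y. exp (a * of_real y - of_real (exp y)) / of_real (exp y))"
      by (subst eq[symmetric]) simp
    also have "\<dots> \<in> borel_measurable borel" by measurable
    finally show ?thesis .
  qed
  have "(\<lambda>t. indicator {0<..} t *\<^sub>R ?f t) = (\<lambda>t. indicator {0<..} t *\<^sub>R ?f (exp (ln t)))"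
      by (auto simp: fun_eq_iff indicator_def)
  moreover have "(\<lambda>t. ?f (exp (ln t))) \<in> borel_measurable borel"
    by (rule measurable_compose[OF _ meas]) measurable
  ultimately have "(\<lambda>t. indicator {0<..} t *\<^sub>R ?f t) \<in> borel_measurable lborel" by simp
  hence si: "set_integrable lborel {0<..} ?f"
    using absolutely_integrable_Gamma_integral'[OF assms] integrable_completion
    unfolding set_integrable_def by blast
  show "integrable lborel (\<lambda>y. exp (a * of_real y - of_real (exp y)))"
    using si set_integral_exp_substitution(1)[OF meas] unfolding eq by blast
  have "Gamma a = integral {0<..} ?f"
    using Gamma_integral_complex'[OF assms] by (simp add: integral_unique)
  also have "\<dots> = (LINT t:{0<..}|lborel. ?f t)"
    using set_borel_integral_eq_integral(2)[OF si] by simp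
  also have "\<dots> = (LBINT y. exp (a * of_real y - of_real (exp y)))"
    unfolding set_integral_exp_substitution(2)[OF meas] eq ..
  finally show "(LBINT y. exp (a * of_real y - of_real (exp y))) = Gamma a" ..
qed

lemma Gamma_exp_square_integral:
  assumes "Re a > 0"
  shows "integrable lborel (\<lambda>y. exp (a * of_real y - of_real ((exp y)\<^sup>2)))"
    and "(LBINT y. exp (a * of_real y - of_real ((exp y)\<^sup>2))) = Gamma (a / 2) / 2"
proof -
  have eq: "exp (a / 2 * of_real (0 + 2 * y) - of_real (exp (0 + 2 * y))) = exp (a * of_real y - of_real ((exp y)\<^sup>2))" for y :: real
    by (simp add: exp_double)
  have a2: "Re (a / 2) > 0" using assms by simp
  show "integrable lborel (\<lambda>y. exp (a * of_real y - of_real ((exp y)\<^sup>2)))"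
    using lborel_integrable_real_affine[OF Gamma_exp_integral(1)[OF a2], of 2 0] unfolding eq by simp
  have "Gamma (a / 2) = 2 *\<^sub>R (LBINT y. exp (a / 2 * of_real (0 + 2 * y) - of_real (exp (0 + 2 * y))))"
    using lborel_integral_real_affine[of 2 "\<lambda>y. exp (a / 2 * of_real y - of_real (exp y))" 0] Gamma_exp_integral(2)[OF a2] by simp
  thus "(LBINT y. exp (a * of_real y - of_real ((exp y)\<^sup>2))) = Gamma (a / 2) / 2"
    unfolding eq by (simp add: scaleR_conv_of_real)
qed

lemma integrable_exp_minus_exp:
  fixes \<sigma> c :: real
  assumes "\<sigma> > 0" "c > 0"
  shows "integrable lborel (\<lambda>y. exp (\<sigma> * y - c * exp y))"
proof -
  have "integrable lborel (\<lambda>y. norm (exp (of_real \<sigma> * of_real y - complex_of_real (exp y))))"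
    using Gamma_exp_integral(1)[of "of_real \<sigma>"] assms by (intro integrable_norm) simp
  hence "integrable lborel (\<lambda>y. exp (\<sigma> * y - exp y))"
    by simp
  hence "integrable lborel (\<lambda>y. exp (\<sigma> * (ln c + y) - exp (ln c + y)))"
    by (simp add: lborel_integrable_shift[of "\<lambda>y. exp (\<sigma> * y - exp y)"])
  moreover have "exp (\<sigma> * (ln c + y) - exp (ln c + y)) = exp (\<sigma> * ln c) * exp (\<sigma> * y - c * exp y)" for y
    using assms by (simp add: exp_add ring_distribs flip: exp_add) (simp add: exp_add exp_diff)
  ultimately show ?thesis by simp
qed

text \<open>This family dominates every one-variable integral that involves the Gaussian factor: its decay
absorbs any exponential of $e^y$, and $\sigma > 0$ takes care of $y \to -\infty$.\<close>
lemma integrable_gaussian_weight: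
  fixes \<sigma> C :: real
  assumes "\<sigma> > 0"
  shows "integrable lborel (\<lambda>y. exp (\<sigma> * y + C * exp y - (exp y)\<^sup>2))"
proof (rule Bochner_Integration.integrable_bound)
  show "integrable lborel (\<lambda>y. exp ((C + 1)\<^sup>2) * exp (\<sigma> * y - 1 * exp y))"
    by (intro integrable_mult_right integrable_exp_minus_exp assms) simp
  have "norm (exp (\<sigma> * y + C * exp y - (exp y)\<^sup>2)) \<le> norm (exp ((C + 1)\<^sup>2) * exp (\<sigma> * y - 1 * exp y))" for y :: real
  proof -
    have "0 \<le> (exp y - (C + 1))\<^sup>2 + (C + 1)\<^sup>2 + (exp y)\<^sup>2" by simp
    hence "(C + 1) * exp y - (exp y)\<^sup>2 \<le> (C + 1)\<^sup>2"
      by (simp add: power2_eq_square algebra_simps)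
    hence "\<sigma> * y + C * exp y - (exp y)\<^sup>2 \<le> (C + 1)\<^sup>2 + (\<sigma> * y - 1 * exp y)"
      by (simp add: algebra_simps)
    thus ?thesis by (simp flip: exp_add)
  qed
  thus "AE y in lborel. norm (exp (\<sigma> * y + C * exp y - (exp y)\<^sup>2)) \<le> norm (exp ((C + 1)\<^sup>2) * exp (\<sigma> * y - 1 * exp y))"
    by simp
qed measurable

text \<open>With exponential damping at both ends the exponent $\sigma$ is arbitrary.\<close>
lemma integrable_two_sided_weight:
  fixes \<sigma> a b :: real
  assumes "a > 0" "b > 0"
  shows "integrable lborel (\<lambda>y. exp (\<sigma> * y - a * exp y - b * exp (- y)))"
proof (rule Bochner_Integration.integrable_bound)
  let ?s = "\<bar>\<sigma>\<bar> + 1"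
  have "integrable lborel (\<lambda>y. exp (?s * (0 - y) - b * exp (0 - y)))"
    by (subst lborel_integrable_reflect[of "\<lambda>y. exp (?s * y - b * exp y)"])
       (intro integrable_exp_minus_exp, use assms in linarith, use assms in simp)
  thus "integrable lborel (\<lambda>y. exp (?s * y - a * exp y) + exp (?s * (0 - y) - b * exp (0 - y)))"
    by (intro Bochner_Integration.integrable_add integrable_exp_minus_exp) (use assms in auto)
  have "norm (exp (\<sigma> * y - a * exp y - b * exp (- y))) \<le> norm (exp (?s * y - a * exp y) + exp (?s * (0 - y) - b * exp (0 - y)))" for y :: real
  proof (cases "y \<ge> 0")
    case True
    have "0 \<le> (\<bar>\<sigma>\<bar> + 1 - \<sigma>) * y + b * exp (- y)"
      using True assms by (intro add_nonneg_nonneg mult_nonneg_nonneg) auto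
    hence "exp (\<sigma> * y - a * exp y - b * exp (- y)) \<le> exp (?s * y - a * exp y)"
      by (simp add: algebra_simps)
    thus ?thesis by (simp add: add_increasing2)
  next
    case False
    have "0 \<le> \<bar>\<sigma>\<bar> + 1 + \<sigma>" by linarith
    hence "0 \<le> (\<bar>\<sigma>\<bar> + 1 + \<sigma>) * (- y)"
      using False by (intro mult_nonneg_nonneg) auto
    hence "0 \<le> (\<bar>\<sigma>\<bar> + 1 + \<sigma>) * (- y) + a * exp y"
      by (rule add_nonneg_nonneg) (use assms in simp)
    hence "exp (\<sigma> * y - a * exp y - b * exp (- y)) \<le> exp (?s * (0 - y) - b * exp (0 - y))"
      by (simp add: algebra_simps)
    thus ?thesis by (simp add: add_increasing)
  qed
  thus "AE y in lborel. norm (exp (\<sigma> * y - a * exp y - b * exp (- y))) \<le> norm (exp (?s * y - a * exp y) + exp (?s * (0 - y) - b * exp (0 - y)))"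
    by simp
qed measurable

section \<open>Fourier inversion for convolutions\<close>

lemma std_normal_fourier:
  "(LBINT t. exp (\<i> * of_real (s * t)) * of_real (std_normal_density t)) = of_real (exp (- s\<^sup>2 / 2))"
proof -
  have "of_real (exp (- s\<^sup>2 / 2)) = char std_normal_distribution s"
    by (simp add: char_std_normal_distribution)
  also have "\<dots> = (LBINT t. std_normal_density t *\<^sub>R iexp (s * t))"
    unfolding char_def by (subst integral_density) auto
  finally show ?thesis by (simp add: scaleR_conv_of_real mult.commute)
qed

text \<open>The Gaussian factor makes the double integral absolutely convergent, and the Fourier transform of a
Gaussian is again one. As \<open>\<epsilon>\<close> tends to 0 the right-hand side approximates a multiple of \<open>h b\<close>.\<close>
lemma fourier_gaussian_mean:
  fixes h :: "real \<Rightarrow> complex"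
  assumes int [measurable]: "integrable lborel h" and \<epsilon>: "\<epsilon> > 0"
  defines "F \<equiv> \<lambda>t. LBINT y. h y * exp (\<i> * of_real (t * y))"
  shows "(LBINT t. F t * exp (- \<i> * of_real (t * b)) * of_real (std_normal_density (\<epsilon> * t)))
       = (LBINT \<xi>. h (b + \<epsilon> * \<xi>) * of_real (exp (- \<xi>\<^sup>2 / 2)))"
proof -
  have nint: "integrable lborel (\<lambda>t. std_normal_density (0 + \<epsilon> * t))"
    by (intro lborel_integrable_real_affine) (use \<epsilon> in auto)
  let ?E = "\<lambda>u t. h u * (exp (\<i> * of_real (t * (u - b))) * of_real (std_normal_density (\<epsilon> * t)))"
  let ?L = "\<lambda>t. F t * exp (- \<i> * of_real (t * b)) * of_real (std_normal_density (\<epsilon> * t))"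
  have "(LBINT t. ?L t)
      = (LBINT t. (LBINT u. ?E u t))"
  proof (intro Bochner_Integration.integral_cong refl)
    fix t
    have "?L t
       = (LBINT u. h u * exp (\<i> * of_real (t * u)) * (exp (- \<i> * of_real (t * b)) * of_real (std_normal_density (\<epsilon> * t))))"
      unfolding F_def by (subst integral_mult_left_zero) (simp only: mult.assoc)
    also have "\<dots> = (LBINT u. ?E u t)"
      by (intro Bochner_Integration.integral_cong refl) (simp add: exp_diff exp_minus right_diff_distrib field_simps)
    finally show "?L t = \<dots>" .
  qed
  also have "\<dots> = (LBINT u. (LBINT t. ?E u t))"
  proof (rule lborel_pair.Fubini_integral)
    show "integrable (lborel \<Otimes>\<^sub>M lborel) (\<lambda>(u, t). ?E u t)"
    proof (rule Bochner_Integration.integrable_bound)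
      show "integrable (lborel \<Otimes>\<^sub>M lborel) (\<lambda>(u, t). h u * complex_of_real (std_normal_density (0 + \<epsilon> * t)))"
        by (rule integrable_product_lborel[OF int integrable_of_real[OF nint]])
      show "AE x in lborel \<Otimes>\<^sub>M lborel. norm (case x of (u, t) \<Rightarrow> ?E u t)
         \<le> norm (case x of (u, t) \<Rightarrow> h u * complex_of_real (std_normal_density (0 + \<epsilon> * t)))"
        by (simp add: norm_mult case_prod_unfold)
    qed measurable
  qed
  also have "\<dots> = (LBINT u. h u * of_real (exp (- ((u - b) / \<epsilon>)\<^sup>2 / 2) / \<epsilon>))"
  proof (intro Bochner_Integration.integral_cong refl)
    fix u
    have "of_real (exp (- ((u - b) / \<epsilon>)\<^sup>2 / 2)) = \<bar>\<epsilon>\<bar> *\<^sub>R (LBINT t. exp (\<i> * of_real ((u - b) / \<epsilon> * (0 + \<epsilon> * t))) * complex_of_real (std_normal_density (0 + \<epsilon> * t)))"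
      using std_normal_fourier[of "(u - b) / \<epsilon>"]
        lborel_integral_real_affine[of \<epsilon> "\<lambda>t. exp (\<i> * of_real ((u - b) / \<epsilon> * t)) * complex_of_real (std_normal_density t)" 0] \<epsilon> by simp
    also have "(\<lambda>t. (u - b) / \<epsilon> * (0 + \<epsilon> * t)) = (\<lambda>t. t * (u - b))" using \<epsilon> by (auto simp: field_simps)
    finally have "(LBINT t. exp (\<i> * of_real (t * (u - b))) * of_real (std_normal_density (\<epsilon> * t))) = complex_of_real (exp (- ((u - b) / \<epsilon>)\<^sup>2 / 2) / \<epsilon>)"
      using \<epsilon> by (simp add: scaleR_conv_of_real field_simps)
    thus "(LBINT t. ?E u t) = h u * of_real (exp (- ((u - b) / \<epsilon>)\<^sup>2 / 2) / \<epsilon>)"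
      by simp
  qed
  also have "\<dots> = \<bar>\<epsilon>\<bar> *\<^sub>R (LBINT \<xi>. h (b + \<epsilon> * \<xi>) * of_real (exp (- (((b + \<epsilon> * \<xi>) - b) / \<epsilon>)\<^sup>2 / 2) / \<epsilon>))"
    using \<epsilon> by (intro lborel_integral_real_affine) simp
  also have "\<dots> = (LBINT \<xi>. h (b + \<epsilon> * \<xi>) * of_real (exp (- \<xi>\<^sup>2 / 2)))"
    using \<epsilon> by (simp add: scaleR_conv_of_real)
  finally show ?thesis .
qed

text \<open>A product of two Fourier transforms is inverted by the convolution of the two functions. Only the
second factor has to be bounded and continuous: the Gaussian means of the previous lemma are taken in
that factor and converge under the integral over the first.\<close>
lemma fourier_inversion_convolution:
  fixes h1 h2 :: "real \<Rightarrow> complex"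
  defines "F1 \<equiv> \<lambda>t. LBINT y. h1 y * exp (\<i> * of_real (t * y))"
    and "F2 \<equiv> \<lambda>t. LBINT y. h2 y * exp (\<i> * of_real (t * y))"
  assumes int1 [measurable]: "integrable lborel h1" and int2 [measurable]: "integrable lborel h2"
    and cont: "continuous_on UNIV h2" and bdd: "\<And>y. norm (h2 y) \<le> B"
    and intF: "integrable lborel (\<lambda>t. F1 t * F2 t)"
  shows "(LBINT t. F1 t * F2 t * exp (- \<i> * of_real (t * a))) = 2 * of_real pi * (LBINT u. h1 u * h2 (a - u))"
proof -
  define \<epsilon> where "\<epsilon> = (\<lambda>n. inverse (real (Suc n)))"
  have \<epsilon>: "\<epsilon> n > 0" for n by (simp add: \<epsilon>_def)
  have \<epsilon>0: "\<epsilon> \<longlonglongrightarrow> 0" unfolding \<epsilon>_def by (rule LIMSEQ_inverse_real_of_nat)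
  have [measurable]: "F1 \<in> borel_measurable lborel" "F2 \<in> borel_measurable lborel"
    unfolding F1_def F2_def by measurable
  have F2bd: "norm (F2 t) \<le> (LBINT y. norm (h2 y))" for t
  proof -
    have "norm (F2 t) \<le> (LBINT y. norm (h2 y * exp (\<i> * of_real (t * y))))"
      unfolding F2_def by (rule integral_norm_bound)
    thus ?thesis by (simp add: norm_mult)
  qed
  define g where "g = (\<lambda>\<xi>::real. exp (- \<xi>\<^sup>2 / 2))"
  have g_eq: "g \<xi> = sqrt (2 * pi) * std_normal_density \<xi>" for \<xi>
    by (simp add: g_def std_normal_density_def)
  have [measurable]: "g \<in> borel_measurable borel" unfolding g_def by measurable
  have gint: "integrable lborel g"
    unfolding g_eq by (intro integrable_mult_right) auto
  have gval: "(LBINT \<xi>. g \<xi>) = sqrt (2 * pi)"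
    unfolding g_eq by simp
  let ?P = "\<lambda>n t. F1 t * F2 t * exp (- \<i> * of_real (t * a)) * of_real (g (\<epsilon> n * t))"
  let ?Q = "\<lambda>n t. F2 t * exp (- \<i> * of_real (t * a)) * of_real (g (\<epsilon> n * t))"
  let ?h = "\<lambda>n u \<xi>. h2 (a - u + \<epsilon> n * \<xi>) * of_real (g \<xi>)"
  let ?r = "complex_of_real (sqrt (2 * pi))"
  define I where "I = (\<lambda>n. LBINT t. ?P n t)"
  have lim1: "I \<longlonglongrightarrow> (LBINT t. F1 t * F2 t * exp (- \<i> * of_real (t * a)))"
    unfolding I_def
  proof (rule integral_dominated_convergence[where w = "\<lambda>t. norm (F1 t * F2 t)"])
    show "AE t in lborel. (\<lambda>n. ?P n t) \<longlonglongrightarrow> F1 t * F2 t * exp (- \<i> * of_real (t * a))"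
    proof (intro AE_I2)
      fix t
      have "(\<lambda>n. g (\<epsilon> n * t)) \<longlonglongrightarrow> g (0 * t)"
        unfolding g_def by (intro tendsto_intros \<epsilon>0) auto
      from tendsto_mult[OF tendsto_const tendsto_of_real[OF this]]
      show "(\<lambda>n. ?P n t) \<longlonglongrightarrow> F1 t * F2 t * exp (- \<i> * of_real (t * a))"
        by (simp add: g_def)
    qed
    show "AE t in lborel. norm (?P n t) \<le> norm (F1 t * F2 t)" for n
      by (simp add: norm_mult g_def mult_left_le)
    show "integrable lborel (\<lambda>t. norm (F1 t * F2 t))" using intF by (rule integrable_norm)
  qed measurable
  have I_eq: "I n = ?r * (LBINT u. h1 u * (LBINT \<xi>. ?h n u \<xi>))" for n
  proof -
    have nint: "integrable lborel (\<lambda>t. g (0 + \<epsilon> n * t))"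
      by (intro lborel_integrable_real_affine gint) (use \<epsilon>[of n] in auto)
    have Gint: "integrable lborel (\<lambda>t. ?Q n t)"
    proof (rule Bochner_Integration.integrable_bound)
      show "integrable lborel (\<lambda>t. (LBINT y. norm (h2 y)) * g (0 + \<epsilon> n * t))"
        by (intro integrable_mult_right nint)
      show "AE t in lborel. norm (?Q n t) \<le> norm ((LBINT y. norm (h2 y)) * g (0 + \<epsilon> n * t))"
        using F2bd by (auto simp: norm_mult abs_mult intro!: mult_right_mono order_trans[OF F2bd])
    qed measurable
    have "I n = (LBINT t. (LBINT u. h1 u * (?Q n t) * exp (\<i> * of_real (t * u))))"
      unfolding I_def
    proof (intro Bochner_Integration.integral_cong refl)
      fix t
      have "(LBINT u. h1 u * (?Q n t) * exp (\<i> * of_real (t * u)))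
          = (LBINT u. h1 u * exp (\<i> * of_real (t * u)) * (?Q n t))"
        by (simp only: mult_ac)
      also have "\<dots> = ?P n t"
        unfolding F1_def by (subst integral_mult_left_zero) (simp only: mult.assoc)
      finally show "?P n t = (LBINT u. h1 u * (?Q n t) * exp (\<i> * of_real (t * u)))" ..
    qed
    also have "\<dots> = (LBINT u. (LBINT t. h1 u * (?Q n t) * exp (\<i> * of_real (t * u))))"
    proof (rule lborel_pair.Fubini_integral)
      show "integrable (lborel \<Otimes>\<^sub>M lborel) (\<lambda>(u, t). h1 u * (?Q n t) * exp (\<i> * of_real (t * u)))"
      proof (rule Bochner_Integration.integrable_bound)
        show "integrable (lborel \<Otimes>\<^sub>M lborel) (\<lambda>(u, t). h1 u * (?Q n t))"
          by (rule integrable_product_lborel[OF int1 Gint])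
        show "AE x in lborel \<Otimes>\<^sub>M lborel. norm (case x of (u, t) \<Rightarrow> h1 u * (?Q n t) * exp (\<i> * of_real (t * u)))
          \<le> norm (case x of (u, t) \<Rightarrow> h1 u * (?Q n t))"
          by (simp add: norm_mult case_prod_unfold)
      qed measurable
    qed
    also have "\<dots> = (LBINT u. ?r * (h1 u * (LBINT \<xi>. ?h n u \<xi>)))"
    proof (intro Bochner_Integration.integral_cong refl)
      fix u
      have "(LBINT t. h1 u * (?Q n t) * exp (\<i> * of_real (t * u)))
         = (LBINT t. (h1 u * ?r) * (F2 t * exp (- \<i> * of_real (t * (a - u))) * of_real (std_normal_density (\<epsilon> n * t))))"
        by (intro Bochner_Integration.integral_cong refl)
           (simp add: g_eq right_diff_distrib exp_diff exp_minus field_simps)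
      also have "\<dots> = (h1 u * ?r) * (LBINT t. F2 t * exp (- \<i> * of_real (t * (a - u))) * of_real (std_normal_density (\<epsilon> n * t)))"
        by simp
      also have "\<dots> = ?r * (h1 u * (LBINT \<xi>. ?h n u \<xi>))"
        unfolding F2_def g_def by (subst fourier_gaussian_mean[OF int2 \<epsilon>]) (simp add: mult_ac)
      finally show "(LBINT t. h1 u * (?Q n t) * exp (\<i> * of_real (t * u))) = \<dots>" .
    qed
    finally show ?thesis by simp
  qed
  have [measurable]: "h2 \<in> borel_measurable borel" using int2 by auto
  have lim2: "(\<lambda>n. LBINT u. h1 u * (LBINT \<xi>. ?h n u \<xi>))
      \<longlonglongrightarrow> (LBINT u. h1 u * (h2 (a - u) * ?r))"
  proof (rule integral_dominated_convergence[where w = "\<lambda>u. norm (h1 u) * (B * sqrt (2 * pi))"])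
    have inner: "(\<lambda>n. (LBINT \<xi>. ?h n u \<xi>)) \<longlonglongrightarrow> (LBINT \<xi>. h2 (a - u) * of_real (g \<xi>))" for u
    proof (rule integral_dominated_convergence[where w = "\<lambda>\<xi>. B * g \<xi>"])
      show "integrable lborel (\<lambda>\<xi>. B * g \<xi>)" by (intro integrable_mult_right gint)
      show "AE \<xi> in lborel. norm (?h n u \<xi>) \<le> B * g \<xi>" for n
        using bdd by (auto simp: norm_mult g_def)
      have "(\<lambda>n. h2 (a - u + \<epsilon> n * \<xi>)) \<longlonglongrightarrow> h2 (a - u + 0 * \<xi>)" for \<xi>
        by (intro continuous_on_tendsto_compose[OF cont] tendsto_intros \<epsilon>0) auto
      thus "AE \<xi> in lborel. (\<lambda>n. ?h n u \<xi>) \<longlonglongrightarrow> h2 (a - u) * of_real (g \<xi>)"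
        by (intro AE_I2 tendsto_mult tendsto_const) simp
    qed measurable
    show "AE u in lborel. (\<lambda>n. h1 u * (LBINT \<xi>. ?h n u \<xi>)) \<longlonglongrightarrow> h1 u * (h2 (a - u) * ?r)"
      using tendsto_mult[OF tendsto_const inner] by (simp add: gval)
    show "AE u in lborel. norm (h1 u * (LBINT \<xi>. ?h n u \<xi>)) \<le> norm (h1 u) * (B * sqrt (2 * pi))" for n
    proof (intro AE_I2)
      fix u
      have "norm (LBINT \<xi>. ?h n u \<xi>) \<le> (LBINT \<xi>. B * g \<xi>)"
      proof (rule Bochner_Integration.integral_norm_bound_integral)
        show "integrable lborel (\<lambda>\<xi>. B * g \<xi>)" by (intro integrable_mult_right gint)
        show b: "norm (?h n u \<xi>) \<le> B * g \<xi>" for \<xi>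
          using bdd by (simp add: norm_mult g_def)
        show "integrable lborel (\<lambda>\<xi>. ?h n u \<xi>)"
          by (rule Bochner_Integration.integrable_bound[OF integrable_mult_right[OF gint, of B]])
             (use b in \<open>auto intro: order_trans[OF _ abs_ge_self]\<close>)
      qed
      thus "norm (h1 u * (LBINT \<xi>. ?h n u \<xi>)) \<le> norm (h1 u) * (B * sqrt (2 * pi))"
        by (simp add: norm_mult gval mult_left_mono)
    qed
    show "integrable lborel (\<lambda>u. norm (h1 u) * (B * sqrt (2 * pi)))"
      by (intro integrable_mult_left integrable_norm int1)
  qed measurable
  have "I \<longlonglongrightarrow> ?r * (LBINT u. h1 u * (h2 (a - u) * ?r))"
    unfolding I_eq by (intro tendsto_mult tendsto_const lim2)
  from LIMSEQ_unique[OF lim1 this]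
  have "(LBINT t. F1 t * F2 t * exp (- \<i> * of_real (t * a))) = ?r * (LBINT u. (h1 u * h2 (a - u)) * ?r)"
    by (simp add: mult.assoc)
  also have "\<dots> = (?r * ?r) * (LBINT u. h1 u * h2 (a - u))"
    by simp
  also have "?r * ?r = (2 * of_real pi :: complex)"
    by (subst of_real_mult[symmetric]) simp
  finally show ?thesis .
qed

section \<open>The generalized Bessel function as a convolution\<close>

text \<open>Up to the factor 2, the Mellin transform of this function at \<open>a\<close> is
$\Gamma(a/2)\,{}_1F_1(a/2; 1/2; -w^2/4)$. Its cosine transform is, up to a constant, the same
function with \<open>\<i> * w\<close> in place of \<open>w\<close>; this is where the exchange of \<open>w\<close> and \<open>\<i> * w\<close> in
the theorem comes from.\<close>
definition gcos :: "complex \<Rightarrow> real \<Rightarrow> complex" where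
  "gcos w v = exp (- (of_real v)\<^sup>2) * cos (w * of_real v)"

lemma continuous_on_gcos [continuous_intros]:
  fixes f :: "'a :: t2_space \<Rightarrow> real"
  shows "continuous_on A f \<Longrightarrow> continuous_on A (\<lambda>x. gcos w (f x))"
  unfolding gcos_def by (intro continuous_intros)

lemma measurable_gcos [measurable]: "gcos w \<in> borel_measurable borel"
  by (intro borel_measurable_continuous_onI continuous_intros)

lemma norm_sin_le: "norm (sin z) \<le> exp (norm z)" for z :: complex
proof -
  have "norm (exp (\<i> * z) - exp (- (\<i> * z))) \<le> norm (exp (\<i> * z)) + norm (exp (- (\<i> * z)))"
    by (rule norm_triangle_ineq4)
  also have "\<dots> \<le> exp (norm z) + exp (norm z)"
    using abs_Im_le_cmod[of z] by (intro add_mono) auto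
  finally show ?thesis by (simp add: sin_exp_eq norm_divide norm_mult)
qed

lemma norm_gcos_le:
  assumes "v \<ge> 0"
  shows "norm (gcos w v) \<le> exp (norm w * v - v\<^sup>2)"
proof -
  have "norm (gcos w v) = exp (- v\<^sup>2) * norm (cos (w * of_real v))"
    by (simp add: gcos_def norm_mult flip: of_real_power)
  also have "\<dots> \<le> exp (- v\<^sup>2) * exp (norm (w * of_real v))"
    by (intro mult_left_mono norm_cos_le) auto
  also have "\<dots> = exp (norm w * v - v\<^sup>2)"
    using assms by (simp add: norm_mult flip: exp_add)
  finally show ?thesis .
qed

lemma norm_gcos_mellin_integrand_le:
  "norm (gcos w (exp y) * exp (a * of_real y)) \<le> exp (Re a * y + norm w * exp y - (exp y)\<^sup>2)"
proof -
  have "norm (gcos w (exp y) * exp (a * of_real y)) = norm (gcos w (exp y)) * exp (Re a * y)"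
    by (simp add: norm_mult)
  also have "\<dots> \<le> exp (norm w * exp y - (exp y)\<^sup>2) * exp (Re a * y)"
    by (intro mult_right_mono norm_gcos_le) auto
  also have "\<dots> = exp (Re a * y + norm w * exp y - (exp y)\<^sup>2)"
    by (simp flip: exp_add)
  finally show ?thesis .
qed

definition gcos_mellin :: "complex \<Rightarrow> complex \<Rightarrow> complex" where
  "gcos_mellin w a = (LBINT y. gcos w (exp y) * exp (a * of_real y))"

lemma integrable_gcos_mellin:
  assumes "Re a > 0"
  shows "integrable lborel (\<lambda>y. gcos w (exp y) * exp (a * of_real y))"
proof (rule Bochner_Integration.integrable_bound[OF integrable_gaussian_weight[OF assms, of "norm w"]])
  show "AE y in lborel. norm (gcos w (exp y) * exp (a * of_real y)) \<le> norm (exp (Re a * y + norm w * exp y - (exp y)\<^sup>2))"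
    using norm_gcos_mellin_integrand_le by simp
qed measurable

lemma cos_sums_even: "(\<lambda>n. (-1) ^ n * z ^ (2 * n) / fact (2 * n)) sums cos z" for z :: complex
proof -
  have "(\<lambda>n. cos_coeff (2 * n) *\<^sub>R z ^ (2 * n)) sums cos z"
  proof (subst sums_mono_reindex[of "\<lambda>n. 2 * n" "\<lambda>n. cos_coeff n *\<^sub>R z ^ n"])
    show "cos_coeff n *\<^sub>R z ^ n = 0" if "n \<notin> range (\<lambda>n. 2 * n)" for n
      using that by (auto simp: cos_coeff_def elim!: evenE)
  qed (auto simp: strict_mono_def cos_converges)
  thus ?thesis by (simp add: cos_coeff_def scaleR_conv_of_real)
qed

lemma sum_even_exp_terms_le:
  assumes "x \<ge> (0::real)"
  shows "(\<Sum>k<N. x ^ (2 * k) / fact (2 * k)) \<le> exp x"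
proof -
  have "(\<Sum>k<N. x ^ (2 * k) / fact (2 * k)) = (\<Sum>j\<in>(\<lambda>k. 2 * k) ` {..<N}. x ^ j / fact j)"
    by (subst sum.reindex) (auto simp: inj_on_def)
  also have "\<dots> \<le> (\<Sum>j. x ^ j / fact j)"
    using assms summable_exp_generic[of x]
    by (intro sum_le_suminf) (auto simp: divide_inverse mult.commute)
  also have "\<dots> = exp x"
    by (simp add: exp_def divide_inverse mult.commute)
  finally show ?thesis .
qed

text \<open>The cosine is expanded into its power series and integrated termwise. The duplication formula
$(2n)! = 4^n\, n!\, (1/2)_n$ turns the resulting Gamma values into the coefficients of the Kummer function.\<close>
lemma gcos_mellin_eq:
  assumes "Re a > 0"
  shows "gcos_mellin w a = Gamma (a / 2) * kummer_1F1 (a / 2) (1 / 2) (- (w\<^sup>2 / 4)) / 2"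
proof -
  define c where "c = (\<lambda>n. (-1) ^ n * w ^ (2 * n) / fact (2 * n) :: complex)"
  define f where "f = (\<lambda>n (y::real). c n * exp ((a + 2 * of_nat n) * of_real y - of_real ((exp y)\<^sup>2)))"
  have f_alt: "f n y = ((-1) ^ n * (w * of_real (exp y)) ^ (2 * n) / fact (2 * n)) * (exp (- (of_real (exp y))\<^sup>2) * exp (a * of_real y))" for n y
    by (simp add: f_def c_def power_mult_distrib ring_distribs exp_add exp_diff exp_minus field_simps
         exp_of_nat_mult[symmetric] flip: exp_of_real)
  have fint: "integrable lborel (f n)" for n
    unfolding f_def using assms by (intro integrable_mult_right Gamma_exp_square_integral) auto
  have fval: "(LBINT y. f n y) = Gamma (a / 2) / 2 * (pochhammer (a / 2) n * (- (w\<^sup>2 / 4)) ^ n / (pochhammer (1 / 2) n * fact n))" for n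
  proof -
    have a2: "a / 2 \<notin> \<int>\<^sub>\<le>\<^sub>0"
    proof
      assume "a / 2 \<in> \<int>\<^sub>\<le>\<^sub>0"
      hence "Re (a / 2) \<le> 0" by (auto elim!: nonpos_Ints_cases)
      thus False using assms by simp
    qed
    have "(LBINT y. f n y) = c n * (Gamma ((a + 2 * of_nat n) / 2) / 2)"
      unfolding f_def using assms by (subst integral_mult_right_zero, subst Gamma_exp_square_integral) auto
    also have "(a + 2 * of_nat n) / 2 = a / 2 + of_nat n" by simp
    also have "Gamma (a / 2 + of_nat n) = pochhammer (a / 2) n * Gamma (a / 2)"
      using pochhammer_Gamma[OF a2, of n] Gamma_eq_zero_iff[of "a / 2"] a2 by simp
    also have "c n = (- (w\<^sup>2 / 4)) ^ n / (pochhammer (1 / 2) n * fact n)"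
    proof -
      have "(- (w\<^sup>2 / 4)) ^ n = (-1) ^ n * w ^ (2 * n) / 2 ^ (2 * n)"
        by (subst power_minus) (simp add: power_divide power_mult)
      thus ?thesis unfolding c_def fact_double by simp
    qed
    finally show ?thesis by (simp only: times_divide_eq_right times_divide_eq_left divide_divide_eq_left mult.assoc mult.commute mult.left_commute)
  qed
  have "(\<lambda>N. LBINT y. (\<Sum>n<N. f n y)) \<longlonglongrightarrow> gcos_mellin w a"
    unfolding gcos_mellin_def
  proof (rule integral_dominated_convergence[where w = "\<lambda>y. exp (Re a * y + norm w * exp y - (exp y)\<^sup>2)"])
    show "integrable lborel (\<lambda>y. exp (Re a * y + norm w * exp y - (exp y)\<^sup>2))"
      by (rule integrable_gaussian_weight[OF assms])
    show "AE y in lborel. (\<lambda>N. \<Sum>n<N. f n y) \<longlonglongrightarrow> gcos w (exp y) * exp (a * of_real y)"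
    proof (intro AE_I2)
      fix y :: real
      from sums_mult2[OF cos_sums_even[of "w * of_real (exp y)"], of "exp (- (of_real (exp y))\<^sup>2) * exp (a * of_real y)"]
      show "(\<lambda>N. \<Sum>n<N. f n y) \<longlonglongrightarrow> gcos w (exp y) * exp (a * of_real y)"
        unfolding f_alt sums_def gcos_def by (simp only: mult_ac)
    qed
    show "AE y in lborel. norm (\<Sum>n<N. f n y) \<le> exp (Re a * y + norm w * exp y - (exp y)\<^sup>2)" for N
    proof (intro AE_I2)
      fix y :: real
      have nf: "norm (f n y) = (norm w * exp y) ^ (2 * n) / fact (2 * n) * exp (Re a * y - (exp y)\<^sup>2)" for n
        unfolding f_alt
        by (simp add: norm_mult norm_divide norm_power exp_diff exp_minus field_simps flip: of_real_power)
      have "norm (\<Sum>n<N. f n y) \<le> (\<Sum>n<N. norm (f n y))" by (rule norm_sum)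
      also have "\<dots> = (\<Sum>n<N. (norm w * exp y) ^ (2 * n) / fact (2 * n)) * exp (Re a * y - (exp y)\<^sup>2)"
        by (simp only: nf sum_distrib_right)
      also have "\<dots> \<le> exp (norm w * exp y) * exp (Re a * y - (exp y)\<^sup>2)"
        by (intro mult_right_mono sum_even_exp_terms_le) auto
      also have "\<dots> = exp (Re a * y + norm w * exp y - (exp y)\<^sup>2)" by (simp add: algebra_simps flip: exp_add)
      finally show "norm (\<Sum>n<N. f n y) \<le> exp (Re a * y + norm w * exp y - (exp y)\<^sup>2)" .
    qed
    show "(\<lambda>y. \<Sum>n<N. f n y) \<in> borel_measurable lborel" for N
      using fint by (intro borel_measurable_sum) auto
  qed measurable
  hence "(\<lambda>n. Gamma (a / 2) / 2 * (pochhammer (a / 2) n * (- (w\<^sup>2 / 4)) ^ n / (pochhammer (1 / 2) n * fact n))) sums gcos_mellin w a"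
    unfolding sums_def by (subst (asm) Bochner_Integration.integral_sum[OF fint]) (simp only: fval)
  hence s: "gcos_mellin w a = (\<Sum>n. Gamma (a / 2) / 2 * (pochhammer (a / 2) n * (- (w\<^sup>2 / 4)) ^ n / (pochhammer (1 / 2) n * fact n)))"
    and sm: "summable (\<lambda>n. Gamma (a / 2) / 2 * (pochhammer (a / 2) n * (- (w\<^sup>2 / 4)) ^ n / (pochhammer (1 / 2) n * fact n)))"
    by (simp_all add: sums_iff)
  have "Re (a / 2) > 0" using assms by simp
  hence "Gamma (a / 2) \<noteq> 0"
    using Gamma_eq_zero_iff[of "a / 2"] by (auto elim!: nonpos_Ints_cases)
  hence "summable (\<lambda>n. pochhammer (a / 2) n * (- (w\<^sup>2 / 4)) ^ n / (pochhammer (1 / 2) n * fact n))"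
    using sm by (subst (asm) summable_cmult_iff) auto
  from suminf_mult[OF this, of "Gamma (a / 2) / 2"] show ?thesis
    unfolding s kummer_1F1_def by simp
qed

text \<open>Integration by parts: $a$ times the transform is, up to sign, the Mellin transform of the derivative
at $a + 1$, which is bounded on a vertical line.\<close>
lemma gcos_mellin_decay:
  assumes \<sigma>: "\<sigma> > 0"
  shows "\<exists>C. \<forall>a. Re a = \<sigma> \<longrightarrow> norm (a * gcos_mellin w a) \<le> C"
proof -
  define D where "D = (\<lambda>v::real. - exp (- (of_real v)\<^sup>2) * (2 * of_real v * cos (w * of_real v) + w * sin (w * of_real v)))"
  define W where "W = (\<lambda>y::real. 2 * exp ((\<sigma> + 2) * y + norm w * exp y - (exp y)\<^sup>2) + norm w * exp ((\<sigma> + 1) * y + norm w * exp y - (exp y)\<^sup>2))"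
  have [measurable]: "D \<in> borel_measurable borel"
    unfolding D_def by (intro borel_measurable_continuous_onI continuous_intros)
  have Wint: "integrable lborel W"
    unfolding W_def using \<sigma> by (intro Bochner_Integration.integrable_add integrable_mult_right integrable_gaussian_weight) auto
  have bound: "norm (D (exp y) * of_real (exp y) * exp (a * of_real y)) \<le> W y" if "Re a = \<sigma>" for a y
  proof -
    have c: "norm (cos (w * of_real (exp y))) \<le> exp (norm w * exp y)"
      using norm_cos_le[of "w * of_real (exp y)"] by (simp add: norm_mult)
    have s: "norm (sin (w * of_real (exp y))) \<le> exp (norm w * exp y)"
      using norm_sin_le[of "w * of_real (exp y)"] by (simp add: norm_mult)
    have "norm (2 * of_real (exp y) * cos (w * of_real (exp y)) + w * sin (w * of_real (exp y)))
       \<le> 2 * exp y * exp (norm w * exp y) + norm w * exp (norm w * exp y)"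
      by (intro norm_triangle_le) (simp add: norm_mult add_mono mult_left_mono c s)
    hence "norm (D (exp y)) \<le> exp (- (exp y)\<^sup>2) * (2 * exp y * exp (norm w * exp y) + norm w * exp (norm w * exp y))"
      unfolding D_def norm_mult norm_minus_cancel
      by (intro mult_mono) (simp_all flip: of_real_power)
    hence "norm (D (exp y) * of_real (exp y) * exp (a * of_real y))
      \<le> exp (- (exp y)\<^sup>2) * (2 * exp y * exp (norm w * exp y) + norm w * exp (norm w * exp y)) * (exp y * exp (\<sigma> * y))"
      unfolding norm_mult using that by (simp add: mult.assoc mult_right_mono)
    also have "\<dots> = W y"
    proof -
      have 1: "exp ((\<sigma> + 2) * y + norm w * exp y - (exp y)\<^sup>2) = exp (- (exp y)\<^sup>2) * exp (norm w * exp y) * (exp y * exp y) * exp (\<sigma> * y)"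
        by (simp add: algebra_simps flip: exp_add)
      have 2: "exp ((\<sigma> + 1) * y + norm w * exp y - (exp y)\<^sup>2) = exp (- (exp y)\<^sup>2) * exp (norm w * exp y) * exp y * exp (\<sigma> * y)"
        by (simp add: algebra_simps flip: exp_add)
      show ?thesis unfolding W_def 1 2 by (simp add: algebra_simps)
    qed
    finally show ?thesis .
  qed
  have "norm (a * gcos_mellin w a) \<le> (LBINT y. W y)" if a: "Re a = \<sigma>" for a
  proof -
    define F where "F = (\<lambda>y::real. gcos w (exp y) * exp (a * of_real y))"
    define f where "f = (\<lambda>y::real. D (exp y) * of_real (exp y) * exp (a * of_real y) + a * (gcos w (exp y) * exp (a * of_real y)))"
    have i1: "integrable lborel (\<lambda>y. D (exp y) * of_real (exp y) * exp (a * of_real y))"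
      by (rule Bochner_Integration.integrable_bound[OF Wint]) (use bound[OF a] in \<open>auto intro: order_trans[OF _ abs_ge_self]\<close>)
    have i2: "integrable lborel (\<lambda>y. gcos w (exp y) * exp (a * of_real y))"
      using \<sigma> a by (intro integrable_gcos_mellin) auto
    have fint: "integrable lborel f"
      unfolding f_def by (intro Bochner_Integration.integrable_add i1 integrable_mult_right i2)
    \<comment> \<open>\<open>f\<close> is the derivative of \<open>F\<close>, and \<open>F\<close> vanishes at both ends.\<close>
    have "(LBINT y=-\<infinity>..\<infinity>. f y) = 0 - 0"
    proof (rule interval_integral_FTC_integrable)
      fix y :: real
      have "((\<lambda>y. exp (- (exp y)\<^sup>2) * cos (w * exp y) * exp (a * y)) has_field_derivative
        (- exp (- (exp (of_real y))\<^sup>2) * (2 * exp (of_real y) * cos (w * exp (of_real y)) + w * sin (w * exp (of_real y)))) * exp (of_real y) * exp (a * of_real y)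
          + a * (exp (- (exp (of_real y))\<^sup>2) * cos (w * exp (of_real y)) * exp (a * of_real y))) (at (of_real y :: complex))"
        by (auto intro!: derivative_eq_intros simp: algebra_simps power2_eq_square)
      from has_vector_derivative_real_field[OF this]
      show "(F has_vector_derivative f y) (at y)"
        unfolding F_def f_def gcos_def D_def by (simp add: exp_of_real)
      show "isCont f y"
        unfolding f_def D_def gcos_def by (intro continuous_intros)
    next
      show "set_integrable lborel (einterval (-\<infinity>) \<infinity>) f"
        using fint by (simp add: set_integrable_def)
    next
      have le: "norm (F y) \<le> exp (\<sigma> * y + norm w * exp y - (exp y)\<^sup>2)" for y
        using norm_gcos_mellin_integrand_le[of w y a] a by (simp add: F_def)
      have "((\<lambda>y. exp (\<sigma> * y + norm w * exp y - (exp y)\<^sup>2)) \<longlongrightarrow> 0) at_top"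
        by real_asymp
      hence "(F \<longlongrightarrow> 0) at_top" by (rule Lim_null_comparison[rotated]) (use le in auto)
      thus "((F \<circ> real_of_ereal) \<longlongrightarrow> 0) (at_left \<infinity>)"
        by (simp add: ereal_tendsto_simps)
      have "((\<lambda>y. exp (\<sigma> * y + norm w * exp y - (exp y)\<^sup>2)) \<longlongrightarrow> 0) at_bot"
        using \<sigma> by real_asymp
      hence "(F \<longlongrightarrow> 0) at_bot" by (rule Lim_null_comparison[rotated]) (use le in auto)
      thus "((F \<circ> real_of_ereal) \<longlongrightarrow> 0) (at_right (-\<infinity>))"
        by (simp add: ereal_tendsto_simps)
    qed simp
    hence "(LBINT y. f y) = 0"
      by (simp add: interval_integral_to_infinity_eq interval_lebesgue_integral_def set_lebesgue_integral_def)
    hence "a * gcos_mellin w a = - (LBINT y. D (exp y) * of_real (exp y) * exp (a * of_real y))"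
      unfolding f_def gcos_mellin_def
      by (subst (asm) Bochner_Integration.integral_add[OF i1 integrable_mult_right[OF i2]]) (simp add: eq_neg_iff_add_eq_0 add.commute)
    hence "norm (a * gcos_mellin w a) = norm (LBINT y. D (exp y) * of_real (exp y) * exp (a * of_real y))" by simp
    also have "\<dots> \<le> (LBINT y. W y)"
      using bound[OF a] by (intro Bochner_Integration.integral_norm_bound_integral i1 Wint) auto
    finally show ?thesis .
  qed
  thus ?thesis by blast
qed

text \<open>Substituting $v = e^u$ and $x = e^\xi$ gives
$x^{-z}\int_0^\infty e^{-v^2-x^2/v^2}\cos(wv)\cos(wx/v)\,v^{2z-1}\,dv$. For $w = 0$ this is the
classical integral representation of $K_z(2x)$.\<close>
definition bessel_conv :: "complex \<Rightarrow> complex \<Rightarrow> real \<Rightarrow> complex" where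
  "bessel_conv z w \<xi> = (LBINT u. gcos w (exp u) * gcos w (exp (\<xi> - u)) * exp (z * of_real (2 * u - \<xi>)))"

lemma Complex_eq_shift: "Complex c t = of_real c + \<i> * of_real t"
  by (simp add: complex_eq_iff)

lemma gen_bessel_integrand_eq:
  assumes "c > \<bar>Re z\<bar>"
  shows "gen_bessel_integrand z w (2 * exp \<xi>) (Complex c t) =
    gcos_mellin w (Complex c t + z) * gcos_mellin w (Complex c t - z) * exp (- Complex c t * of_real \<xi>)"
proof -
  let ?s = "Complex c t"
  have re: "Re (?s - z) > 0" "Re (?s + z) > 0" using assms by auto
  have "2 powr (?s - 2) * of_real (2 * exp \<xi>) powr (- ?s) = exp (- ?s * of_real \<xi>) / 4"
  proof -
    have ln2: "Ln (of_real (2 * exp \<xi>)) = of_real (ln 2 + \<xi>)"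
      by (subst Ln_of_real) (auto simp: ln_mult)
    have ln2': "Ln 2 = of_real (ln 2)" using Ln_of_real[of 2] by simp
    have "2 powr (?s - 2) * of_real (2 * exp \<xi>) powr (- ?s) = exp ((?s - 2) * of_real (ln 2)) * exp (- ?s * of_real (ln 2 + \<xi>))"
      by (simp add: powr_def ln2 ln2' del: of_real_mult)
    also have "\<dots> = exp (- ?s * of_real \<xi> - of_real (2 * ln 2))"
      by (simp add: algebra_simps flip: exp_add)
    also have "\<dots> = exp (- ?s * of_real \<xi>) / of_real (exp (2 * ln 2))"
      by (simp only: exp_diff exp_of_real)
    also have "exp (2 * ln 2) = (4 :: real)" by (simp add: exp_double)
    finally show ?thesis by simp
  qed
  hence p: "gen_bessel_integrand z w (2 * exp \<xi>) ?s =
    Gamma ((?s - z) / 2) * Gamma ((?s + z) / 2)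
     * kummer_1F1 ((?s - z) / 2) (1 / 2) (- (w\<^sup>2 / 4))
     * kummer_1F1 ((?s + z) / 2) (1 / 2) (- (w\<^sup>2 / 4)) * (exp (- ?s * of_real \<xi>) / 4)"
    unfolding gen_bessel_integrand_def by (simp only: mult.assoc)
  show ?thesis unfolding p gcos_mellin_eq[OF re(1)] gcos_mellin_eq[OF re(2)] by simp
qed

text \<open>Each factor decays like the reciprocal of its argument, so the product is dominated by a
multiple of $1/(1+t^2)$.\<close>
lemma gcos_mellin_integrable_vertical:
  assumes "c > \<bar>Re z\<bar>"
  shows "integrable lborel (\<lambda>t. gcos_mellin w (Complex c t + z) * gcos_mellin w (Complex c t - z))"
proof -
  have c1: "c + Re z > 0" "c - Re z > 0" using assms by auto
  obtain C1 where C1: "\<And>a. Re a = c + Re z \<Longrightarrow> norm (a * gcos_mellin w a) \<le> C1"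
    using gcos_mellin_decay[OF c1(1)] by blast
  obtain C2 where C2: "\<And>a. Re a = c - Re z \<Longrightarrow> norm (a * gcos_mellin w a) \<le> C2"
    using gcos_mellin_decay[OF c1(2)] by blast
  have m: "(\<lambda>t. gcos_mellin w (Complex c t + z)) \<in> borel_measurable borel"
          "(\<lambda>t. gcos_mellin w (Complex c t - z)) \<in> borel_measurable borel"
    unfolding gcos_mellin_def Complex_eq_shift by measurable
  define k where "k = min (c + Re z) (c - Re z)"
  have k: "k > 0" "k \<le> c + Re z" "k \<le> c - Re z" using c1 by (auto simp: k_def)
  let ?g = "\<lambda>s t. inverse (k\<^sup>2 + (t + s)\<^sup>2) :: real"
  have base: "integrable lborel (\<lambda>t::real. inverse (1 + t\<^sup>2))"
  proof -
    have "set_integrable lborel (einterval (-\<infinity>) \<infinity>) (\<lambda>t::real. inverse (1 + t\<^sup>2))"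
    proof (rule interval_integral_FTC_nonneg(1)[where A = "- (pi / 2)" and B = "pi / 2"])
      show "((arctan \<circ> real_of_ereal) \<longlongrightarrow> - (pi / 2)) (at_right (-\<infinity>))"
        using tendsto_arctan_at_bot by (simp add: ereal_tendsto_simps)
      show "((arctan \<circ> real_of_ereal) \<longlongrightarrow> pi / 2) (at_left \<infinity>)"
        using tendsto_arctan_at_top by (simp add: ereal_tendsto_simps)
      show "isCont (\<lambda>t::real. inverse (1 + t\<^sup>2)) x" for x
        by (intro continuous_intros) (metis add_pos_nonneg less_irrefl zero_le_power2 zero_less_one)
    qed (auto intro: DERIV_arctan)
    thus ?thesis by (simp add: set_integrable_def)
  qed
  have gint: "integrable lborel (?g s)" for s
  proof -
    have "integrable lborel (\<lambda>t. inverse (k\<^sup>2) * inverse (1 + (s / k + 1 / k * t)\<^sup>2))"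
      using k by (intro integrable_mult_right lborel_integrable_real_affine base) auto
    moreover have "inverse (k\<^sup>2) * inverse (1 + (s / k + 1 / k * t)\<^sup>2) = ?g s t" for t
      using k by (simp add: power2_eq_square field_simps)
    ultimately show ?thesis by (simp only:)
  qed
  have "C1 \<ge> 0" by (rule order_trans[OF norm_ge_zero C1[of "of_real (c + Re z)"]]) simp
  moreover have "C2 \<ge> 0" by (rule order_trans[OF norm_ge_zero C2[of "of_real (c - Re z)"]]) simp
  ultimately have C0: "C1 \<ge> 0" "C2 \<ge> 0" by blast+
  show ?thesis
  proof (rule Bochner_Integration.integrable_bound)
    show "integrable lborel (\<lambda>t. C1 * C2 * (?g (Im z) t + ?g (- Im z) t))"
      by (intro integrable_mult_right Bochner_Integration.integrable_add gint)
    show "AE t in lborel. norm (gcos_mellin w (Complex c t + z) * gcos_mellin w (Complex c t - z)) \<le> norm (C1 * C2 * (?g (Im z) t + ?g (- Im z) t))"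
    proof (intro AE_I2)
      fix t
      let ?a = "Complex c t + z" and ?b = "Complex c t - z"
      define A where "A = norm ?a"
      define B where "B = norm ?b"
      have A2: "A\<^sup>2 = (c + Re z)\<^sup>2 + (t + Im z)\<^sup>2" by (simp add: A_def cmod_power2)
      have B2: "B\<^sup>2 = (c - Re z)\<^sup>2 + (t - Im z)\<^sup>2" by (simp add: B_def cmod_power2)
      have A: "A > 0" "B > 0" using c1 by (auto simp: A_def B_def complex_eq_iff)
      have "k\<^sup>2 \<le> (c + Re z)\<^sup>2" using k by (intro power_mono) auto
      hence A3: "inverse (A\<^sup>2) \<le> ?g (Im z) t" unfolding A2 using k by (intro le_imp_inverse_le) (auto intro: add_pos_nonneg)
      have "k\<^sup>2 \<le> (c - Re z)\<^sup>2" using k by (intro power_mono) auto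
      hence B3: "inverse (B\<^sup>2) \<le> ?g (- Im z) t" unfolding B2 using k by (intro le_imp_inverse_le) (auto intro: add_pos_nonneg)
      have "norm (gcos_mellin w ?a) \<le> C1 / A"
        using C1[of ?a] A unfolding norm_mult A_def[symmetric] by (simp add: field_simps)
      moreover have "norm (gcos_mellin w ?b) \<le> C2 / B"
        using C2[of ?b] A unfolding norm_mult B_def[symmetric] by (simp add: field_simps)
      ultimately have "norm (gcos_mellin w ?a * gcos_mellin w ?b) \<le> (C1 / A) * (C2 / B)"
        unfolding norm_mult using C0 A by (intro mult_mono) auto
      also have "\<dots> = C1 * C2 * (inverse A * inverse B)" by (simp add: field_simps)
      also have "inverse A * inverse B \<le> inverse (A\<^sup>2) + inverse (B\<^sup>2)"
      proof -
        have "0 \<le> (inverse A - inverse B)\<^sup>2 + inverse (A\<^sup>2) + inverse (B\<^sup>2)" by simp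
        thus ?thesis by (simp add: power2_eq_square algebra_simps)
      qed
      hence "C1 * C2 * (inverse A * inverse B) \<le> C1 * C2 * (?g (Im z) t + ?g (- Im z) t)"
        using C0 A3 B3 by (intro mult_left_mono) (auto simp: mult_nonneg_nonneg)
      finally show "norm (gcos_mellin w ?a * gcos_mellin w ?b) \<le> norm (C1 * C2 * (?g (Im z) t + ?g (- Im z) t))"
        by simp
    qed
  qed (use m in measurable)
qed

text \<open>On the line with abscissa \<open>c\<close> the two Gamma-Kummer factors are the Fourier transforms of
$e^{(c \pm z)u}$ times the Gaussian cosine, and the power of the argument plays the role of the
inverse Fourier kernel. Hence the Mellin--Barnes integral is the inverse transform of a product.\<close>
lemma gen_bessel_K_eq_bessel_conv:
  assumes "c > \<bar>Re z\<bar>"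
  shows "gen_bessel_K c z w (2 * exp \<xi>) = bessel_conv z w \<xi>"
proof -
  define h1 where "h1 = (\<lambda>u::real. gcos w (exp u) * exp ((of_real c + z) * of_real u))"
  define h2 where "h2 = (\<lambda>u::real. gcos w (exp u) * exp ((of_real c - z) * of_real u))"
  have F1: "(LBINT y. h1 y * exp (\<i> * of_real (t * y))) = gcos_mellin w (Complex c t + z)" for t
    unfolding gcos_mellin_def h1_def Complex_eq_shift
    by (intro Bochner_Integration.integral_cong refl) (simp add: ring_distribs exp_add mult_ac)
  have F2: "(LBINT y. h2 y * exp (\<i> * of_real (t * y))) = gcos_mellin w (Complex c t - z)" for t
    unfolding gcos_mellin_def h2_def Complex_eq_shift
    by (intro Bochner_Integration.integral_cong refl) (simp add: ring_distribs exp_add exp_diff mult_ac)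
  have inv: "(LBINT t. gcos_mellin w (Complex c t + z) * gcos_mellin w (Complex c t - z) * exp (- \<i> * of_real (t * \<xi>)))
     = 2 * of_real pi * (LBINT u. h1 u * h2 (\<xi> - u))"
    unfolding F1[symmetric] F2[symmetric]
  proof (rule fourier_inversion_convolution[where B = "exp ((norm w + (c - Re z))\<^sup>2)"])
    show "integrable lborel h1" "integrable lborel h2"
      unfolding h1_def h2_def using assms by (auto intro!: integrable_gcos_mellin)
    show "continuous_on UNIV h2" unfolding h2_def by (intro continuous_intros)
    show "integrable lborel (\<lambda>t. (LBINT y. h1 y * exp (\<i> * of_real (t * y))) * (LBINT y. h2 y * exp (\<i> * of_real (t * y))))"
      unfolding F1 F2 by (rule gcos_mellin_integrable_vertical[OF assms])
    fix y :: real
    let ?C = "norm w + (c - Re z)"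
    have "norm (h2 y) \<le> exp ((c - Re z) * y + norm w * exp y - (exp y)\<^sup>2)"
      using norm_gcos_mellin_integrand_le[of w y "of_real c - z"] by (simp add: h2_def)
    also have "(c - Re z) * y + norm w * exp y - (exp y)\<^sup>2 \<le> ?C\<^sup>2"
    proof -
      have "y \<le> exp y" using exp_ge_add_one_self[of y] by linarith
      hence "(c - Re z) * y \<le> (c - Re z) * exp y" using assms by (intro mult_left_mono) auto
      moreover have "0 \<le> (exp y - ?C)\<^sup>2 + ?C\<^sup>2 + (exp y)\<^sup>2" by simp
      hence "?C * exp y - (exp y)\<^sup>2 \<le> ?C\<^sup>2" by (simp add: power2_eq_square algebra_simps)
      ultimately show ?thesis by (simp add: algebra_simps)
    qed
    finally show "norm (h2 y) \<le> exp (?C\<^sup>2)" by simp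
  qed
  have "(LBINT u. h1 u * h2 (\<xi> - u)) = (LBINT u. exp (of_real (c * \<xi>)) * (gcos w (exp u) * gcos w (exp (\<xi> - u)) * exp (z * of_real (2 * u - \<xi>))))"
    unfolding h1_def h2_def
  proof (intro Bochner_Integration.integral_cong refl)
    fix u :: real
    have "exp ((of_real c + z) * of_real u) * exp ((of_real c - z) * of_real (\<xi> - u)) = exp (of_real (c * \<xi>)) * exp (z * of_real (2 * u - \<xi>))"
      by (simp add: algebra_simps flip: exp_add)
    thus "gcos w (exp u) * exp ((of_real c + z) * of_real u) * (gcos w (exp (\<xi> - u)) * exp ((of_real c - z) * of_real (\<xi> - u)))
       = exp (of_real (c * \<xi>)) * (gcos w (exp u) * gcos w (exp (\<xi> - u)) * exp (z * of_real (2 * u - \<xi>)))"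
      by (metis (no_types, lifting) mult.assoc mult.commute mult.left_commute)
  qed
  also have "\<dots> = exp (of_real (c * \<xi>)) * bessel_conv z w \<xi>"
    by (simp add: bessel_conv_def)
  finally have conv: "(LBINT u. h1 u * h2 (\<xi> - u)) = exp (of_real (c * \<xi>)) * bessel_conv z w \<xi>" .
  have "(LINT t|lborel. gen_bessel_integrand z w (2 * exp \<xi>) (Complex c t) * \<i>)
     = (LBINT t. \<i> * exp (- of_real (c * \<xi>)) * (gcos_mellin w (Complex c t + z) * gcos_mellin w (Complex c t - z) * exp (- \<i> * of_real (t * \<xi>))))"
    unfolding gen_bessel_integrand_eq[OF assms]
  proof (intro Bochner_Integration.integral_cong refl)
    fix t :: real
    have "exp (- Complex c t * of_real \<xi>) = exp (- of_real (c * \<xi>)) * exp (- \<i> * of_real (t * \<xi>))"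
      by (simp add: Complex_eq_shift algebra_simps flip: exp_add)
    thus "gcos_mellin w (Complex c t + z) * gcos_mellin w (Complex c t - z) * exp (- Complex c t * of_real \<xi>) * \<i> =
      \<i> * exp (- of_real (c * \<xi>)) * (gcos_mellin w (Complex c t + z) * gcos_mellin w (Complex c t - z) * exp (- \<i> * of_real (t * \<xi>)))"
      by simp
  qed
  also have "\<dots> = \<i> * exp (- of_real (c * \<xi>)) * (2 * of_real pi * (exp (of_real (c * \<xi>)) * bessel_conv z w \<xi>))"
    by (subst integral_mult_right_zero) (simp only: inv conv)
  also have "\<dots> = 2 * of_real pi * \<i> * bessel_conv z w \<xi>"
    by (simp add: exp_minus)
  finally show ?thesis unfolding gen_bessel_K_def by simp
qed

section \<open>The Koshliakov kernel as a power series\<close>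

text \<open>The entire series common to all Bessel functions: $J_\nu$ and $I_\nu$ are $(x/2)^\nu$ times its value
at $-x^2/4$ and at $x^2/4$. The order may vary holomorphically, which makes the limits that define
$Y_0$ and $K_0$ accessible.\<close>
definition bessel_series :: "complex \<Rightarrow> complex \<Rightarrow> complex" where
  "bessel_series \<nu> x = (\<Sum>k. rGamma (\<nu> + of_nat k + 1) / fact k * x ^ k)"

lemma norm_rGamma_shift_le:
  assumes "0 < \<rho>" "\<rho> \<le> 1" "\<rho> \<le> 1 + Re \<nu>"
  shows "norm (rGamma (\<nu> + of_nat k + 1)) \<le> norm (rGamma (\<nu> + 1)) / (\<rho> ^ k * fact k)"
proof -
  have "\<rho> ^ k * fact k \<le> norm (pochhammer (\<nu> + 1) k)"
  proof (induction k)
    case (Suc k)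
    have "0 \<le> (1 - \<rho>) * real k" using assms by simp
    hence "\<rho> * (real k + 1) \<le> 1 + Re \<nu> + real k"
      using assms by (simp add: algebra_simps)
    also have "\<dots> = Re (\<nu> + 1 + of_nat k)" by simp
    also have "\<dots> \<le> norm (\<nu> + 1 + of_nat k)" by (rule complex_Re_le_cmod)
    finally have "\<rho> * (real k + 1) \<le> norm (\<nu> + 1 + of_nat k)" .
    hence "(\<rho> ^ k * fact k) * (\<rho> * (real k + 1)) \<le> norm (pochhammer (\<nu> + 1) k) * norm (\<nu> + 1 + of_nat k)"
      using Suc assms by (intro mult_mono) auto
    moreover have "\<rho> ^ Suc k * fact (Suc k) = (\<rho> ^ k * fact k) * (\<rho> * (real k + 1))"
      by (simp add: algebra_simps)
    ultimately show ?case by (simp only: pochhammer_Suc norm_mult)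
  qed auto
  moreover have "rGamma (\<nu> + 1) = pochhammer (\<nu> + 1) k * rGamma (\<nu> + of_nat k + 1)"
    by (subst pochhammer_rGamma[of "\<nu> + 1" k]) (simp add: add_ac)
  ultimately have "(\<rho> ^ k * fact k) * norm (rGamma (\<nu> + of_nat k + 1)) \<le> norm (rGamma (\<nu> + 1))"
    by (simp add: norm_mult mult_right_mono)
  thus ?thesis using assms by (simp add: field_simps)
qed

lemma bessel_series_term_le:
  assumes "0 < \<rho>" "\<rho> \<le> 1" "\<rho> \<le> 1 + Re \<nu>"
  shows "norm (rGamma (\<nu> + of_nat k + 1) / fact k * x ^ k) \<le> norm (rGamma (\<nu> + 1)) * (sqrt (norm x / \<rho>) ^ k / fact k)\<^sup>2"
proof -
  have "norm (rGamma (\<nu> + of_nat k + 1) / fact k * x ^ k) = norm (rGamma (\<nu> + of_nat k + 1)) * (norm x ^ k / fact k)"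
    by (simp add: norm_mult norm_divide norm_power)
  also have "\<dots> \<le> norm (rGamma (\<nu> + 1)) / (\<rho> ^ k * fact k) * (norm x ^ k / fact k)"
    by (intro mult_right_mono norm_rGamma_shift_le assms) auto
  also have "\<dots> = norm (rGamma (\<nu> + 1)) * ((norm x / \<rho>) ^ k / (fact k)\<^sup>2)"
    by (simp add: power_divide power2_eq_square)
  also have "(norm x / \<rho>) ^ k = (sqrt (norm x / \<rho>) ^ k)\<^sup>2"
    using assms by (simp flip: power_mult add: mult.commute[of k 2] power_mult)
  finally show ?thesis by (simp add: power_divide)
qed

lemma exp_terms_square:
  assumes "y \<ge> (0::real)"
  shows "summable (\<lambda>k. (y ^ k / fact k)\<^sup>2)" "(\<Sum>k. (y ^ k / fact k)\<^sup>2) \<le> exp (2 * y)"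
proof -
  have s: "(\<lambda>k. y ^ k / fact k) sums exp y"
    using exp_converges[of y] by (simp add: divide_inverse mult.commute)
  have le: "y ^ k / fact k \<le> exp y" for k
    using sum_le_suminf[of "\<lambda>k. y ^ k / fact k" "{k}"] s assms by (simp add: sums_iff)
  have le2: "(y ^ k / fact k)\<^sup>2 \<le> exp y * (y ^ k / fact k)" for k
    unfolding power2_eq_square using assms le by (intro mult_right_mono) auto
  have s2: "(\<lambda>k. exp y * (y ^ k / fact k)) sums (exp y * exp y)" by (intro sums_mult s)
  show sm: "summable (\<lambda>k. (y ^ k / fact k)\<^sup>2)"
    by (rule summable_comparison_test'[of "\<lambda>k. exp y * (y ^ k / fact k)" 0]) (use s2 le2 in \<open>auto simp: sums_iff\<close>)
  have "(\<Sum>k. (y ^ k / fact k)\<^sup>2) \<le> (\<Sum>k. exp y * (y ^ k / fact k))"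
    using s2 by (intro suminf_le le2 sm) (auto simp: sums_iff)
  also have "\<dots> = exp (2 * y)" using s2 by (simp add: sums_iff exp_double power2_eq_square)
  finally show "(\<Sum>k. (y ^ k / fact k)\<^sup>2) \<le> exp (2 * y)" .
qed

text \<open>The growth is that of the exponential of a multiple of $\sqrt{|x|}$. An exponential of $|x|$ itself would be
too weak later on: the series is evaluated at a product $x = 4a\tau s$, which has to be beaten by
$e^{-\tau^2-s^2}$ for every \<open>a\<close>.\<close>
lemma bessel_series_bound:
  assumes "0 < \<rho>" "\<rho> \<le> 1" "\<rho> \<le> 1 + Re \<nu>"
  shows "summable (\<lambda>k. norm (rGamma (\<nu> + of_nat k + 1) / fact k * x ^ k))"
    and "norm (bessel_series \<nu> x) \<le> norm (rGamma (\<nu> + 1)) * exp (2 * sqrt (norm x / \<rho>))"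
proof -
  let ?y = "sqrt (norm x / \<rho>)"
  have y: "?y \<ge> 0" using assms by simp
  have s2: "summable (\<lambda>k. norm (rGamma (\<nu> + 1)) * (?y ^ k / fact k)\<^sup>2)"
    by (intro summable_mult exp_terms_square y)
  show s1: "summable (\<lambda>k. norm (rGamma (\<nu> + of_nat k + 1) / fact k * x ^ k))"
    by (rule summable_comparison_test'[OF s2, of 0]) (use bessel_series_term_le[OF assms] in simp)
  have "norm (bessel_series \<nu> x) \<le> (\<Sum>k. norm (rGamma (\<nu> + of_nat k + 1) / fact k * x ^ k))"
    unfolding bessel_series_def by (rule summable_norm[OF s1])
  also have "\<dots> \<le> (\<Sum>k. norm (rGamma (\<nu> + 1)) * (?y ^ k / fact k)\<^sup>2)"
    by (intro suminf_le bessel_series_term_le assms s1 s2)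
  also have "\<dots> = norm (rGamma (\<nu> + 1)) * (\<Sum>k. (?y ^ k / fact k)\<^sup>2)"
    by (intro suminf_mult exp_terms_square y)
  also have "\<dots> \<le> norm (rGamma (\<nu> + 1)) * exp (2 * ?y)"
    by (intro mult_left_mono exp_terms_square y) auto
  finally show "norm (bessel_series \<nu> x) \<le> norm (rGamma (\<nu> + 1)) * exp (2 * ?y)" .
qed

lemma summable_bessel_series:
  assumes "Re \<nu> > -1"
  shows "summable (\<lambda>k. rGamma (\<nu> + of_nat k + 1) / fact k * x ^ k)"
  by (rule summable_norm_cancel, rule bessel_series_bound(1)[of "min 1 (1 + Re \<nu>)"]) (use assms in auto)

lemma has_field_derivative_bessel_series:
  assumes "Re \<nu> > -1"
  shows "(bessel_series \<nu> has_field_derivative bessel_series (\<nu> + 1) x) (at x)"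
proof -
  let ?c = "\<lambda>k. rGamma (\<nu> + of_nat k + 1) / fact k"
  have "((\<lambda>x. \<Sum>k. ?c k * x ^ k) has_field_derivative (\<Sum>k. diffs ?c k * x ^ k)) (at x)"
    by (rule termdiffs_strong_converges_everywhere) (rule summable_bessel_series[OF assms])
  moreover have "diffs ?c k = rGamma (\<nu> + 1 + of_nat k + 1) / fact k" for k
  proof -
    have eq: "\<nu> + of_nat (Suc k) + 1 = \<nu> + 1 + of_nat k + 1" by simp
    show ?thesis unfolding diffs_def eq fact_Suc by (simp del: of_nat_Suc)
  qed
  ultimately show ?thesis unfolding bessel_series_def by (simp add: fun_eq_iff)
qed

lemma continuous_on_bessel_series [continuous_intros]:
  fixes f :: "'a :: topological_space \<Rightarrow> complex"
  assumes "Re \<nu> > -1" "continuous_on A f"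
  shows "continuous_on A (\<lambda>x. bessel_series \<nu> (f x))"
proof -
  have "continuous_on UNIV (bessel_series \<nu>)"
    using has_field_derivative_bessel_series[OF assms(1)]
    by (auto intro!: DERIV_continuous_on)
  thus ?thesis using continuous_on_compose2[of UNIV "bessel_series \<nu>" A f] assms(2) by auto
qed

text \<open>The three-term recurrence of the Bessel functions, obtained by splitting the factor
$\nu + k + 1$ that relates consecutive reciprocal Gamma values.\<close>
lemma bessel_series_recurrence:
  assumes "Re \<nu> > -1"
  shows "bessel_series \<nu> x = (\<nu> + 1) * bessel_series (\<nu> + 1) x + x * bessel_series (\<nu> + 2) x"
proof -
  let ?t = "\<lambda>\<mu> k. rGamma (\<mu> + of_nat k + 1) / fact k * x ^ k"
  have s1: "summable (?t (\<nu> + 1))" and s2: "summable (?t (\<nu> + 2))" and s0: "summable (?t \<nu>)"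
    using assms by (intro summable_bessel_series; simp)+
  have a: "?t \<nu> k = (\<nu> + 1) * ?t (\<nu> + 1) k + of_nat k * ?t (\<nu> + 1) k" for k
  proof -
    have "rGamma (\<nu> + of_nat k + 1) = (\<nu> + of_nat k + 1) * rGamma (\<nu> + 1 + of_nat k + 1)"
      using rGamma_plus1[of "\<nu> + of_nat k + 1"] by (simp add: add_ac)
    thus ?thesis by (simp only: ring_distribs) (simp add: field_simps)
  qed
  have b: "of_nat (Suc k) * ?t (\<nu> + 1) (Suc k) = x * ?t (\<nu> + 2) k" for k
  proof -
    have eq: "\<nu> + 1 + of_nat (Suc k) + 1 = \<nu> + 2 + of_nat k + 1" by simp
    show ?thesis unfolding eq fact_Suc power_Suc by (simp del: of_nat_Suc)
  qed
  have "(\<lambda>k. x * ?t (\<nu> + 2) k) sums (x * bessel_series (\<nu> + 2) x)"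
    unfolding bessel_series_def by (intro sums_mult summable_sums s2)
  hence "(\<lambda>k. of_nat k * ?t (\<nu> + 1) k) sums (x * bessel_series (\<nu> + 2) x)"
    unfolding b[symmetric] by (subst (asm) sums_Suc_iff) simp
  moreover have "(\<lambda>k. (\<nu> + 1) * ?t (\<nu> + 1) k) sums ((\<nu> + 1) * bessel_series (\<nu> + 1) x)"
    unfolding bessel_series_def by (intro sums_mult summable_sums s1)
  ultimately have "?t \<nu> sums (x * bessel_series (\<nu> + 2) x + (\<nu> + 1) * bessel_series (\<nu> + 1) x)"
    unfolding a by (subst add.commute) (rule sums_add)
  thus ?thesis by (simp add: bessel_series_def sums_iff)
qed

lemma holomorphic_bessel_series_order:
  "(\<lambda>\<nu>. bessel_series \<nu> x) holomorphic_on {\<nu>. Re \<nu> > -1}"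
proof -
  have op: "open {\<nu>. Re \<nu> > -1}" by (rule open_halfspace_Re_gt)
  obtain g where g: "\<forall>\<nu>\<in>{\<nu>. Re \<nu> > -1}. ((\<lambda>k. rGamma (\<nu> + of_nat k + 1) / fact k * x ^ k) sums g \<nu>) \<and> g field_differentiable (at \<nu>)"
  proof (rule series_differentiable_comparison_complex[OF op, of "\<lambda>k \<nu>. rGamma (\<nu> + of_nat k + 1) / fact k * x ^ k"])
    show "(\<lambda>\<nu>. rGamma (\<nu> + of_nat k + 1) / fact k * x ^ k) field_differentiable (at \<nu>)" for k \<nu>
      by (rule holomorphic_on_imp_differentiable_at[of _ UNIV]) (auto intro!: holomorphic_intros)
    fix \<nu>0 :: complex assume n0: "\<nu>0 \<in> {\<nu>. Re \<nu> > -1}"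
    define d where "d = min 1 ((1 + Re \<nu>0) / 2)"
    have d: "d > 0" "d \<le> 1" "d \<le> (1 + Re \<nu>0) / 2" using n0 unfolding d_def min_def by (auto split: if_splits)
    have "compact ((\<lambda>\<nu>. rGamma (\<nu> + 1)) ` cball \<nu>0 d)"
      by (intro compact_continuous_image holomorphic_on_imp_continuous_on holomorphic_intros) auto
    then obtain C where C: "\<And>\<nu>. \<nu> \<in> cball \<nu>0 d \<Longrightarrow> norm (rGamma (\<nu> + 1)) \<le> C"
      by (metis bounded_iff compact_imp_bounded imageI)
    have C0: "C \<ge> 0" by (rule order_trans[OF norm_ge_zero C[of \<nu>0]]) (use d in simp)
    let ?h = "\<lambda>k. of_real (C * (sqrt (norm x / d) ^ k / fact k)\<^sup>2) :: complex"
    have sm: "summable ?h"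
      by (subst summable_complex_of_real) (intro summable_mult exp_terms_square, use d in simp)
    have "norm (rGamma (\<nu> + of_nat k + 1) / fact k * x ^ k) \<le> norm (?h k)" if "\<nu> \<in> ball \<nu>0 d" for \<nu> k
    proof -
      have "\<bar>Re (\<nu>0 - \<nu>)\<bar> \<le> norm (\<nu>0 - \<nu>)" by (rule abs_Re_le_cmod)
      hence "d \<le> 1 + Re \<nu>" using that d by (auto simp: dist_norm)
      hence "norm (rGamma (\<nu> + of_nat k + 1) / fact k * x ^ k) \<le> norm (rGamma (\<nu> + 1)) * (sqrt (norm x / d) ^ k / fact k)\<^sup>2"
        using d by (intro bessel_series_term_le) auto
      also have "\<dots> \<le> C * (sqrt (norm x / d) ^ k / fact k)\<^sup>2"
        using that by (intro mult_right_mono C) auto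
      also have "\<dots> = norm (?h k)" using C0 by (simp only: norm_of_real) simp
      finally show ?thesis .
    qed
    thus "\<exists>d h. 0 < d \<and> summable h \<and> range h \<subseteq> \<real>\<^sub>\<ge>\<^sub>0 \<and> (\<forall>\<^sub>F n in sequentially. \<forall>\<nu>\<in>ball \<nu>0 d \<inter> {\<nu>. - 1 < Re \<nu>}. cmod (rGamma (\<nu> + of_nat n + 1) / fact n * x ^ n) \<le> cmod (h n))"
      using d(1) sm C0 by (intro exI[of _ d] exI[of _ ?h]) (auto intro!: always_eventually mult_nonneg_nonneg simp del: of_real_mult of_real_power)
  qed
  have "g holomorphic_on {\<nu>. Re \<nu> > -1}"
    using g by (auto simp: holomorphic_on_def field_differentiable_at_within)
  thus ?thesis
    by (rule holomorphic_transform) (use g in \<open>auto simp: bessel_series_def sums_iff\<close>)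
qed

lemma holomorphic_bessel_series_order' [holomorphic_intros]:
  assumes "f holomorphic_on A" "\<And>\<nu>. \<nu> \<in> A \<Longrightarrow> Re (f \<nu>) > -1"
  shows "(\<lambda>\<nu>. bessel_series (f \<nu>) x) holomorphic_on A"
  using holomorphic_on_compose_gen[OF assms(1) holomorphic_bessel_series_order[of x]] assms(2)
  by (auto simp: o_def)

lemma bessel_J_eq_series: "bessel_J \<nu> x = (x / 2) powr \<nu> * bessel_series \<nu> (- (x\<^sup>2 / 4))"
proof -
  have "(- (x\<^sup>2 / 4)) ^ m = (- 1) ^ m * (x / 2) ^ (2 * m)" for m
    by (subst power_minus) (simp add: power_mult power_divide)
  thus ?thesis unfolding bessel_J_def bessel_series_def by (simp add: mult_ac)
qed

lemma bessel_I_eq_series: "bessel_I \<nu> x = (x / 2) powr \<nu> * bessel_series \<nu> (x\<^sup>2 / 4)"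
  unfolding bessel_I_def bessel_series_def by (simp add: power_mult power_divide)

lemma sin_pi_eq_0_iff: "sin (of_real pi * \<mu>) = 0 \<longleftrightarrow> \<mu> \<in> \<int>" for \<mu> :: complex
proof -
  have "of_real pi * \<mu> = of_real (real_of_int n * pi) \<longleftrightarrow> \<mu> = of_int n" for n :: int
    by (auto simp: field_simps)
  thus ?thesis by (auto simp: sin_eq_0 Ints_def)
qed

lemma small_not_Int:
  assumes "\<bar>Re \<mu>\<bar> < 1" "\<mu> \<noteq> 0"
  shows "\<mu> \<notin> \<int>"
  using assms by (auto elim!: Ints_cases)

text \<open>In $I_\nu + J_\nu$ only the even powers of $x^2/4$ survive. With $y = e^r$ and $x = 4\sqrt{y}$ this is
the series factor of that sum.\<close>
definition even_series :: "complex \<Rightarrow> real \<Rightarrow> complex" where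
  "even_series \<nu> r = bessel_series \<nu> (4 * of_real (exp r)) + bessel_series \<nu> (- 4 * of_real (exp r))"

lemma bessel_JI_exp:
  "bessel_J \<nu> (of_real (4 * sqrt (exp r))) = exp (\<nu> / 2 * of_real (r + ln 4)) * bessel_series \<nu> (- 4 * of_real (exp r))"
  "bessel_I \<nu> (of_real (4 * sqrt (exp r))) = exp (\<nu> / 2 * of_real (r + ln 4)) * bessel_series \<nu> (4 * of_real (exp r))"
proof -
  have sq: "sqrt (exp r) = exp (r / 2)"
    using exp_double[of "r / 2"] by simp
  have ln4: "ln 4 = 2 * ln (2::real)" using ln_realpow[of 2 2] by simp
  have "(of_real (4 * sqrt (exp r)) / 2 :: complex) = of_real (exp (ln 2 + r / 2))"
    by (simp add: sq exp_add del: of_real_exp) 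
  hence p: "(of_real (4 * sqrt (exp r)) / 2 :: complex) powr \<nu> = exp (\<nu> / 2 * of_real (r + ln 4))"
    by (simp add: powr_def ln4 Ln_of_real algebra_simps)
  have x: "(of_real (4 * sqrt (exp r)))\<^sup>2 / 4 = (4 * of_real (exp r) :: complex)"
    by (simp add: power_mult_distrib flip: of_real_power)
  show "bessel_J \<nu> (of_real (4 * sqrt (exp r))) = exp (\<nu> / 2 * of_real (r + ln 4)) * bessel_series \<nu> (- 4 * of_real (exp r))"
    unfolding bessel_J_eq_series p x by simp
  show "bessel_I \<nu> (of_real (4 * sqrt (exp r))) = exp (\<nu> / 2 * of_real (r + ln 4)) * bessel_series \<nu> (4 * of_real (exp r))"
    unfolding bessel_I_eq_series p x by simp
qed

text \<open>By the double-angle formulas the terms containing $J_{2z}$ combine, and the kernel becomes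
$\bigl((I_{-2z}+J_{-2z}) - (I_{2z}+J_{2z})\bigr)/(2\sin \pi z)$ at the argument $4\sqrt y$. The right-hand
side is visibly even in $z$.\<close>
lemma koshliakov_kernel_eq_series:
  assumes z: "\<bar>Re z\<bar> < 1 / 2" "z \<noteq> 0"
  shows "koshliakov_kernel z (exp r) =
    (exp (- z * of_real (r + ln 4)) * even_series (- 2 * z) r - exp (z * of_real (r + ln 4)) * even_series (2 * z) r)
      / (2 * sin (of_real pi * z))"
proof -
  have n: "2 * z \<notin> \<int>" using z by (intro small_not_Int) auto
  have s: "sin (of_real pi * z) \<noteq> 0" unfolding sin_pi_eq_0_iff using z by (intro small_not_Int) auto
  have s2: "sin (of_real pi * (2 * z)) = 2 * sin (of_real pi * z) * cos (of_real pi * z)"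
    using sin_double[of "of_real pi * z"] by (simp add: mult_ac)
  have "sin (of_real pi * (2 * z)) \<noteq> 0" using n by (simp only: sin_pi_eq_0_iff not_False_eq_True)
  hence c: "cos (of_real pi * z) \<noteq> 0" unfolding s2 by auto
  have c2: "cos (of_real pi * (2 * z)) = 1 - 2 * (sin (of_real pi * z))\<^sup>2"
    using cos_double_sin[of "of_real pi * z"] by (simp add: mult_ac)
  define Jp Jm Ip Im where "Jp = bessel_J (2 * z) (of_real (4 * sqrt (exp r)))" "Jm = bessel_J (- (2 * z)) (of_real (4 * sqrt (exp r)))"
    "Ip = bessel_I (2 * z) (of_real (4 * sqrt (exp r)))" "Im = bessel_I (- (2 * z)) (of_real (4 * sqrt (exp r)))"
  define S C where "S = sin (of_real pi * z)" "C = cos (of_real pi * z)"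
  have "koshliakov_kernel z (exp r) = C * (2 / of_real pi * (of_real pi / 2 * (Im - Ip) / (2 * S * C)) - (Jp * (1 - 2 * S\<^sup>2) - Jm) / (2 * S * C)) - S * Jp"
    unfolding koshliakov_kernel_def bessel_M_def bessel_K_def bessel_Y_def Let_def
    using n by (simp only: if_False s2 c2 Jp_Jm_Ip_Im_def S_C_def)
  also have "2 / of_real pi * (of_real pi / 2 * (Im - Ip) / (2 * S * C)) = (Im - Ip) / (2 * S * C)"
  proof -
    have "2 / of_real pi * (of_real pi / 2 * X / Y) = X / Y" for X Y :: complex
      by (cases "Y = 0") (auto simp: field_simps)
    thus ?thesis .
  qed
  also have "C * ((Im - Ip) / (2 * S * C) - (Jp * (1 - 2 * S\<^sup>2) - Jm) / (2 * S * C)) = (Im - Ip - (Jp * (1 - 2 * S\<^sup>2) - Jm)) / (2 * S)"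
    using c unfolding S_C_def[symmetric] by (simp flip: diff_divide_distrib)
  also have "\<dots> - S * Jp = (Im + Jm - (Ip + Jp)) / (2 * S)"
    using s unfolding S_C_def[symmetric] by (simp add: divide_simps) (simp add: algebra_simps power2_eq_square)
  also have "\<dots> = (exp (- z * of_real (r + ln 4)) * even_series (- 2 * z) r - exp (z * of_real (r + ln 4)) * even_series (2 * z) r)
      / (2 * sin (of_real pi * z))"
    unfolding Jp_Jm_Ip_Im_def bessel_JI_exp even_series_def S_C_def by (simp add: ring_distribs)
  finally show ?thesis .
qed

lemma tendsto_over_sin_pi:
  assumes N: "N holomorphic_on ball 0 1" and N0: "N 0 = 0"
  shows "\<exists>l. ((\<lambda>\<mu>. N \<mu> / sin (of_real pi * \<mu>)) \<longlongrightarrow> l) (at (0::complex))"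
proof -
  have "(N has_field_derivative deriv N 0) (at 0)"
    by (rule holomorphic_derivI[OF N]) auto
  hence 1: "((\<lambda>\<mu>. N \<mu> / \<mu>) \<longlongrightarrow> deriv N 0) (at 0)"
    by (simp add: has_field_derivative_iff N0)
  have "((\<lambda>\<mu>::complex. sin (of_real pi * \<mu>)) has_field_derivative of_real pi) (at 0)"
    by (auto intro!: derivative_eq_intros)
  hence 2: "((\<lambda>\<mu>::complex. sin (of_real pi * \<mu>) / \<mu>) \<longlongrightarrow> of_real pi) (at 0)"
    by (simp add: has_field_derivative_iff)
  have "((\<lambda>\<mu>. (N \<mu> / \<mu>) / (sin (of_real pi * \<mu>) / \<mu>)) \<longlongrightarrow> deriv N 0 / of_real pi) (at 0)"
    by (intro tendsto_divide 1 2) auto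
  moreover have "\<forall>\<^sub>F \<mu> in at 0. (N \<mu> / \<mu>) / (sin (of_real pi * \<mu>) / \<mu>) = N \<mu> / sin (of_real pi * \<mu>)"
    by (auto simp: eventually_at_filter)
  ultimately have "((\<lambda>\<mu>. N \<mu> / sin (of_real pi * \<mu>)) \<longlongrightarrow> deriv N 0 / of_real pi) (at 0)"
    by (rule Lim_transform_eventually)
  thus ?thesis by blast
qed

lemma holomorphic_on_bessel_JI:
  assumes "f holomorphic_on A" "\<And>\<nu>. \<nu> \<in> A \<Longrightarrow> Re (f \<nu>) > -1"
  shows "(\<lambda>\<nu>. bessel_J (f \<nu>) (of_real (4 * sqrt (exp r)))) holomorphic_on A"
        "(\<lambda>\<nu>. bessel_I (f \<nu>) (of_real (4 * sqrt (exp r)))) holomorphic_on A"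
  unfolding bessel_JI_exp by (intro holomorphic_intros assms; simp)+

text \<open>At $z = 0$ the functions $K_0$ and $Y_0$ are limits of quotients whose numerator and denominator
have a zero at order 0, the denominator a simple one. The limits therefore exist, and the kernel is
continuous in $z$ there.\<close>
lemma koshliakov_kernel_tendsto_0:
  "((\<lambda>z. koshliakov_kernel z (exp r)) \<longlongrightarrow> koshliakov_kernel 0 (exp r)) (at 0)"
proof -
  let ?x = "complex_of_real (4 * sqrt (exp r))"
  have re: "Re \<nu> < 1" "Re \<nu> > -1" if "\<nu> \<in> ball 0 1" for \<nu>
    using that abs_Re_le_cmod[of \<nu>] by (auto simp: dist_norm)
  have ev: "\<forall>\<^sub>F z in at (0::complex). 2 * z \<notin> \<int>"
  proof -
    have "\<forall>\<^sub>F z in at (0::complex). z \<in> ball 0 (1/2) - {0}"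
      by (intro eventually_at_in_open) auto
    thus ?thesis
    proof eventually_elim
      case (elim z)
      hence "2 * z \<in> ball 0 1" "z \<noteq> 0" by (auto simp: dist_norm norm_mult)
      thus ?case using re[of "2 * z"] by (intro small_not_Int) auto
    qed
  qed
  have fl: "filterlim (\<lambda>z::complex. 2 * z) (at 0) (at 0)"
    by (auto simp: filterlim_at eventually_at_filter intro!: tendsto_eq_intros)
  have hJ: "(\<lambda>\<mu>. bessel_J \<mu> ?x) holomorphic_on ball 0 1" "(\<lambda>\<mu>. bessel_J (- \<mu>) ?x) holomorphic_on ball 0 1"
    and hI: "(\<lambda>\<mu>. bessel_I \<mu> ?x) holomorphic_on ball 0 1" "(\<lambda>\<mu>. bessel_I (- \<mu>) ?x) holomorphic_on ball 0 1"
    by (rule holomorphic_on_bessel_JI; use re in \<open>auto intro: holomorphic_on_minus\<close>)+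
  have hK: "(\<lambda>\<mu>. of_real pi / 2 * (bessel_I (- \<mu>) ?x - bessel_I \<mu> ?x)) holomorphic_on ball 0 1"
    by (intro holomorphic_intros hI)
  have hY: "(\<lambda>\<mu>. bessel_J \<mu> ?x * cos (of_real pi * \<mu>) - bessel_J (- \<mu>) ?x) holomorphic_on ball 0 1"
    by (intro holomorphic_intros hJ)
  obtain lK where lK: "((\<lambda>\<mu>. (of_real pi / 2 * (bessel_I (- \<mu>) ?x - bessel_I \<mu> ?x)) / sin (of_real pi * \<mu>)) \<longlongrightarrow> lK) (at 0)"
    using tendsto_over_sin_pi[OF hK] by auto
  obtain lY where lY: "((\<lambda>\<mu>. (bessel_J \<mu> ?x * cos (of_real pi * \<mu>) - bessel_J (- \<mu>) ?x) / sin (of_real pi * \<mu>)) \<longlongrightarrow> lY) (at 0)"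
    using tendsto_over_sin_pi[OF hY] by auto
  have K0: "bessel_K 0 ?x = lK" unfolding bessel_K_def Let_def using tendsto_Lim[OF _ lK] by simp
  have Y0: "bessel_Y 0 ?x = lY" unfolding bessel_Y_def Let_def using tendsto_Lim[OF _ lY] by simp
  have K: "((\<lambda>z. bessel_K (2 * z) ?x) \<longlongrightarrow> lK) (at 0)"
  proof (rule Lim_transform_eventually[OF filterlim_compose[OF lK fl]])
    show "\<forall>\<^sub>F z in at 0. of_real pi / 2 * (bessel_I (- (2 * z)) ?x - bessel_I (2 * z) ?x) / sin (of_real pi * (2 * z)) = bessel_K (2 * z) ?x"
      using ev by eventually_elim (simp add: bessel_K_def Let_def)
  qed
  have Y: "((\<lambda>z. bessel_Y (2 * z) ?x) \<longlongrightarrow> lY) (at 0)"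
  proof (rule Lim_transform_eventually[OF filterlim_compose[OF lY fl]])
    show "\<forall>\<^sub>F z in at 0. (bessel_J (2 * z) ?x * cos (of_real pi * (2 * z)) - bessel_J (- (2 * z)) ?x) / sin (of_real pi * (2 * z)) = bessel_Y (2 * z) ?x"
      using ev by eventually_elim (simp add: bessel_Y_def Let_def)
  qed
  have "continuous (at 0) (\<lambda>\<mu>. bessel_J \<mu> ?x)"
    by (rule continuous_on_interior[OF holomorphic_on_imp_continuous_on[OF hJ(1)]]) simp
  hence "((\<lambda>\<mu>. bessel_J \<mu> ?x) \<longlongrightarrow> bessel_J 0 ?x) (at 0)" by (simp add: isCont_def)
  from filterlim_compose[OF this fl] have J: "((\<lambda>z. bessel_J (2 * z) ?x) \<longlongrightarrow> bessel_J 0 ?x) (at 0)" .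
  have c: "((\<lambda>z::complex. cos (of_real pi * z)) \<longlongrightarrow> cos (of_real pi * 0)) (at 0)" 
    and s: "((\<lambda>z::complex. sin (of_real pi * z)) \<longlongrightarrow> sin (of_real pi * 0)) (at 0)"
    by (intro tendsto_intros)+
  show ?thesis
    unfolding koshliakov_kernel_def bessel_M_def mult_zero_right K0 Y0
    using tendsto_diff[OF tendsto_mult[OF c tendsto_diff[OF tendsto_mult[OF tendsto_const[of "2 / of_real pi"] K] Y]] tendsto_mult[OF s J]]
    by simp
qed

lemma open_strip: "open {z::complex. \<bar>Re z\<bar> < 1 / 2}"
proof -
  have "{z::complex. \<bar>Re z\<bar> < 1 / 2} = {z. Re z > - (1/2)} \<inter> {z. Re z < 1/2}" by auto
  thus ?thesis using open_halfspace_Re_gt[of "-(1/2)"] open_halfspace_Re_lt[of "1/2"] by auto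
qed

text \<open>The point 0 is a removable singularity, because the kernel is continuous in $z$ there.\<close>
lemma holomorphic_koshliakov_kernel:
  "(\<lambda>z. koshliakov_kernel z (exp r)) holomorphic_on {z. \<bar>Re z\<bar> < 1 / 2}"
proof -
  let ?S = "{z::complex. \<bar>Re z\<bar> < 1 / 2}"
  have h: "(\<lambda>z. koshliakov_kernel z (exp r)) holomorphic_on (?S - {0})"
  proof (rule holomorphic_transform)
    have sn: "sin (of_real pi * z) \<noteq> 0" if "z \<in> ?S - {0}" for z
      unfolding sin_pi_eq_0_iff using that by (intro small_not_Int) auto
    show "(\<lambda>z. (exp (- z * of_real (r + ln 4)) * even_series (- 2 * z) r - exp (z * of_real (r + ln 4)) * even_series (2 * z) r)
      / (2 * sin (of_real pi * z))) holomorphic_on (?S - {0})"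
      unfolding even_series_def using sn by (intro holomorphic_intros) auto
  qed (auto simp: koshliakov_kernel_eq_series)
  have "continuous_on ?S (\<lambda>z. koshliakov_kernel z (exp r))"
  proof (rule continuous_at_imp_continuous_on, rule ballI)
    fix z assume z: "z \<in> ?S"
    show "isCont (\<lambda>z. koshliakov_kernel z (exp r)) z"
    proof (cases "z = 0")
      case True thus ?thesis using koshliakov_kernel_tendsto_0 by (simp add: isCont_def)
    next
      case False
      have "open (?S - {0})" by (intro open_Diff open_strip) auto
      thus ?thesis using holomorphic_on_imp_continuous_on[OF h] z False
        by (subst (asm) continuous_on_eq_continuous_at) auto
    qed
  qed
  thus ?thesis using no_isolated_singularity[OF _ h open_strip] by auto
qed

lemma measurable_koshliakov_kernel_exp:
  assumes "\<bar>Re z\<bar> < 1 / 2"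
  shows "(\<lambda>r. koshliakov_kernel z (exp r)) \<in> borel_measurable borel"
proof -
  have *: "(\<lambda>r. koshliakov_kernel z (exp r)) \<in> borel_measurable borel" if "\<bar>Re z\<bar> < 1 / 2" "z \<noteq> 0" for z
  proof (rule borel_measurable_continuous_onI)
    have "sin (of_real pi * z) \<noteq> 0"
      unfolding sin_pi_eq_0_iff using that by (intro small_not_Int) auto
    thus "continuous_on UNIV (\<lambda>r. koshliakov_kernel z (exp r))"
      unfolding koshliakov_kernel_eq_series[OF that] even_series_def using that
      by (intro continuous_intros) auto
  qed
  show ?thesis
  proof (cases "z = 0")
    case True
    have "filterlim (\<lambda>n. complex_of_real (inverse (real (Suc n)))) (at 0) sequentially"
      using tendsto_of_real[OF LIMSEQ_inverse_real_of_nat, where ?'a=complex]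
      by (auto simp: filterlim_at simp del: of_nat_Suc)
    hence "filterlim (\<lambda>n. complex_of_real (inverse (real (Suc (n + 2))))) (at 0) sequentially"
      by (rule filterlim_compose[OF _ filterlim_add_const_nat_at_top])
    hence lim: "(\<lambda>n. koshliakov_kernel (of_real (inverse (real (Suc (n + 2))))) (exp r)) \<longlonglongrightarrow> koshliakov_kernel z (exp r)" for r
      unfolding True by (rule filterlim_compose[OF koshliakov_kernel_tendsto_0])
    show ?thesis
    proof (rule borel_measurable_LIMSEQ_metric[OF _ lim], rule *)
      fix n
      have "0 < inverse (real (Suc (n + 2)))" "inverse (real (Suc (n + 2))) < 1 / 2" by (simp_all add: field_simps)
      thus "\<bar>Re (complex_of_real (inverse (real (Suc (n + 2)))))\<bar> < 1 / 2" "complex_of_real (inverse (real (Suc (n + 2)))) \<noteq> 0"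
        by (simp_all only: Re_complex_of_real of_real_eq_0_iff)
    qed
  qed (use * assms in auto)
qed

lemma koshliakov_kernel_uminus:
  assumes "\<bar>Re z\<bar> < 1 / 2"
  shows "koshliakov_kernel (- z) (exp r) = koshliakov_kernel z (exp r)"
proof (cases "z = 0")
  case False
  have swap: "(X - Y) / (- D) = (Y - X) / D" for X Y D :: complex
    by (cases "D = 0") (auto simp: field_simps)
  have "\<bar>Re (- z)\<bar> < 1 / 2" "- z \<noteq> 0" using assms False by auto
  from koshliakov_kernel_eq_series[OF this] koshliakov_kernel_eq_series[OF assms False] show ?thesis
    by (simp only: minus_minus mult_minus_left mult_minus_right sin_minus swap)
qed auto

text \<open>The series formula gives no direct bound near $z = 0$, where its denominator vanishes. The estimate is made on a
circle around \<open>z0\<close> that avoids 0 and carried inside by the maximum modulus principle.\<close>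
lemma koshliakov_kernel_locally_bounded:
  assumes "Re z0 = 0"
  shows "\<exists>\<rho> C. 0 < \<rho> \<and> \<rho> \<le> 1 / 8 \<and> C \<ge> 0 \<and>
    (\<forall>z\<in>cball z0 \<rho>. \<forall>r. norm (koshliakov_kernel z (exp r)) \<le> C * exp (\<bar>r\<bar> / 8) * exp (8 * exp (r / 2)))"
proof -
  \<comment> \<open>the radius is chosen so that the circle does not pass through 0\<close>
  define \<rho> :: real where "\<rho> = (if norm z0 = 1 / 8 then 1 / 16 else 1 / 8)"
  have \<rho>: "0 < \<rho>" "\<rho> \<le> 1 / 8" "norm z0 \<noteq> \<rho>" by (auto simp: \<rho>_def)
  have re: "\<bar>Re z\<bar> \<le> 1 / 8" if "z \<in> cball z0 \<rho>" for z
    using abs_Re_le_cmod[of "z0 - z"] that \<rho> assms by (auto simp: dist_norm)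
  let ?K = "sphere z0 \<rho>"
  have K: "\<bar>Re z\<bar> < 1 / 2" "z \<noteq> 0" "\<bar>Re z\<bar> \<le> 1 / 8" if "z \<in> ?K" for z
    using re[of z] that \<rho> by (auto simp: dist_norm)
  have sn: "sin (of_real pi * z) \<noteq> 0" if "z \<in> ?K" for z
    unfolding sin_pi_eq_0_iff using K[OF that] by (intro small_not_Int) auto
  have "compact ((\<lambda>z. (norm (rGamma (- 2 * z + 1)) + norm (rGamma (2 * z + 1))) * norm (1 / sin (of_real pi * z))) ` ?K)"
    by (intro compact_continuous_image continuous_intros)
       (auto intro!: holomorphic_on_imp_continuous_on holomorphic_intros sn)
  then obtain B where B: "\<And>z. z \<in> ?K \<Longrightarrow> (norm (rGamma (- 2 * z + 1)) + norm (rGamma (2 * z + 1))) * norm (1 / sin (of_real pi * z)) \<le> B"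
    by (metis (no_types, lifting) bounded_real compact_imp_bounded imageI abs_le_D1)
  have sph: "norm (koshliakov_kernel z (exp r)) \<le> \<bar>B\<bar> * exp (ln 4 / 8) * exp (\<bar>r\<bar> / 8) * exp (8 * exp (r / 2))" if z: "z \<in> ?K" for z r
  proof -
    have S: "norm (bessel_series \<nu> x) \<le> norm (rGamma (\<nu> + 1)) * exp (8 * exp (r / 2))"
      if "\<bar>Re \<nu>\<bar> \<le> 1 / 4" "norm x = 4 * exp r" for \<nu> x
    proof -
      have "sqrt (norm x / (1/4)) = 4 * exp (r / 2)"
        using that exp_double[of "r / 2"] by (intro real_sqrt_unique) (auto simp: power_mult_distrib)
      thus ?thesis using bessel_series_bound(2)[of "1/4" \<nu> x] that by simp
    qed
    have E: "norm (even_series \<nu> r) \<le> 2 * (norm (rGamma (\<nu> + 1)) * exp (8 * exp (r / 2)))" if "\<bar>Re \<nu>\<bar> \<le> 1 / 4" for \<nu>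
      unfolding even_series_def using S[OF that, of "4 * of_real (exp r)"] S[OF that, of "- 4 * of_real (exp r)"]
      by (intro order_trans[OF norm_triangle_ineq]) (simp add: norm_mult)
    have X: "norm (exp (y * of_real (r + ln 4))) \<le> exp (ln 4 / 8) * exp (\<bar>r\<bar> / 8)" if "\<bar>Re y\<bar> \<le> 1 / 8" for y
    proof -
      have "Re y * (r + ln 4) \<le> \<bar>Re y\<bar> * \<bar>r + ln 4\<bar>" by (metis abs_ge_self abs_mult)
      also have "\<bar>r + ln 4\<bar> \<le> \<bar>r\<bar> + ln 4" using abs_triangle_ineq[of r "ln 4"] by simp
      hence "\<bar>Re y\<bar> * \<bar>r + ln 4\<bar> \<le> 1 / 8 * (\<bar>r\<bar> + ln 4)" using that by (intro mult_mono) auto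
      finally show ?thesis by (simp flip: exp_add)
    qed
    let ?X = "exp (ln 4 / 8) * exp (\<bar>r\<bar> / 8)" and ?E = "exp (8 * exp (r / 2))"
    have "norm (koshliakov_kernel z (exp r)) = norm (exp (- z * of_real (r + ln 4)) * even_series (- 2 * z) r - exp (z * of_real (r + ln 4)) * even_series (2 * z) r)
      / 2 * norm (1 / sin (of_real pi * z))"
      unfolding koshliakov_kernel_eq_series[OF K(1,2)[OF z]] by (simp add: norm_divide norm_mult)
    also have "norm (exp (- z * of_real (r + ln 4)) * even_series (- 2 * z) r - exp (z * of_real (r + ln 4)) * even_series (2 * z) r)
       \<le> norm (exp (- z * of_real (r + ln 4))) * norm (even_series (- 2 * z) r) + norm (exp (z * of_real (r + ln 4))) * norm (even_series (2 * z) r)"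
      by (metis norm_mult norm_triangle_ineq4)
    also have "\<dots> \<le> ?X * (2 * (norm (rGamma (- 2 * z + 1)) * ?E)) + ?X * (2 * (norm (rGamma (2 * z + 1)) * ?E))"
      using K[OF z] by (intro add_mono mult_mono X E) auto
    also have "\<dots> / 2 * norm (1 / sin (of_real pi * z)) = ((norm (rGamma (- 2 * z + 1)) + norm (rGamma (2 * z + 1))) * norm (1 / sin (of_real pi * z))) * (?X * ?E)"
      by (simp add: algebra_simps)
    also have "\<dots> \<le> \<bar>B\<bar> * (?X * ?E)"
      using B[OF z] by (intro mult_right_mono) auto
    finally show ?thesis by (simp add: mult_ac divide_right_mono mult_right_mono)
  qed
  have "norm (koshliakov_kernel z (exp r)) \<le> \<bar>B\<bar> * exp (ln 4 / 8) * exp (\<bar>r\<bar> / 8) * exp (8 * exp (r / 2))" if z: "z \<in> cball z0 \<rho>" for z r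
  proof (rule maximum_modulus_frontier[of "\<lambda>z. koshliakov_kernel z (exp r)" "cball z0 \<rho>"])
    have sub: "cball z0 \<rho> \<subseteq> {z. \<bar>Re z\<bar> < 1 / 2}" using re by force
    show "(\<lambda>z. koshliakov_kernel z (exp r)) holomorphic_on interior (cball z0 \<rho>)"
      using sub interior_subset by (intro holomorphic_on_subset[OF holomorphic_koshliakov_kernel]) blast
    show "continuous_on (closure (cball z0 \<rho>)) (\<lambda>z. koshliakov_kernel z (exp r))"
      using sub by (intro holomorphic_on_imp_continuous_on holomorphic_on_subset[OF holomorphic_koshliakov_kernel]) auto
    show "cmod (koshliakov_kernel z (exp r)) \<le> \<bar>B\<bar> * exp (ln 4 / 8) * exp (\<bar>r\<bar> / 8) * exp (8 * exp (r / 2))" if "z \<in> frontier (cball z0 \<rho>)" for z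
      using that \<rho> by (intro sph) (simp add: frontier_cball)
  qed (use z in auto)
  thus ?thesis using \<rho> by (intro exI[of _ \<rho>] exI[of _ "\<bar>B\<bar> * exp (ln 4 / 8)"]) auto
qed

section \<open>A Laplace integral in closed form\<close>

text \<open>This is $\int_0^\infty e^{-pv-q/v}v^{\nu-1}\,dv = 2(q/p)^{\nu/2}K_\nu(2\sqrt{pq})$. Keeping \<open>p\<close> and \<open>q\<close>
separate avoids the branch of $\sqrt{pq}$ when both approach the imaginary axis.\<close>
definition laplace_pair :: "complex \<Rightarrow> complex \<Rightarrow> complex \<Rightarrow> complex" where
  "laplace_pair \<nu> p q = (LBINT y. exp (\<nu> * of_real y - p * of_real (exp y) - q * of_real (exp (- y))))"

lemma integrable_laplace_pair:
  assumes "Re p > 0" "Re q > 0"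
  shows "integrable lborel (\<lambda>y. exp (\<nu> * of_real y - p * of_real (exp y) - q * of_real (exp (- y))))"
  by (rule Bochner_Integration.integrable_bound[OF integrable_two_sided_weight[OF assms, of "Re \<nu>"]])
     auto

lemma laplace_pair_swap: "laplace_pair \<nu> p q = laplace_pair (- \<nu>) q p"
  unfolding laplace_pair_def
  by (subst lborel_integral_reflect[symmetric, of _ 0]) (simp add: algebra_simps)

lemma laplace_pair_scale:
  assumes "t > 0"
  shows "laplace_pair \<nu> (of_real t) q = exp (- \<nu> * of_real (ln t)) * laplace_pair \<nu> 1 (of_real t * q)"
proof -
  have "laplace_pair \<nu> (of_real t) q = (LBINT y. exp (\<nu> * of_real (- ln t + y) - of_real t * of_real (exp (- ln t + y)) - q * of_real (exp (- (- ln t + y)))))"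
    unfolding laplace_pair_def by (rule lborel_integral_shift[symmetric])
  also have "\<dots> = (LBINT y. exp (- \<nu> * of_real (ln t)) * exp (\<nu> * of_real y - 1 * of_real (exp y) - of_real t * q * of_real (exp (- y))))"
  proof (intro Bochner_Integration.integral_cong refl)
    fix y :: real
    have e1: "t * exp (- ln t + y) = exp y" "exp (- (- ln t + y)) = t * exp (- y)"
      using assms by (simp_all add: exp_add exp_diff exp_minus field_simps)
    have "complex_of_real t * of_real (exp (- ln t + y)) = of_real (exp y)" by (simp only: e1(1) flip: of_real_mult)
    moreover have "complex_of_real (exp (- (- ln t + y))) = of_real t * of_real (exp (- y))" by (simp only: e1(2) of_real_mult)
    ultimately show "exp (\<nu> * of_real (- ln t + y) - of_real t * of_real (exp (- ln t + y)) - q * of_real (exp (- (- ln t + y)))) =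
      exp (- \<nu> * of_real (ln t)) * exp (\<nu> * of_real y - 1 * of_real (exp y) - of_real t * q * of_real (exp (- y)))"
      by (simp only: exp_add[symmetric]) (simp add: algebra_simps)
  qed
  finally show ?thesis by (simp add: laplace_pair_def)
qed

text \<open>The second-order Taylor remainder of the exponential is dominated, uniformly in the increment, by an
integrable function with half of the damping at \<open>q\<close>.\<close>
lemma laplace_pair_DERIV:
  assumes p: "Re p > 0" and q: "Re q > 0"
  shows "(laplace_pair \<nu> p has_field_derivative - laplace_pair (\<nu> - 1) p q) (at q)"
proof -
  define E where "E = (\<lambda>q y::real. exp (\<nu> * of_real y - p * of_real (exp y) - q * of_real (exp (- y))))"
  define w where "w = (\<lambda>y::real. exp ((Re \<nu> - 2) * y - Re p * exp y - Re q / 2 * exp (- y)))"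
  define K where "K = (LBINT y. w y)"
  have wint: "integrable lborel w"
    unfolding w_def using p q by (intro integrable_two_sided_weight) auto
  have bound: "norm (laplace_pair \<nu> p (q + h) - laplace_pair \<nu> p q + h * laplace_pair (\<nu> - 1) p q) \<le> K * (norm h)\<^sup>2"
    if h: "norm h \<le> Re q / 2" for h
  proof -
    have "\<bar>Re h\<bar> \<le> norm h" by (rule abs_Re_le_cmod)
    hence qh: "Re (q + h) > 0" using h q by simp
    have i1: "integrable lborel (E (q + h))" and i2: "integrable lborel (E q)"
      unfolding E_def using p q qh by (auto intro: integrable_laplace_pair)
    have E3: "exp ((\<nu> - 1) * of_real y - p * of_real (exp y) - q * of_real (exp (- y))) = of_real (exp (- y)) * E q y" for y :: real
      unfolding E_def by (simp add: exp_of_real[symmetric] algebra_simps flip: exp_add)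
    have i3: "integrable lborel (\<lambda>y. of_real (exp (- y)) * E q y)"
      using integrable_laplace_pair[OF p q, of "\<nu> - 1"] unfolding E3 .
    have "laplace_pair \<nu> p (q + h) - laplace_pair \<nu> p q + h * laplace_pair (\<nu> - 1) p q
       = (LBINT y. E (q + h) y - E q y + h * (of_real (exp (- y)) * E q y))"
    proof -
      have "laplace_pair \<nu> p (q + h) = (LBINT y. E (q + h) y)" "laplace_pair \<nu> p q = (LBINT y. E q y)"
        "laplace_pair (\<nu> - 1) p q = (LBINT y. of_real (exp (- y)) * E q y)"
        by (simp_all only: laplace_pair_def E3) (simp_all only: E_def)
      thus ?thesis using i1 i2 i3 by simp
    qed
    also have "norm \<dots> \<le> (LBINT y. (norm h)\<^sup>2 * w y)"
    proof (rule Bochner_Integration.integral_norm_bound_integral)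
      show "integrable lborel (\<lambda>y. E (q + h) y - E q y + h * (of_real (exp (- y)) * E q y))"
        by (intro Bochner_Integration.integrable_add Bochner_Integration.integrable_diff integrable_mult_right i1 i2 i3)
      show "integrable lborel (\<lambda>y. (norm h)\<^sup>2 * w y)" by (intro integrable_mult_right wint)
      fix y :: real
      define Z where "Z = - h * of_real (exp (- y))"
      have "E (q + h) y = E q y * exp Z"
        unfolding E_def Z_def by (simp add: algebra_simps flip: exp_add)
      hence "E (q + h) y - E q y + h * (of_real (exp (- y)) * E q y) = E q y * (exp Z - (1 + Z))"
        by (simp add: Z_def algebra_simps)
      also have "norm \<dots> \<le> norm (E q y) * (exp \<bar>Re Z\<bar> * (norm Z)\<^sup>2)"
        using Taylor_exp[of Z 1] by (simp add: norm_mult mult_left_mono power2_eq_square)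
      also have "\<dots> \<le> norm (E q y) * (exp (norm h * exp (- y)) * (norm Z)\<^sup>2)"
        using abs_Re_le_cmod[of Z] by (intro mult_left_mono mult_right_mono) (auto simp: Z_def norm_mult)
      also have "\<dots> \<le> norm (E q y) * (exp (Re q / 2 * exp (- y)) * (norm Z)\<^sup>2)"
        using h by (intro mult_left_mono mult_right_mono) auto
      also have "(norm Z)\<^sup>2 = (norm h)\<^sup>2 * exp (- 2 * y)"
        using exp_double[of "-y"] by (simp add: Z_def norm_mult power_mult_distrib)
      also have "norm (E q y) * (exp (Re q / 2 * exp (- y)) * ((norm h)\<^sup>2 * exp (- 2 * y))) = (norm h)\<^sup>2 * (norm (E q y) * exp (Re q / 2 * exp (- y)) * exp (- 2 * y))"
        by (simp only: mult_ac)
      also have "norm (E q y) * exp (Re q / 2 * exp (- y)) * exp (- 2 * y) = w y"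
        unfolding E_def w_def by (simp add: algebra_simps flip: exp_add)
      finally show "norm (E (q + h) y - E q y + h * (of_real (exp (- y)) * E q y)) \<le> (norm h)\<^sup>2 * w y" .
    qed
    also have "\<dots> = K * (norm h)\<^sup>2" by (simp add: K_def)
    finally show ?thesis .
  qed
  show ?thesis unfolding DERIV_def
  proof (rule LIM_zero_cancel, rule Lim_null_comparison)
    have "((\<lambda>h::complex. K * norm h) \<longlongrightarrow> K * norm (0::complex)) (at 0)" by (intro tendsto_intros)
    thus "((\<lambda>h::complex. K * norm h) \<longlongrightarrow> 0) (at 0)" by simp
    have "\<forall>\<^sub>F h in at (0::complex). h \<in> ball 0 (Re q / 2) - {0}"
      using q by (intro eventually_at_in_open) auto
    thus "\<forall>\<^sub>F h in at 0. norm ((laplace_pair \<nu> p (q + h) - laplace_pair \<nu> p q) / h - - laplace_pair (\<nu> - 1) p q) \<le> K * norm h"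
    proof eventually_elim
      case (elim h)
      hence h: "h \<noteq> 0" "norm h \<le> Re q / 2" by auto
      have "(laplace_pair \<nu> p (q + h) - laplace_pair \<nu> p q) / h - - laplace_pair (\<nu> - 1) p q
         = (laplace_pair \<nu> p (q + h) - laplace_pair \<nu> p q + h * laplace_pair (\<nu> - 1) p q) / h"
        using h by (simp add: field_simps)
      also have "norm \<dots> \<le> K * (norm h)\<^sup>2 / norm h"
        unfolding norm_divide by (intro divide_right_mono bound h) auto
      also have "\<dots> = K * norm h" using h by (simp add: power2_eq_square)
      finally show ?case .
    qed
  qed
qed

lemma holomorphic_laplace_pair:
  assumes "Re p > 0"
  shows "laplace_pair \<nu> p holomorphic_on {q. Re q > 0}"
    and "(\<lambda>q. laplace_pair \<nu> q p) holomorphic_on {q. Re q > 0}"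
proof -
  show *: "laplace_pair \<nu> p holomorphic_on {q. Re q > 0}" for \<nu>
    using laplace_pair_DERIV[OF assms] 
    by (auto simp: holomorphic_on_def field_differentiable_def intro: has_field_derivative_at_within)
  show "(\<lambda>q. laplace_pair \<nu> q p) holomorphic_on {q. Re q > 0}"
    using *[of "- \<nu>"] by (subst laplace_pair_swap)
qed

lemma laplace_pair_tendsto_Gamma:
  assumes "Re \<nu> > 0"
  shows "((\<lambda>q. laplace_pair \<nu> 1 (of_real q)) \<longlongrightarrow> Gamma \<nu>) (at_right (0::real))"
proof (rule tendsto_at_right_sequentially[of 0 1])
  fix S :: "nat \<Rightarrow> real" assume S: "\<And>n. 0 < S n" "S \<longlonglongrightarrow> 0"
  have "(\<lambda>n. laplace_pair \<nu> 1 (of_real (S n))) \<longlonglongrightarrow> (LBINT y. exp (\<nu> * of_real y - of_real (exp y)))"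
    unfolding laplace_pair_def
  proof (rule integral_dominated_convergence[where w = "\<lambda>y. exp (Re \<nu> * y - 1 * exp y)"])
    show "integrable lborel (\<lambda>y. exp (Re \<nu> * y - 1 * exp y))"
      using assms by (intro integrable_exp_minus_exp) auto
    show "AE y in lborel. (\<lambda>n. exp (\<nu> * of_real y - 1 * of_real (exp y) - of_real (S n) * of_real (exp (- y)))) \<longlonglongrightarrow> exp (\<nu> * of_real y - of_real (exp y))"
    proof (intro AE_I2)
      fix y :: real
      have "(\<lambda>n. exp (\<nu> * of_real y - 1 * of_real (exp y) - of_real (S n) * of_real (exp (- y)))) \<longlonglongrightarrow> exp (\<nu> * of_real y - 1 * of_real (exp y) - of_real 0 * of_real (exp (- y)))"
        by (intro tendsto_intros S)
      thus "(\<lambda>n. exp (\<nu> * of_real y - 1 * of_real (exp y) - of_real (S n) * of_real (exp (- y)))) \<longlonglongrightarrow> exp (\<nu> * of_real y - of_real (exp y))"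
        by simp
    qed
    show "AE y in lborel. norm (exp (\<nu> * of_real y - 1 * of_real (exp y) - of_real (S n) * of_real (exp (- y)))) \<le> exp (Re \<nu> * y - 1 * exp y)" for n
      using S(1)[of n] by (simp add: less_imp_le)
  qed measurable
  thus "(\<lambda>n. laplace_pair \<nu> 1 (of_real (S n))) \<longlonglongrightarrow> Gamma \<nu>"
    using Gamma_exp_integral(2)[OF assms] by simp
qed simp

text \<open>The coefficients $q^{\nu-1}$ and $q^{-\nu}$ are singular at 0 but integrable there. Near 0, integrating
one equation halves any bound on the other function, so that the bounds tend to 0.\<close>
lemma coupled_singular_system_zero:
  fixes F G :: "real \<Rightarrow> complex"
  assumes \<nu>: "0 < Re \<nu>" "Re \<nu> < 1"
    and F': "\<And>q. q > 0 \<Longrightarrow> (F has_vector_derivative - (of_real q powr (\<nu> - 1) * G q)) (at q)"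
    and G': "\<And>q. q > 0 \<Longrightarrow> (G has_vector_derivative - (of_real q powr (- \<nu>) * F q)) (at q)"
    and F0: "(F \<longlongrightarrow> 0) (at_right 0)" and G0: "(G \<longlongrightarrow> 0) (at_right 0)"
  shows "\<exists>\<delta>>0. \<forall>q\<in>{0<..\<delta>}. F q = 0"
proof -
  define \<sigma> where "\<sigma> = Re \<nu>"
  have \<sigma>: "0 < \<sigma>" "\<sigma> < 1" using \<nu> by (auto simp: \<sigma>_def)
  have powr_small: "\<forall>\<^sub>F q in at_right 0. q powr s \<le> s / 2" if "s > 0" for s :: real
  proof -
    have "((\<lambda>q. q powr s) \<longlongrightarrow> 0) (at_right (0::real))" using that by real_asymp
    from order_tendstoD(2)[OF this, of "s / 2"] that show ?thesis
      by (auto elim: eventually_mono)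
  qed
  have "\<forall>\<^sub>F q in at_right 0. q powr \<sigma> \<le> \<sigma> / 2 \<and> q powr (1 - \<sigma>) \<le> (1 - \<sigma>) / 2 \<and> norm (F q) < 1 \<and> norm (G q) < 1"
    using powr_small[of \<sigma>] powr_small[of "1 - \<sigma>"] \<sigma>
      order_tendstoD(2)[OF tendsto_norm_zero[OF F0], of 1] order_tendstoD(2)[OF tendsto_norm_zero[OF G0], of 1]
    by (auto intro!: eventually_conj)
  then obtain b where b: "b > 0" "\<And>q. 0 < q \<Longrightarrow> q < b \<Longrightarrow> q powr \<sigma> \<le> \<sigma> / 2 \<and> q powr (1 - \<sigma>) \<le> (1 - \<sigma>) / 2 \<and> norm (F q) < 1 \<and> norm (G q) < 1"
    unfolding eventually_at_right_field by blast
  have step: "norm (f q) \<le> M / 2"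
    if f': "\<And>q. q > 0 \<Longrightarrow> (f has_vector_derivative - (of_real q powr \<mu> * g q)) (at q)"
      and \<mu>: "Re \<mu> = s - 1" "s > 0"
      and f0: "(f \<longlongrightarrow> 0) (at_right 0)"
      and g: "\<And>r. 0 < r \<Longrightarrow> r < b \<Longrightarrow> norm (g r) \<le> M"
      and sm: "\<And>r. 0 < r \<Longrightarrow> r < b \<Longrightarrow> r powr s \<le> s / 2"
      and q: "0 < q" "q < b"
    for f g :: "real \<Rightarrow> complex" and \<mu> s M q
  proof -
    have M: "M \<ge> 0" by (rule order_trans[OF norm_ge_zero g[OF q]])
    have "norm (f q) \<le> M / 2 + norm (f \<eta>)" if \<eta>: "0 < \<eta>" "\<eta> < q" for \<eta>
    proof -
      have "norm (f q - f \<eta>) \<le> M * q powr s / s - M * \<eta> powr s / s"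
      proof (rule differentiable_bound_general[OF \<eta>(2)])
        show "continuous_on {\<eta>..q} f"
          using f' \<eta> by (intro continuous_at_imp_continuous_on ballI)
            (auto intro!: has_vector_derivative_continuous[OF f'])
        show "continuous_on {\<eta>..q} (\<lambda>x. M * x powr s / s)"
          using \<eta> \<mu> by (intro continuous_intros) auto
        fix x assume x: "\<eta> < x" "x < q"
        show "(f has_vector_derivative - (of_real x powr \<mu> * g x)) (at x)"
          using x \<eta> by (intro f') auto
        have "((\<lambda>x. M * x powr s / s) has_real_derivative M * x powr (s - 1)) (at x)"
          using x \<eta> \<mu> by (auto intro!: derivative_eq_intros)
        thus "((\<lambda>x. M * x powr s / s) has_vector_derivative M * x powr (s - 1)) (at x)"
          by (simp add: has_real_derivative_iff_has_vector_derivative)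
        have "norm (complex_of_real x powr \<mu>) = x powr (s - 1)"
          using x \<eta> \<mu> by (simp add: norm_powr_real_powr)
        thus "norm (- (of_real x powr \<mu> * g x)) \<le> M * x powr (s - 1)"
          using g[of x] x \<eta> q by (simp add: norm_mult mult.commute mult_right_mono)
      qed
      also have "\<dots> \<le> M * q powr s / s" using M \<mu> by simp
      also have "\<dots> \<le> M * (s / 2) / s"
        using M \<mu> sm[OF q] by (intro divide_right_mono mult_left_mono) auto
      also have "\<dots> = M / 2" using \<mu> by simp
      finally have "norm (f q - f \<eta>) \<le> M / 2" .
      thus ?thesis using norm_triangle_ineq[of "f q - f \<eta>" "f \<eta>"] by simp
    qed
    hence "\<forall>\<^sub>F \<eta> in at_right 0. norm (f q) \<le> M / 2 + norm (f \<eta>)"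
      unfolding eventually_at_right_field using q by blast
    moreover have "((\<lambda>\<eta>. M / 2 + norm (f \<eta>)) \<longlongrightarrow> M / 2 + 0) (at_right 0)"
      by (intro tendsto_intros tendsto_norm_zero f0)
    ultimately show ?thesis
      using tendsto_lowerbound[of "\<lambda>\<eta>. M / 2 + norm (f \<eta>)" "M / 2 + 0" "at_right 0" "norm (f q)"] by simp
  qed
  have ind: "\<forall>q. 0 < q \<longrightarrow> q < b \<longrightarrow> norm (F q) \<le> (1 / 2) ^ n \<and> norm (G q) \<le> (1 / 2) ^ n" for n
  proof (induction n)
    case 0 thus ?case using b by (auto intro: less_imp_le)
  next
    case (Suc n)
    have "norm (F q) \<le> (1 / 2) ^ n / 2" if "0 < q" "q < b" for q
      by (rule step[OF F' _ _ F0, where s = \<sigma>]) (use Suc b \<sigma> that in \<open>auto simp: \<sigma>_def\<close>)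
    moreover have "norm (G q) \<le> (1 / 2) ^ n / 2" if "0 < q" "q < b" for q
      by (rule step[OF G' _ _ G0, where s = "1 - \<sigma>"]) (use Suc b \<sigma> that in \<open>auto simp: \<sigma>_def\<close>)
    ultimately show ?case by (simp add: field_simps)
  qed
  have "F q = 0" if "q \<in> {0<..b / 2}" for q
  proof -
    have "(\<lambda>n. (1 / 2) ^ n :: real) \<longlonglongrightarrow> 0" by (rule LIMSEQ_power_zero) simp
    moreover have "\<forall>\<^sub>F n in sequentially. norm (F q) \<le> (1 / 2) ^ n"
      using ind that b(1) by (intro always_eventually allI) auto
    ultimately have "norm (F q) \<le> 0" by (intro tendsto_lowerbound[of _ 0 sequentially]) auto
    thus ?thesis by simp
  qed
  thus ?thesis using b(1) by (intro exI[of _ "b / 2"]) auto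
qed

text \<open>The closed form of \<open>laplace_pair\<close>: up to a power of $q/p$ a constant multiple of $I_{-\nu} - I_\nu$ at
$2\sqrt{pq}$, written with separate powers of \<open>p\<close> and \<open>q\<close>.\<close>
definition laplace_series :: "complex \<Rightarrow> complex \<Rightarrow> complex \<Rightarrow> complex" where
  "laplace_series \<nu> p q = of_real pi / sin (of_real pi * \<nu>) *
     (p powr (- \<nu>) * bessel_series (- \<nu>) (p * q) - q powr \<nu> * bessel_series \<nu> (p * q))"

text \<open>Together with the same formula for order $1-\nu$ this is the singular system of
the lemma \<open>coupled_singular_system_zero\<close>.\<close>
lemma laplace_series_DERIV:
  assumes \<nu>: "0 < Re \<nu>" "Re \<nu> < 1" and q: "Re q > 0"
  shows "(laplace_series \<nu> 1 has_field_derivative - (q powr (\<nu> - 1) * laplace_series (1 - \<nu>) 1 q)) (at q)"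
proof -
  have q0: "q \<notin> \<real>\<^sub>\<le>\<^sub>0" "q \<noteq> 0" using q by (auto elim!: nonpos_Reals_cases)
  have rec: "bessel_series (\<nu> - 1) q = \<nu> * bessel_series \<nu> q + q * bessel_series (\<nu> + 1) q"
    using bessel_series_recurrence[of "\<nu> - 1" q] \<nu> by (simp add: add.commute)
  have sin: "sin (of_real pi * (1 - \<nu>)) = sin (of_real pi * \<nu>)"
    using sin_diff[of "of_real pi" "of_real pi * \<nu>"] by (simp add: right_diff_distrib)
  have pw: "q powr \<nu> = q * q powr (\<nu> - 1)" "q powr (\<nu> - 1) * q powr (1 - \<nu>) = 1"
    using q0 by (simp_all add: powr_diff flip: powr_add)
  have "((\<lambda>q. bessel_series (- \<nu>) q - q powr \<nu> * bessel_series \<nu> q) has_field_derivative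
    bessel_series (- \<nu> + 1) q - (\<nu> * q powr (\<nu> - 1) * bessel_series \<nu> q + q powr \<nu> * bessel_series (\<nu> + 1) q)) (at q)"
    using \<nu> q0 by (auto intro!: derivative_eq_intros has_field_derivative_bessel_series has_field_derivative_powr)
  also have "bessel_series (- \<nu> + 1) q - (\<nu> * q powr (\<nu> - 1) * bessel_series \<nu> q + q powr \<nu> * bessel_series (\<nu> + 1) q)
    = - (q powr (\<nu> - 1) * (bessel_series (\<nu> - 1) q - q powr (1 - \<nu>) * bessel_series (1 - \<nu>) q))"
    unfolding rec pw(1) using pw(2) by (simp add: algebra_simps)
  finally have D: "((\<lambda>q. bessel_series (- \<nu>) q - q powr \<nu> * bessel_series \<nu> q) has_field_derivative
      - (q powr (\<nu> - 1) * (bessel_series (\<nu> - 1) q - q powr (1 - \<nu>) * bessel_series (1 - \<nu>) q))) (at q)" .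
  have s1: "laplace_series \<nu> 1 = (\<lambda>q. of_real pi / sin (of_real pi * \<nu>) * (bessel_series (- \<nu>) q - q powr \<nu> * bessel_series \<nu> q))"
    by (simp add: laplace_series_def fun_eq_iff)
  have s2: "laplace_series (1 - \<nu>) 1 q = of_real pi / sin (of_real pi * \<nu>) * (bessel_series (\<nu> - 1) q - q powr (1 - \<nu>) * bessel_series (1 - \<nu>) q)"
    by (simp add: laplace_series_def sin)
  have "(laplace_series \<nu> 1 has_field_derivative of_real pi / sin (of_real pi * \<nu>) *
      (- (q powr (\<nu> - 1) * (bessel_series (\<nu> - 1) q - q powr (1 - \<nu>) * bessel_series (1 - \<nu>) q)))) (at q)"
    unfolding s1 by (rule DERIV_cmult[OF D])
  also have "of_real pi / sin (of_real pi * \<nu>) *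
      (- (q powr (\<nu> - 1) * (bessel_series (\<nu> - 1) q - q powr (1 - \<nu>) * bessel_series (1 - \<nu>) q))) = - (q powr (\<nu> - 1) * laplace_series (1 - \<nu>) 1 q)"
    unfolding s2 by (simp only: mult_ac mult_minus_right)
  finally show ?thesis .
qed

lemma laplace_series_tendsto_Gamma:
  assumes \<nu>: "0 < Re \<nu>" "Re \<nu> < 1"
  shows "((\<lambda>q. laplace_series \<nu> 1 (of_real q)) \<longlongrightarrow> Gamma \<nu>) (at_right (0::real))"
proof -
  have S: "((\<lambda>q. bessel_series \<mu> (of_real q)) \<longlongrightarrow> bessel_series \<mu> (of_real 0)) (at_right (0::real))" if "Re \<mu> > -1" for \<mu>
  proof -
    have "continuous_on UNIV (\<lambda>q::real. bessel_series \<mu> (of_real q))"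
      using that by (intro continuous_intros)
    hence "isCont (\<lambda>q::real. bessel_series \<mu> (of_real q)) 0"
      by (simp add: continuous_on_eq_continuous_at)
    thus ?thesis by (auto simp: isCont_def intro: filterlim_mono[OF _ order_refl at_le])
  qed
  have "((\<lambda>q. q powr Re \<nu>) \<longlongrightarrow> 0) (at_right (0::real))" using \<nu> by real_asymp
  hence P: "((\<lambda>q::real. complex_of_real q powr \<nu>) \<longlongrightarrow> 0) (at_right 0)"
  proof (rule Lim_null_comparison[rotated])
    show "\<forall>\<^sub>F q in at_right 0. norm (complex_of_real q powr \<nu>) \<le> q powr Re \<nu>"
      using eventually_at_right_less[of "0::real"] by eventually_elim (simp add: norm_powr_real_powr)
  qed
  have "((\<lambda>q::real. of_real pi / sin (of_real pi * \<nu>) * (bessel_series (- \<nu>) (of_real q) - of_real q powr \<nu> * bessel_series \<nu> (of_real q))) \<longlongrightarrow>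
     of_real pi / sin (of_real pi * \<nu>) * (bessel_series (- \<nu>) (of_real 0) - 0 * bessel_series \<nu> (of_real 0))) (at_right 0)"
    by (intro tendsto_intros S P) (use \<nu> in auto)
  also have "bessel_series (- \<nu>) (of_real 0) = rGamma (1 - \<nu>)"
    using powser_zero[of "\<lambda>k. rGamma (- \<nu> + of_nat k + 1) / fact k"] by (simp add: bessel_series_def)
  also have "of_real pi / sin (of_real pi * \<nu>) * (rGamma (1 - \<nu>) - 0 * bessel_series \<nu> (of_real 0)) = Gamma \<nu>"
  proof -
    have "1 - \<nu> \<notin> \<int>\<^sub>\<le>\<^sub>0"
    proof
      have "Re x \<le> 0" if "x \<in> \<int>\<^sub>\<le>\<^sub>0" for x :: complex using that by (auto elim!: nonpos_Ints_cases)
      moreover assume "1 - \<nu> \<in> \<int>\<^sub>\<le>\<^sub>0"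
      ultimately have "Re (1 - \<nu>) \<le> 0" by blast
      thus False using \<nu> by simp
    qed
    hence "Gamma (1 - \<nu>) \<noteq> 0" by (simp add: Gamma_eq_zero_iff)
    hence "Gamma \<nu> * Gamma (1 - \<nu>) * rGamma (1 - \<nu>) = Gamma \<nu>" by (simp add: rGamma_inverse_Gamma)
    thus ?thesis by (simp add: Gamma_reflection_complex)
  qed
  finally show ?thesis by (simp add: laplace_series_def)
qed

lemma holomorphic_zero_of_zero_on_interval:
  assumes hol: "f holomorphic_on {q. Re q > 0}" and d: "\<delta> > 0"
    and zero: "\<And>q. 0 < q \<Longrightarrow> q \<le> \<delta> \<Longrightarrow> f (of_real q) = 0" and w: "Re w > 0"
  shows "f w = 0"
proof (rule analytic_continuation[OF hol open_halfspace_Re_gt, where U = "of_real ` {0<..\<delta>}" and \<xi> = "of_real (\<delta> / 2)"])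
  show "connected {q. 0 < Re q}" by (intro convex_connected convex_halfspace_Re_gt)
  show "complex_of_real (\<delta> / 2) islimpt of_real ` {0<..\<delta>}"
    unfolding islimpt_sequential
  proof (intro exI conjI allI)
    let ?s = "\<lambda>n. complex_of_real (\<delta> / 2 + \<delta> / 2 * inverse (real (Suc n)))"
    show "?s n \<in> of_real ` {0<..\<delta>} - {of_real (\<delta> / 2)}" for n
    proof -
      have "inverse (real (Suc n)) > 0" "inverse (real (Suc n)) \<le> 1" by (auto simp: field_simps)
      hence "\<delta> * inverse (real (Suc n)) \<le> \<delta> * 1" "\<delta> * inverse (real (Suc n)) > 0"
        using d by (auto intro!: mult_left_mono simp del: of_nat_Suc)
      hence "\<delta> / 2 + \<delta> / 2 * inverse (real (Suc n)) \<in> {0<..\<delta>}" "\<delta> / 2 + \<delta> / 2 * inverse (real (Suc n)) \<noteq> \<delta> / 2"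
        unfolding greaterThanAtMost_iff using d by argo+
      thus ?thesis unfolding Diff_iff singleton_iff of_real_eq_iff by (intro conjI imageI)
    qed
    have "?s \<longlonglongrightarrow> of_real (\<delta> / 2 + \<delta> / 2 * 0)"
      by (intro tendsto_intros LIMSEQ_inverse_real_of_nat)
    thus "?s \<longlonglongrightarrow> of_real (\<delta> / 2)" by simp
  qed
qed (use d zero w in auto)

lemma laplace_pair_eq_series_1:
  assumes \<nu>: "0 < Re \<nu>" "Re \<nu> < 1" and q: "Re q > 0"
  shows "laplace_pair \<nu> 1 q = laplace_series \<nu> 1 q"
proof -
  \<comment> \<open>Both sides obey the same first-order system, and both tend to \<open>Gamma \<mu>\<close> at 0.\<close>
  define D where "D = (\<lambda>\<mu> q::real. laplace_pair \<mu> 1 (of_real q) - laplace_series \<mu> 1 (of_real q))"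
  have D': "(D \<mu> has_vector_derivative - (of_real q powr (\<mu> - 1) * D (1 - \<mu>) q)) (at q)"
    if \<mu>: "0 < Re \<mu>" "Re \<mu> < 1" and q: "q > 0" for \<mu> q
  proof -
    have "laplace_pair (\<mu> - 1) 1 (of_real q) = laplace_pair (1 - \<mu>) (of_real q) 1"
      by (subst laplace_pair_swap) simp
    also have "\<dots> = of_real q powr (\<mu> - 1) * laplace_pair (1 - \<mu>) 1 (of_real q)"
      using q by (subst laplace_pair_scale) (auto simp: powr_def Ln_of_real algebra_simps)
    finally have e: "laplace_pair (\<mu> - 1) 1 (of_real q) = of_real q powr (\<mu> - 1) * laplace_pair (1 - \<mu>) 1 (of_real q)" .
    have "((\<lambda>q. laplace_pair \<mu> 1 q - laplace_series \<mu> 1 q) has_field_derivative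
       - laplace_pair (\<mu> - 1) 1 (of_real q) - - (of_real q powr (\<mu> - 1) * laplace_series (1 - \<mu>) 1 (of_real q))) (at (of_real q))"
      using \<mu> q by (intro DERIV_diff laplace_pair_DERIV laplace_series_DERIV) auto
    from has_vector_derivative_real_field[OF this] show ?thesis
      unfolding D_def e by (simp add: algebra_simps)
  qed
  have D0: "(D \<mu> \<longlongrightarrow> 0) (at_right 0)" if \<mu>: "0 < Re \<mu>" "Re \<mu> < 1" for \<mu>
    using tendsto_diff[OF laplace_pair_tendsto_Gamma laplace_series_tendsto_Gamma, of \<mu> \<mu>] \<mu> by (simp add: D_def)
  have "\<exists>\<delta>>0. \<forall>q\<in>{0<..\<delta>}. D \<nu> q = 0"
  proof (rule coupled_singular_system_zero[OF \<nu>])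
    show "(D (1 - \<nu>) has_vector_derivative - (of_real q powr (- \<nu>) * D \<nu> q)) (at q)" if "q > 0" for q
      using D'[of "1 - \<nu>" q] \<nu> that by simp
  qed (use D' D0 \<nu> in auto)
  then obtain \<delta> where \<delta>: "\<delta> > 0" "\<And>q. q \<in> {0<..\<delta>} \<Longrightarrow> D \<nu> q = 0" by blast
  have "(\<lambda>q. laplace_pair \<nu> 1 q - laplace_series \<nu> 1 q) q = 0"
  proof (rule holomorphic_zero_of_zero_on_interval[OF _ \<delta>(1) _ q])
    have "laplace_series \<nu> 1 holomorphic_on {q. Re q > 0}"
      using laplace_series_DERIV[OF \<nu>]
      by (auto simp: holomorphic_on_def field_differentiable_def intro: has_field_derivative_at_within)
    thus "(\<lambda>q. laplace_pair \<nu> 1 q - laplace_series \<nu> 1 q) holomorphic_on {q. Re q > 0}"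
      by (intro holomorphic_on_diff holomorphic_laplace_pair) auto
  qed (use \<delta>(2) in \<open>auto simp: D_def\<close>)
  thus ?thesis by simp
qed

text \<open>For $p > 0$ the identity scales to the case $p = 1$; analytic continuation in \<open>p\<close> does the rest.\<close>
lemma laplace_pair_eq_series:
  assumes \<nu>: "0 < Re \<nu>" "Re \<nu> < 1" and p: "Re p > 0" and q: "Re q > 0"
  shows "laplace_pair \<nu> p q = laplace_series \<nu> p q"
proof -
  have "(\<lambda>p. laplace_pair \<nu> p q - laplace_series \<nu> p q) p = 0"
  proof (rule holomorphic_zero_of_zero_on_interval[OF _ _ _ p, where \<delta> = 1])
    have np: "p \<notin> \<real>\<^sub>\<le>\<^sub>0" if "Re p > 0" for p using that by (auto elim!: nonpos_Reals_cases)
    have "bessel_series \<mu> holomorphic_on UNIV" if "Re \<mu> > -1" for \<mu>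
      using has_field_derivative_bessel_series[OF that] by (auto simp: holomorphic_on_def field_differentiable_def)
    hence bs: "(\<lambda>p. bessel_series \<mu> (p * q)) holomorphic_on {p. Re p > 0}" if "Re \<mu> > -1" for \<mu>
    proof -
      have "(\<lambda>p. p * q) holomorphic_on {p. Re p > 0}" by (intro holomorphic_intros)
      from holomorphic_on_compose_gen[OF this \<open>\<And>\<mu>. Re \<mu> > -1 \<Longrightarrow> bessel_series \<mu> holomorphic_on UNIV\<close>[OF that]]
      show ?thesis by (simp add: o_def)
    qed
    have "(\<lambda>p. laplace_series \<nu> p q) holomorphic_on {p. Re p > 0}"
      unfolding laplace_series_def using \<nu> np by (intro holomorphic_intros bs) auto
    thus "(\<lambda>p. laplace_pair \<nu> p q - laplace_series \<nu> p q) holomorphic_on {q. Re q > 0}"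
      by (intro holomorphic_on_diff holomorphic_laplace_pair q)
    fix t :: real assume t: "0 < t"
    have q0: "q \<noteq> 0" using q by auto
    have w: "(of_real t * q) powr \<nu> = of_real t powr \<nu> * q powr \<nu>"
      using t q0 by (simp add: powr_def Ln_times_of_real Ln_of_real ring_distribs exp_add)
    have w2: "exp (- \<nu> * of_real (ln t)) = of_real t powr (- \<nu>)" "of_real t powr (- \<nu>) * of_real t powr \<nu> = (1::complex)"
      using t by (simp_all add: powr_def Ln_of_real flip: exp_add)
    have "laplace_pair \<nu> (of_real t) q = of_real t powr (- \<nu>) * laplace_series \<nu> 1 (of_real t * q)"
      using t q by (subst laplace_pair_scale[OF t], subst w2(1), subst laplace_pair_eq_series_1[OF \<nu>]) auto
    also have "\<dots> = laplace_series \<nu> (of_real t) q"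
    proof -
      have "of_real t powr (- \<nu>) * (c * (A - of_real t powr \<nu> * q powr \<nu> * B)) = c * (of_real t powr (- \<nu>) * A - q powr \<nu> * B)" for c A B
        using w2(2) by (simp add: right_diff_distrib)
      thus ?thesis unfolding laplace_series_def w by simp
    qed
    finally show "laplace_pair \<nu> (of_real t) q - laplace_series \<nu> (of_real t) q = 0" by simp
  qed simp
  thus ?thesis by simp
qed

section \<open>The Koshliakov kernel as a limit of damped cosine integrals\<close>

text \<open>The bound is uniform in the damping \<open>\<epsilon>\<close>, which makes dominated convergence applicable as \<open>\<epsilon>\<close>
tends to 0. The power of \<open>exp \<eta>\<close> comes from $p^{-\nu}$ and is the only singular
factor.\<close>
lemma laplace_pair_bound:
  assumes \<nu>: "0 < Re \<nu>" "Re \<nu> < 1"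
  shows "\<exists>C k. 0 \<le> C \<and> (\<forall>\<epsilon> s t \<eta> \<theta>. 0 < \<epsilon> \<longrightarrow> \<epsilon> \<le> 1 \<longrightarrow> \<bar>s\<bar> = 1 \<longrightarrow> \<bar>t\<bar> = 1 \<longrightarrow>
     norm (laplace_pair \<nu> (Complex \<epsilon> (2 * s * exp \<eta>)) (Complex \<epsilon> (2 * t * exp \<theta>)))
       \<le> C * exp (k * (exp \<eta> + exp \<theta>)) * (exp (- Re \<nu> * \<eta>) + 1))"
proof -
  define \<rho> where "\<rho> = 1 - Re \<nu>"
  have \<rho>: "0 < \<rho>" "\<rho> \<le> 1" "\<rho> \<le> 1 + Re \<nu>" "\<rho> \<le> 1 + Re (- \<nu>)" using \<nu> by (auto simp: \<rho>_def)
  define m where "m = 2 / sqrt \<rho>"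
  have m: "m \<ge> 0" using \<rho> by (simp add: m_def)
  define R where "R = norm (rGamma (\<nu> + 1)) + norm (rGamma (- \<nu> + 1))"
  define A where "A = exp (pi * \<bar>Im \<nu>\<bar>)"
  define C where "C = norm (of_real pi / sin (of_real pi * \<nu>)) * (A * (R * exp m))"
  have "norm (laplace_pair \<nu> (Complex \<epsilon> (2 * s * exp \<eta>)) (Complex \<epsilon> (2 * t * exp \<theta>)))
       \<le> C * exp ((m + 2) * (exp \<eta> + exp \<theta>)) * (exp (- Re \<nu> * \<eta>) + 1)"
    if \<epsilon>: "0 < \<epsilon>" "\<epsilon> \<le> 1" and st: "\<bar>s\<bar> = 1" "\<bar>t\<bar> = 1" for \<epsilon> s t \<eta> \<theta> :: real
  proof -
    define p where "p = Complex \<epsilon> (2 * s * exp \<eta>)"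
    define q where "q = Complex \<epsilon> (2 * t * exp \<theta>)"
    have pq: "Re p > 0" "Re q > 0" "p \<noteq> 0" "q \<noteq> 0" using \<epsilon> by (auto simp: p_def q_def complex_eq_iff)
    have "\<bar>Im p\<bar> = 2 * exp \<eta>" "\<bar>Im q\<bar> = 2 * exp \<theta>" using st by (simp_all add: p_def q_def abs_mult)
    hence np: "2 * exp \<eta> \<le> norm p" "norm p \<le> 1 + 2 * exp \<eta>" and nq: "norm q \<le> 1 + 2 * exp \<theta>"
      using abs_Im_le_cmod[of p] cmod_le[of p] cmod_le[of q] \<epsilon> by (auto simp: p_def q_def)
    have arg: "\<bar>Im \<nu> * Im (Ln x)\<bar> \<le> pi * \<bar>Im \<nu>\<bar>" if "x \<noteq> 0" for x
      unfolding abs_mult using mpi_less_Im_Ln[OF that] Im_Ln_le_pi[OF that]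
      by (subst mult.commute, intro mult_right_mono) auto
    have P: "norm (p powr (- \<nu>)) \<le> A * exp (- Re \<nu> * \<eta>)"
    proof -
      have "exp \<eta> \<le> norm p" using np(1) exp_gt_zero[of \<eta>] by linarith
      hence "\<eta> \<le> ln (norm p)" using pq by (subst ln_ge_iff) auto
      hence "Re \<nu> * \<eta> \<le> Re \<nu> * ln (norm p)" using \<nu> by (intro mult_left_mono) auto
      moreover have "norm (p powr (- \<nu>)) = exp (- Re \<nu> * ln (norm p) + Im \<nu> * Im (Ln p))"
        using pq by (simp add: powr_def)
      ultimately show ?thesis
        using arg[OF pq(3)] unfolding A_def by (simp flip: exp_add)
    qed
    have Q: "norm (q powr \<nu>) \<le> A * exp (2 * exp \<theta>)"
    proof -
      have "ln (norm q) \<le> ln (1 + 2 * exp \<theta>)" using nq pq by (subst ln_le_cancel_iff) (auto intro: add_pos_pos)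
      also have "\<dots> \<le> 2 * exp \<theta>" by (intro ln_add_one_self_le_self) auto
      finally have "Re \<nu> * ln (norm q) \<le> Re \<nu> * (2 * exp \<theta>)" using \<nu> by (intro mult_left_mono) auto
      also have "\<dots> \<le> 1 * (2 * exp \<theta>)" using \<nu> by (intro mult_right_mono) auto
      finally have "Re \<nu> * ln (norm q) \<le> 2 * exp \<theta>" by simp
      moreover have "norm (q powr \<nu>) = exp (Re \<nu> * ln (norm q) - Im \<nu> * Im (Ln q))"
        using pq by (simp add: powr_def)
      ultimately show ?thesis
        using arg[OF pq(4)] unfolding A_def by (simp flip: exp_add)
    qed
    have "norm (p * q) \<le> (1 + exp \<eta> + exp \<theta>)\<^sup>2"
    proof -
      have "norm (p * q) \<le> (1 + 2 * exp \<eta>) * (1 + 2 * exp \<theta>)"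
        unfolding norm_mult using np nq by (intro mult_mono) auto
      also have "\<dots> \<le> (1 + exp \<eta> + exp \<theta>)\<^sup>2"
      proof -
        have "0 \<le> (exp \<eta> - exp \<theta>)\<^sup>2" by simp
        thus ?thesis by (simp add: power2_eq_square algebra_simps)
      qed
      finally show ?thesis .
    qed
    hence "sqrt (norm (p * q)) \<le> 1 + exp \<eta> + exp \<theta>"
      by (intro real_le_lsqrt) (auto intro: add_nonneg_nonneg)
    hence "m * sqrt (norm (p * q)) \<le> m * (1 + exp \<eta> + exp \<theta>)" using m by (rule mult_left_mono)
    hence sq: "2 * sqrt (norm (p * q) / \<rho>) \<le> m + m * (exp \<eta> + exp \<theta>)"
      by (simp add: real_sqrt_divide m_def algebra_simps)
    have S: "norm (bessel_series \<mu> (p * q)) \<le> R * exp (m + m * (exp \<eta> + exp \<theta>))"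
      if "\<mu> = \<nu> \<or> \<mu> = - \<nu>" for \<mu>
    proof -
      have "norm (bessel_series \<mu> (p * q)) \<le> norm (rGamma (\<mu> + 1)) * exp (2 * sqrt (norm (p * q) / \<rho>))"
        using that \<rho> by (intro bessel_series_bound) auto
      also have "\<dots> \<le> R * exp (m + m * (exp \<eta> + exp \<theta>))"
        using that sq by (intro mult_mono) (auto simp: R_def)
      finally show ?thesis .
    qed
    let ?S = "R * exp (m + m * (exp \<eta> + exp \<theta>))"
    have A0: "A \<ge> 0" "R \<ge> 0" by (auto simp: A_def R_def)
    have "norm (laplace_pair \<nu> p q) = norm (of_real pi / sin (of_real pi * \<nu>)) *
       norm (p powr (- \<nu>) * bessel_series (- \<nu>) (p * q) - q powr \<nu> * bessel_series \<nu> (p * q))"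
      unfolding laplace_pair_eq_series[OF \<nu> pq(1,2)] laplace_series_def by (rule norm_mult)
    also have "norm (p powr (- \<nu>) * bessel_series (- \<nu>) (p * q) - q powr \<nu> * bessel_series \<nu> (p * q))
       \<le> norm (p powr (- \<nu>)) * norm (bessel_series (- \<nu>) (p * q)) + norm (q powr \<nu>) * norm (bessel_series \<nu> (p * q))"
      by (metis norm_mult norm_triangle_ineq4)
    also have "\<dots> \<le> A * exp (- Re \<nu> * \<eta>) * ?S + A * exp (2 * exp \<theta>) * ?S"
      using P Q S A0 by (intro add_mono mult_mono) auto
    also have "\<dots> = A * ?S * (exp (- Re \<nu> * \<eta>) + exp (2 * exp \<theta>))" by (simp add: algebra_simps)
    also have "\<dots> \<le> A * ?S * (exp (2 * (exp \<eta> + exp \<theta>)) * (exp (- Re \<nu> * \<eta>) + 1))"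
    proof (intro mult_left_mono)
      have "1 * exp (- Re \<nu> * \<eta>) \<le> exp (2 * (exp \<eta> + exp \<theta>)) * exp (- Re \<nu> * \<eta>)"
        by (intro mult_right_mono) (auto intro: add_nonneg_nonneg)
      hence "exp (- Re \<nu> * \<eta>) \<le> exp (2 * (exp \<eta> + exp \<theta>)) * exp (- Re \<nu> * \<eta>)" by simp
      moreover have "exp (2 * exp \<theta>) \<le> exp (2 * (exp \<eta> + exp \<theta>))" by simp
      ultimately show "exp (- Re \<nu> * \<eta>) + exp (2 * exp \<theta>) \<le> exp (2 * (exp \<eta> + exp \<theta>)) * (exp (- Re \<nu> * \<eta>) + 1)"
        unfolding distrib_left[where c = 1] mult_1_right by (rule add_mono)
    qed (use A0 in auto)
    finally have "norm (laplace_pair \<nu> p q) \<le> norm (of_real pi / sin (of_real pi * \<nu>)) *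
      (A * ?S * (exp (2 * (exp \<eta> + exp \<theta>)) * (exp (- Re \<nu> * \<eta>) + 1)))"
      by (simp add: mult_left_mono)
    also have "\<dots> = C * (exp (m * (exp \<eta> + exp \<theta>)) * exp (2 * (exp \<eta> + exp \<theta>))) * (exp (- Re \<nu> * \<eta>) + 1)"
      by (simp add: C_def exp_add)
    also have "exp (m * (exp \<eta> + exp \<theta>)) * exp (2 * (exp \<eta> + exp \<theta>)) = exp ((m + 2) * (exp \<eta> + exp \<theta>))"
      by (simp only: exp_add[symmetric] distrib_right)
    finally show ?thesis unfolding p_def q_def .
  qed
  moreover have "C \<ge> 0" by (simp add: C_def A_def R_def)
  ultimately show ?thesis by blast
qed

text \<open>For $p \to \pm 2i\tau$ and $q \to \pm 2iu$ the products $pq$ tend to $\pm 4\tau u$ and the powers contribute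
the phases $e^{\pm i\pi z}$. Summing over the four signs leaves twice a cosine times the even parts of the
series, that is, the Koshliakov kernel at $\tau u$.\<close>
lemma laplace_pair_tendsto_boundary:
  assumes z: "0 < Re z" "Re z < 1 / 2" and \<epsilon>: "\<And>n. 0 < \<epsilon> n" "\<epsilon> \<longlonglongrightarrow> 0"
  shows "(\<lambda>n. \<Sum>s\<in>{1, -1}. \<Sum>t\<in>{1, -1}. laplace_pair (2 * z) (Complex (\<epsilon> n) (2 * s * exp \<eta>)) (Complex (\<epsilon> n) (2 * t * exp \<theta>)))
    \<longlonglongrightarrow> 2 * of_real pi * exp (z * of_real (\<theta> - \<eta>)) * koshliakov_kernel z (exp (\<eta> + \<theta>))"
proof -
  let ?\<nu> = "2 * z"
  have \<nu>: "0 < Re ?\<nu>" "Re ?\<nu> < 1" using z by auto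
  have z': "\<bar>Re z\<bar> < 1 / 2" "z \<noteq> 0" using z by auto
  have lim: "(\<lambda>n. laplace_pair ?\<nu> (Complex (\<epsilon> n) (2 * s * exp \<eta>)) (Complex (\<epsilon> n) (2 * t * exp \<theta>)))
     \<longlonglongrightarrow> laplace_series ?\<nu> (Complex 0 (2 * s * exp \<eta>)) (Complex 0 (2 * t * exp \<theta>))"
    if st: "s \<in> {1, -1}" "t \<in> {1, -1}" for s t :: real
  proof -
    let ?p = "\<lambda>e. Complex e (2 * s * exp \<eta>)" and ?q = "\<lambda>e. Complex e (2 * t * exp \<theta>)"
    have p: "(\<lambda>n. ?p (\<epsilon> n)) \<longlonglongrightarrow> ?p 0" and q: "(\<lambda>n. ?q (\<epsilon> n)) \<longlonglongrightarrow> ?q 0"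
      by (intro tendsto_Complex tendsto_const \<epsilon>)+
    have nz: "?p 0 \<notin> \<real>\<^sub>\<le>\<^sub>0" "?q 0 \<notin> \<real>\<^sub>\<le>\<^sub>0"
      using st by (auto simp: complex_nonpos_Reals_iff)
    have bs: "(\<lambda>n. bessel_series \<mu> (?p (\<epsilon> n) * ?q (\<epsilon> n))) \<longlonglongrightarrow> bessel_series \<mu> (?p 0 * ?q 0)" if "Re \<mu> > -1" for \<mu>
      by (rule isCont_tendsto_compose[OF DERIV_isCont[OF has_field_derivative_bessel_series[OF that]]])
         (rule tendsto_mult[OF p q])
    have "(\<lambda>n. laplace_series ?\<nu> (?p (\<epsilon> n)) (?q (\<epsilon> n))) \<longlonglongrightarrow> laplace_series ?\<nu> (?p 0) (?q 0)"
      unfolding laplace_series_def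
    proof (rule tendsto_mult[OF tendsto_const tendsto_diff[OF tendsto_mult tendsto_mult]])
      show "(\<lambda>n. ?p (\<epsilon> n) powr (- ?\<nu>)) \<longlonglongrightarrow> ?p 0 powr (- ?\<nu>)"
        by (rule tendsto_powr_complex[OF nz(1) p tendsto_const])
      show "(\<lambda>n. ?q (\<epsilon> n) powr ?\<nu>) \<longlonglongrightarrow> ?q 0 powr ?\<nu>"
        by (rule tendsto_powr_complex[OF nz(2) q tendsto_const])
    qed (rule bs; use \<nu> in simp)+
    moreover have "laplace_pair ?\<nu> (?p (\<epsilon> n)) (?q (\<epsilon> n)) = laplace_series ?\<nu> (?p (\<epsilon> n)) (?q (\<epsilon> n))" for n
      using \<epsilon>(1)[of n] by (intro laplace_pair_eq_series \<nu>) auto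
    ultimately show ?thesis by simp
  qed
  let ?T = "\<lambda>s t. laplace_series ?\<nu> (Complex 0 (2 * s * exp \<eta>)) (Complex 0 (2 * t * exp \<theta>))"
  have L1: "(\<lambda>n. \<Sum>s\<in>{1, -1}. \<Sum>t\<in>{1, -1}. laplace_pair ?\<nu> (Complex (\<epsilon> n) (2 * s * exp \<eta>)) (Complex (\<epsilon> n) (2 * t * exp \<theta>)))
    \<longlonglongrightarrow> (\<Sum>s\<in>{1, -1}. \<Sum>t\<in>{1, -1}. ?T s t)"
    by (intro tendsto_sum lim)
  define X where "X = exp (- ?\<nu> * of_real (ln 2 + \<eta>))"
  define Y where "Y = exp (?\<nu> * of_real (ln 2 + \<theta>))"
  define e where "e = exp (\<i> * of_real pi * z)"
  define c where "c = of_real pi / sin (of_real pi * ?\<nu>)"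
  let ?B = "\<lambda>\<mu> s. bessel_series \<mu> (s * (4 * of_real (exp (\<eta> + \<theta>))))"
  have Ln1: "Ln (Complex 0 (2 * exp x)) = of_real (ln 2 + x) + \<i> * of_real pi / 2" 
    and Ln2: "Ln (Complex 0 (- (2 * exp x))) = of_real (ln 2 + x) - \<i> * of_real pi / 2" for x
  proof -
    have a: "Complex 0 (2 * exp x) = of_real (2 * exp x) * \<i>" "Complex 0 (- (2 * exp x)) = of_real (2 * exp x) * (- \<i>)"
      by (simp_all add: complex_eq_iff)
    have b: "ln (2 * exp x) = ln 2 + x" by (subst ln_mult) auto
    have c: "Ln (complex_of_real (2 * exp x)) = of_real (ln 2 + x)" by (subst Ln_of_real, simp, simp only: b)
    show "Ln (Complex 0 (2 * exp x)) = of_real (ln 2 + x) + \<i> * of_real pi / 2"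
      unfolding a by (subst Ln_times_of_real, simp, simp, simp only: c b) simp
    show "Ln (Complex 0 (- (2 * exp x))) = of_real (ln 2 + x) - \<i> * of_real pi / 2"
      unfolding a by (subst Ln_times_of_real, simp, simp, simp only: c b) simp
  qed
  have ei: "exp (- (\<i> * of_real pi * z)) = inverse e" by (simp add: e_def exp_minus)
  have pX: "Complex 0 (2 * exp \<eta>) powr (- ?\<nu>) = X * inverse e" "Complex 0 (- (2 * exp \<eta>)) powr (- ?\<nu>) = X * e"
    unfolding powr_def Ln1 Ln2 X_def ei[symmetric] unfolding e_def
    by (auto simp: algebra_simps complex_eq_iff simp flip: exp_add)
  have qY: "Complex 0 (2 * exp \<theta>) powr ?\<nu> = Y * e" "Complex 0 (- (2 * exp \<theta>)) powr ?\<nu> = Y * inverse e"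
    unfolding powr_def Ln1 Ln2 Y_def ei[symmetric] unfolding e_def
    by (auto simp: algebra_simps complex_eq_iff simp flip: exp_add)
  have prod: "Complex 0 (2 * exp \<eta>) * Complex 0 (2 * exp \<theta>) = - 1 * (4 * of_real (exp (\<eta> + \<theta>)))"
    "Complex 0 (- (2 * exp \<eta>)) * Complex 0 (- (2 * exp \<theta>)) = - 1 * (4 * of_real (exp (\<eta> + \<theta>)))"
    "Complex 0 (2 * exp \<eta>) * Complex 0 (- (2 * exp \<theta>)) = 1 * (4 * of_real (exp (\<eta> + \<theta>)))"
    "Complex 0 (- (2 * exp \<eta>)) * Complex 0 (2 * exp \<theta>) = 1 * (4 * of_real (exp (\<eta> + \<theta>)))"
    by (simp_all add: complex_eq_iff exp_add)
  have T: "?T 1 1 = c * (X * inverse e * ?B (- ?\<nu>) (- 1) - Y * e * ?B ?\<nu> (- 1))"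
    "?T (- 1) (- 1) = c * (X * e * ?B (- ?\<nu>) (- 1) - Y * inverse e * ?B ?\<nu> (- 1))"
    "?T 1 (- 1) = c * (X * inverse e * ?B (- ?\<nu>) 1 - Y * inverse e * ?B ?\<nu> 1)"
    "?T (- 1) 1 = c * (X * e * ?B (- ?\<nu>) 1 - Y * e * ?B ?\<nu> 1)"
    unfolding mult_1_right mult_minus_right mult_minus_left laplace_series_def c_def[symmetric] pX[unfolded mult_minus_left] qY prod by (rule refl)+
  have "(\<Sum>s\<in>{1, -1}. \<Sum>t\<in>{1, -1}. ?T s t) = (?T 1 1 + ?T 1 (- 1)) + (?T (- 1) 1 + ?T (- 1) (- 1))"
    by simp
  also have "\<dots> = c * ((e + inverse e) * (X * (?B (- ?\<nu>) 1 + ?B (- ?\<nu>) (- 1)) - Y * (?B ?\<nu> 1 + ?B ?\<nu> (- 1))))"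
    unfolding T by (simp only: ring_distribs add_ac mult_ac diff_conv_add_uminus mult_minus_right minus_add_distrib)
  also have "e + inverse e = 2 * cos (of_real pi * z)"
    unfolding cos_exp_eq e_def by (simp only: mult.assoc) (simp add: exp_minus)
  also have "?B (- ?\<nu>) 1 + ?B (- ?\<nu>) (- 1) = even_series (- 2 * z) (\<eta> + \<theta>)"
    by (simp add: even_series_def)
  also have "?B ?\<nu> 1 + ?B ?\<nu> (- 1) = even_series (2 * z) (\<eta> + \<theta>)"
    by (simp add: even_series_def)
  also have "c * (2 * cos (of_real pi * z) * (X * even_series (- 2 * z) (\<eta> + \<theta>) - Y * even_series (2 * z) (\<eta> + \<theta>)))
     = 2 * of_real pi * exp (z * of_real (\<theta> - \<eta>)) * koshliakov_kernel z (exp (\<eta> + \<theta>))"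
  proof -
    have s: "sin (of_real pi * ?\<nu>) \<noteq> 0" unfolding sin_pi_eq_0_iff using z by (intro small_not_Int) auto
    have s2: "sin (of_real pi * ?\<nu>) = 2 * sin (of_real pi * z) * cos (of_real pi * z)"
      using sin_double[of "of_real pi * z"] by (simp add: mult_ac)
    have sc: "sin (of_real pi * z) \<noteq> 0" "cos (of_real pi * z) \<noteq> 0" using s unfolding s2 by auto
    have ln4: "ln 4 = 2 * ln (2::real)" using ln_realpow[of 2 2] by simp
    have X': "X = exp (z * of_real (\<theta> - \<eta>)) * exp (- z * of_real (\<eta> + \<theta> + ln 4))"
      and Y': "Y = exp (z * of_real (\<theta> - \<eta>)) * exp (z * of_real (\<eta> + \<theta> + ln 4))"
    proof -
      have "- ?\<nu> * of_real (ln 2 + \<eta>) = z * of_real (\<theta> - \<eta>) + - z * of_real (\<eta> + \<theta> + ln 4)"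
        "?\<nu> * of_real (ln 2 + \<theta>) = z * of_real (\<theta> - \<eta>) + z * of_real (\<eta> + \<theta> + ln 4)"
        unfolding ln4 by (simp_all add: algebra_simps)
      thus "X = exp (z * of_real (\<theta> - \<eta>)) * exp (- z * of_real (\<eta> + \<theta> + ln 4))"
        "Y = exp (z * of_real (\<theta> - \<eta>)) * exp (z * of_real (\<eta> + \<theta> + ln 4))"
        unfolding X_def Y_def by (simp_all only: exp_add)
    qed
    have alg: "of_real pi / (2 * S * C) * (2 * C * (g * D)) = 2 * of_real pi * g * (D / (2 * S))"
      if "S \<noteq> 0" "C \<noteq> 0" for S C g D :: complex
      using that by (simp add: field_simps)
    have XY: "X * A - Y * B = exp (z * of_real (\<theta> - \<eta>)) * (exp (- z * of_real (\<eta> + \<theta> + ln 4)) * A - exp (z * of_real (\<eta> + \<theta> + ln 4)) * B)" for A B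
      unfolding X' Y' right_diff_distrib mult.assoc ..
    show ?thesis
      unfolding koshliakov_kernel_eq_series[OF z'] XY c_def s2 by (rule alg[OF sc])
  qed
  finally show ?thesis using L1 by simp
qed

section \<open>The double integral identity\<close>

lemma kummer_half: "kummer_1F1 (1 / 2) (1 / 2) u = exp u"
proof -
  have "(1 / 2 :: complex) \<noteq> - of_nat k" for k
  proof
    assume "(1 / 2 :: complex) = - of_nat k"
    from arg_cong[OF this, of Re] show False by simp
  qed
  hence nz: "pochhammer (1 / 2 :: complex) n \<noteq> 0" for n
    unfolding pochhammer_eq_0_iff by blast
  have "pochhammer (1 / 2) n * u ^ n / (pochhammer (1 / 2) n * fact n) = u ^ n /\<^sub>R fact n" for n
    by (subst mult_divide_mult_cancel_left[OF nz]) (simp add: divide_inverse scaleR_conv_of_real)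
  thus ?thesis by (simp only: kummer_1F1_def exp_def)
qed

lemma gcos_mellin_1: "gcos_mellin b 1 = of_real (sqrt pi) / 2 * exp (- (b\<^sup>2 / 4))"
proof -
  have "Gamma (1 / 2 :: complex) = of_real (sqrt pi)"
    using Gamma_complex_of_real[of "1 / 2"] Gamma_one_half_real by simp
  thus ?thesis using gcos_mellin_eq[of 1 b] kummer_half by simp
qed

text \<open>By the product formula for cosines this is the Mellin transform at $a = 1$, where the Kummer function
reduces to the exponential.\<close>
lemma gcos_cosine_transform:
  fixes v :: real
  shows "integrable lborel (\<lambda>x. of_real (exp x) * gcos w (exp x) * cos (of_real (2 * exp x * v)))"
    and "(LBINT x. of_real (exp x) * gcos w (exp x) * cos (of_real (2 * exp x * v)))
       = of_real (sqrt pi) / 2 * exp (- (w\<^sup>2 / 4)) * gcos (\<i> * w) v"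
proof -
  have eq: "of_real (exp x) * gcos w (exp x) * cos (of_real (2 * exp x * v)) =
      (1 / 2) * (gcos (w + 2 * of_real v) (exp x) * exp (1 * of_real x)) + (1 / 2) * (gcos (w - 2 * of_real v) (exp x) * exp (1 * of_real x))" for x :: real
  proof -
    define A where "A = w * complex_of_real (exp x)"
    define B where "B = complex_of_real (2 * exp x * v)"
    have "(w + 2 * of_real v) * of_real (exp x) = A + B" "(w - 2 * of_real v) * of_real (exp x) = A - B"
      by (simp_all add: A_def B_def algebra_simps)
    moreover have "cos (A + B) + cos (A - B) = 2 * (cos A * cos B)" by (simp add: cos_add cos_diff)
    moreover have "E * (G * p) * q = (1 / 2) * (G * r * E) + (1 / 2) * (G * t * E)" if "r + t = 2 * (p * q)" for E G p q r t :: complex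
    proof -
      have "2 * (E * (G * p) * q) = E * G * (2 * (p * q))" by simp
      also have "\<dots> = G * r * E + G * t * E" unfolding that[symmetric] by (simp add: algebra_simps)
      finally have f: "2 * (E * (G * p) * q) = G * r * E + G * t * E" .
      have "E * (G * p) * q = (2 * (E * (G * p) * q)) / 2" by simp
      also have "\<dots> = (1 / 2) * (G * r * E) + (1 / 2) * (G * t * E)"
        unfolding f by (simp add: add_divide_distrib)
      finally show ?thesis .
    qed
    ultimately show ?thesis
      unfolding gcos_def A_def[symmetric] B_def[symmetric] mult_1_left exp_of_real by simp
  qed
  have i: "integrable lborel (\<lambda>x. gcos b (exp x) * exp (1 * of_real x))" for b
    by (rule integrable_gcos_mellin) simp
  show "integrable lborel (\<lambda>x. of_real (exp x) * gcos w (exp x) * cos (of_real (2 * exp x * v)))"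
    unfolding eq by (intro Bochner_Integration.integrable_add integrable_mult_right i)
  have "(LBINT x. of_real (exp x) * gcos w (exp x) * cos (of_real (2 * exp x * v)))
     = (1 / 2) * gcos_mellin (w + 2 * of_real v) 1 + (1 / 2) * gcos_mellin (w - 2 * of_real v) 1"
    unfolding eq gcos_mellin_def
    by (subst Bochner_Integration.integral_add) (auto intro: i[unfolded mult_1_left])
  also have "\<dots> = of_real (sqrt pi) / 2 * ((exp (- ((w + 2 * of_real v)\<^sup>2 / 4)) + exp (- ((w - 2 * of_real v)\<^sup>2 / 4))) / 2)"
    unfolding gcos_mellin_1 by (simp add: field_simps)
  also have "(exp (- ((w + 2 * of_real v)\<^sup>2 / 4)) + exp (- ((w - 2 * of_real v)\<^sup>2 / 4))) / 2 = exp (- (w\<^sup>2 / 4)) * gcos (\<i> * w) v"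
  proof -
    have e1: "- ((w + 2 * of_real v)\<^sup>2 / 4) = - (w\<^sup>2 / 4) + - (of_real v)\<^sup>2 + - (w * of_real v)"
     and e2: "- ((w - 2 * of_real v)\<^sup>2 / 4) = - (w\<^sup>2 / 4) + - (of_real v)\<^sup>2 + w * of_real v"
      by (simp_all add: power2_eq_square field_simps)
    have c: "cos (\<i> * w * of_real v) = (exp (- (w * of_real v)) + exp (w * of_real v)) / 2"
      by (simp add: cos_exp_eq mult.assoc[symmetric])
    show ?thesis unfolding e1 e2 gcos_def c exp_add by (simp add: algebra_simps)
  qed
  finally show "(LBINT x. of_real (exp x) * gcos w (exp x) * cos (of_real (2 * exp x * v)))
       = of_real (sqrt pi) / 2 * exp (- (w\<^sup>2 / 4)) * gcos (\<i> * w) v"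
    by (simp add: mult.assoc)
qed

lemma norm_gcos_le_exp_minus:
  assumes "v \<ge> 0"
  shows "norm (gcos w v) \<le> exp ((norm w + 1)\<^sup>2) * exp (- v)"
proof -
  have "norm (gcos w v) \<le> exp (norm w * v - v\<^sup>2)" by (rule norm_gcos_le[OF assms])
  also have "norm w * v - v\<^sup>2 \<le> (norm w + 1)\<^sup>2 - v"
  proof -
    have "0 \<le> (v - (norm w + 1))\<^sup>2 + (norm w + 1)\<^sup>2 + v\<^sup>2" by simp
    thus ?thesis by (simp add: power2_eq_square algebra_simps)
  qed
  hence "exp (norm w * v - v\<^sup>2) \<le> exp ((norm w + 1)\<^sup>2) * exp (- v)"
    by (simp flip: exp_add)
  finally show ?thesis .
qed

lemma bessel_conv_integrand_le:
  "norm (gcos w (exp u) * gcos w (exp (\<xi> - u)) * exp (z * of_real (2 * u - \<xi>)))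
   \<le> (exp ((norm w + 1)\<^sup>2))\<^sup>2 * exp (- Re z * \<xi>) * exp (2 * Re z * u - 1 * exp u - exp \<xi> * exp (- u))"
proof -
  have "norm (gcos w (exp u) * gcos w (exp (\<xi> - u)) * exp (z * of_real (2 * u - \<xi>)))
     = norm (gcos w (exp u)) * norm (gcos w (exp (\<xi> - u))) * exp (Re z * (2 * u - \<xi>))"
    by (simp add: norm_mult)
  also have "\<dots> \<le> (exp ((norm w + 1)\<^sup>2) * exp (- exp u)) * (exp ((norm w + 1)\<^sup>2) * exp (- exp (\<xi> - u))) * exp (Re z * (2 * u - \<xi>))"
    by (intro mult_right_mono mult_mono norm_gcos_le_exp_minus) auto
  also have "\<dots> = (exp ((norm w + 1)\<^sup>2))\<^sup>2 * exp (- Re z * \<xi>) * exp (2 * Re z * u - 1 * exp u - exp \<xi> * exp (- u))"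
  proof -
    have "exp (2 * Re z * u - 1 * exp u - exp \<xi> * exp (- u)) = exp (2 * Re z * u) * exp (- exp u) * exp (- exp (\<xi> - u))"
      by (simp add: exp_diff exp_minus field_simps flip: exp_add)
    moreover have "exp (Re z * (2 * u - \<xi>)) = exp (2 * Re z * u) * exp (- Re z * \<xi>)"
      by (simp add: algebra_simps flip: exp_add)
    ultimately show ?thesis by (simp add: power2_eq_square)
  qed
  finally show ?thesis .
qed

lemma integrable_bessel_conv:
  "integrable lborel (\<lambda>u. gcos w (exp u) * gcos w (exp (\<xi> - u)) * exp (z * of_real (2 * u - \<xi>)))"
proof (rule Bochner_Integration.integrable_bound)
  show "integrable lborel (\<lambda>u. (exp ((norm w + 1)\<^sup>2))\<^sup>2 * exp (- Re z * \<xi>) * exp (2 * Re z * u - 1 * exp u - exp \<xi> * exp (- u)))"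
    by (intro integrable_mult_right integrable_two_sided_weight) auto
qed (use bessel_conv_integrand_le in \<open>auto intro: order_trans[OF _ abs_ge_self]\<close>)

lemma bessel_conv_uminus: "bessel_conv (- z) w \<xi> = bessel_conv z w \<xi>"
  unfolding bessel_conv_def
  by (subst lborel_integral_reflect[symmetric, of _ \<xi>]) (simp add: algebra_simps)

text \<open>The double integral of this function is what remains of
$\int_0^\infty K_{z,w}(2t)\,\kappa_z(e^a t)\,dt$ after the convolution integral
of $K_{z,w}$ is inserted and its two factors get independent variables $e^\eta$, $e^\theta$; here $\kappa_z$ is the
Koshliakov kernel.\<close>
definition koshliakov_integrand :: "complex \<Rightarrow> complex \<Rightarrow> real \<Rightarrow> real \<Rightarrow> real \<Rightarrow> complex" where
  "koshliakov_integrand z w a \<eta> \<theta> =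
     of_real (exp \<eta>) * gcos w (exp \<eta>) * (of_real (exp \<theta>) * gcos w (exp \<theta>))
       * (exp (z * of_real (\<theta> - \<eta>)) * koshliakov_kernel z (exp (a + \<eta> + \<theta>)))"

definition double_integral_identity :: "complex \<Rightarrow> complex \<Rightarrow> real \<Rightarrow> bool" where
  "double_integral_identity z w a \<longleftrightarrow>
     integrable (lborel \<Otimes>\<^sub>M lborel) (\<lambda>(\<eta>, \<theta>). koshliakov_integrand z w a \<eta> \<theta>) \<and>
     2 * (\<integral>(\<eta>, \<theta>). koshliakov_integrand z w a \<eta> \<theta> \<partial>(lborel \<Otimes>\<^sub>M lborel)) = exp (- (w\<^sup>2 / 2)) * bessel_conv z (\<i> * w) a"

lemma measurable_koshliakov_integrand:
  assumes "\<bar>Re z\<bar> < 1 / 2"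
  shows "(\<lambda>(\<eta>, \<theta>). koshliakov_integrand z w a \<eta> \<theta>) \<in> borel_measurable (lborel \<Otimes>\<^sub>M lborel)"
proof -
  note [measurable] = measurable_koshliakov_kernel_exp[OF assms]
  show ?thesis unfolding koshliakov_integrand_def by measurable
qed

text \<open>Without the damping, the integral of the two cosines would only converge conditionally. For $\nu = 2z$ its limit is
$\frac{\pi}{2}$ times a power times the Koshliakov kernel, so that the Koshliakov transform is the
multiplicative convolution of two cosine transforms.\<close>
lemma damped_cosine_product_integral:
  fixes \<epsilon> \<eta> \<theta> :: real
  assumes "\<epsilon> > 0"
  shows "(LBINT y. exp (\<nu> * of_real y - of_real (\<epsilon> * exp y + \<epsilon> * exp (- y))) * cos (of_real (2 * exp \<eta> * exp y)) * cos (of_real (2 * exp \<theta> * exp (- y))))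
     = (\<Sum>s\<in>{1, -1}. \<Sum>t\<in>{1, -1}. laplace_pair \<nu> (Complex \<epsilon> (2 * s * exp \<eta>)) (Complex \<epsilon> (2 * t * exp \<theta>))) / 4"
proof -
  let ?E = "\<lambda>s t y. exp (\<nu> * of_real y - Complex \<epsilon> (2 * s * exp \<eta>) * of_real (exp y) - Complex \<epsilon> (2 * t * exp \<theta>) * of_real (exp (- y)))"
  have int: "integrable lborel (?E s t)" for s t
    using assms by (intro integrable_laplace_pair) auto
  have eq: "exp (\<nu> * of_real y - of_real (\<epsilon> * exp y + \<epsilon> * exp (- y))) * cos (of_real (2 * exp \<eta> * exp y)) * cos (of_real (2 * exp \<theta> * exp (- y)))
     = (\<Sum>s\<in>{1, -1}. \<Sum>t\<in>{1, -1}. ?E s t y) / 4" for y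
  proof -
    define G where "G = exp (\<nu> * of_real y - of_real (\<epsilon> * exp y + \<epsilon> * exp (- y)))"
    define A where "A = complex_of_real (2 * exp \<eta> * exp y)"
    define B where "B = complex_of_real (2 * exp \<theta> * exp (- y))"
    have E: "?E s t y = G * (exp (- of_real s * (\<i> * A)) * exp (- of_real t * (\<i> * B)))" for s t
      unfolding G_def A_def B_def exp_add[symmetric]
      by (rule arg_cong[of _ _ exp]) (simp add: complex_eq_iff algebra_simps)
    have "(\<Sum>s\<in>{1, -1}. \<Sum>t\<in>{1, -1}. ?E s t y) = G * ((exp (\<i> * A) + exp (- (\<i> * A))) * (exp (\<i> * B) + exp (- (\<i> * B))))"
      unfolding E by (simp add: algebra_simps)
    thus ?thesis
      unfolding G_def[symmetric] A_def[symmetric] B_def[symmetric] cos_exp_eq by simp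
  qed
  show ?thesis unfolding eq laplace_pair_def
    by (simp only: integral_divide_zero Bochner_Integration.integral_sum[OF Bochner_Integration.integrable_sum[OF int]]
          Bochner_Integration.integral_sum[OF int])
qed

text \<open>The integral of the damped product of cosines, multiplied by the Gaussian cosines in both variables, is
evaluated in two ways. Integrating over the two Gaussian variables first gives cosine transforms, and
hence the convolution that represents $K_{z,iw}$. Integrating over the damped variable first gives the
sum of four Laplace integrals, which tends to the Koshliakov kernel.\<close>
lemma double_integral_identity_positive:
  assumes z: "0 < Re z" "Re z < 1 / 2"
  shows "double_integral_identity z w a"
proof -
  let ?M = "lborel \<Otimes>\<^sub>M lborel :: (real \<times> real) measure"
  define \<epsilon> where "\<epsilon> = (\<lambda>n. inverse (real (Suc n)))"
  have \<epsilon>: "0 < \<epsilon> n" "\<epsilon> n \<le> 1" for n by (auto simp: \<epsilon>_def field_simps)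
  have \<epsilon>0: "\<epsilon> \<longlonglongrightarrow> 0" unfolding \<epsilon>_def by (rule LIMSEQ_inverse_real_of_nat)
  define D where "D = (\<lambda>n y. exp (2 * z * of_real y - of_real (\<epsilon> n * exp y + \<epsilon> n * exp (- y))))"
  define h where "h = (\<lambda>x. complex_of_real (exp x) * gcos w (exp x))"
  define c1 where "c1 = (\<lambda>y x. cos (complex_of_real (2 * exp x * exp y)))"
  define c2 where "c2 = (\<lambda>y x. cos (complex_of_real (2 * exp (a + x) * exp (- y))))"
  have [measurable]: "h \<in> borel_measurable borel" unfolding h_def by measurable
  have h_le: "norm (h x) \<le> exp (1 * x + norm w * exp x - (exp x)\<^sup>2)" for x
    using norm_gcos_mellin_integrand_le[of w x 1] by (simp add: h_def norm_mult mult.commute)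
  have hint: "integrable lborel h"
    by (rule Bochner_Integration.integrable_bound[OF integrable_gaussian_weight[of 1 "norm w"]]) (use h_le in auto)
  have Dn: "norm (D n y) = exp (2 * Re z * y - \<epsilon> n * exp y - \<epsilon> n * exp (- y))" for n y
    by (simp add: D_def diff_diff_eq)
  have Dint: "integrable lborel (D n)" for n
  proof (rule Bochner_Integration.integrable_bound)
    show "integrable lborel (\<lambda>y. exp (2 * Re z * y - \<epsilon> n * exp y - \<epsilon> n * exp (- y)))"
      using \<epsilon> by (intro integrable_two_sided_weight) auto
    show "AE y in lborel. norm (D n y) \<le> norm (exp (2 * Re z * y - \<epsilon> n * exp y - \<epsilon> n * exp (- y)))"
      by (simp add: Dn)
  qed (simp add: D_def)
  define I where "I = (\<lambda>n. LBINT y. D n y * ((LBINT x. h x * c1 y x) * (LBINT x. h x * c2 y x)))"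
  define W where "W = complex_of_real (sqrt pi) / 2 * exp (- (w\<^sup>2 / 4))"
  have C1: "integrable lborel (\<lambda>x. h x * c1 y x)" "(LBINT x. h x * c1 y x) = W * gcos (\<i> * w) (exp y)" for y
    unfolding h_def c1_def W_def by (rule gcos_cosine_transform)+
  have c2': "c2 y x = cos (complex_of_real (2 * exp x * exp (a - y)))" for x y
    by (simp add: c2_def exp_add exp_diff exp_minus field_simps)
  have C2: "integrable lborel (\<lambda>x. h x * c2 y x)" "(LBINT x. h x * c2 y x) = W * gcos (\<i> * w) (exp (a - y))" for y
    unfolding h_def c2' W_def by (rule gcos_cosine_transform)+
  have WW: "W * W = of_real pi / 4 * exp (- (w\<^sup>2 / 2))"
  proof -
    have "complex_of_real (sqrt pi) * of_real (sqrt pi) = of_real pi" by (simp flip: of_real_mult)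
    moreover have "exp (- (w\<^sup>2 / 4)) * exp (- (w\<^sup>2 / 4)) = exp (- (w\<^sup>2 / 2))" by (simp flip: exp_add)
    moreover have "W * W = (of_real (sqrt pi) * of_real (sqrt pi)) / 4 * (exp (- (w\<^sup>2 / 4)) * exp (- (w\<^sup>2 / 4)))"
      by (simp add: W_def)
    ultimately show ?thesis by (simp only:)
  qed
  let ?d = "\<lambda>n y. exp (- complex_of_real (\<epsilon> n * exp y + \<epsilon> n * exp (- y)))"
  \<comment> \<open>the limit computed with the cosine transforms\<close>
  have lim1: "I \<longlonglongrightarrow> of_real pi / 4 * exp (- (w\<^sup>2 / 2)) * (exp (z * of_real a) * bessel_conv z (\<i> * w) a)"
  proof -
    let ?g = "\<lambda>y. gcos (\<i> * w) (exp y) * gcos (\<i> * w) (exp (a - y)) * exp (z * of_real (2 * y - a))"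
    have I': "I n = (LBINT y. W * W * exp (z * of_real a) * (?g y * ?d n y))" for n
      unfolding I_def C1 C2
    proof (intro Bochner_Integration.integral_cong refl)
      fix y
      have "D n y = exp (z * of_real a) * exp (z * of_real (2 * y - a)) * ?d n y"
        unfolding D_def exp_add[symmetric] by (rule arg_cong[of _ _ exp]) (simp add: algebra_simps)
      thus "D n y * (W * gcos (\<i> * w) (exp y) * (W * gcos (\<i> * w) (exp (a - y)))) =
        W * W * exp (z * of_real a) * (?g y * ?d n y)"
        by (simp only: mult_ac)
    qed
    have "(\<lambda>n. LBINT y. ?g y * ?d n y) \<longlonglongrightarrow> (LBINT y. ?g y)"
    proof (rule integral_dominated_convergence[where w = "\<lambda>y. norm (?g y)"])
      show "integrable lborel (\<lambda>y. norm (?g y))" by (intro integrable_norm integrable_bessel_conv)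
      show "AE y in lborel. norm (?g y * ?d n y) \<le> norm (?g y)" for n
      proof (intro AE_I2)
        fix y
        have "norm (?d n y) \<le> 1"
        proof -
          have "norm (exp (- complex_of_real r)) \<le> 1" if "r \<ge> 0" for r using that by simp
          moreover have "\<epsilon> n * exp y + \<epsilon> n * exp (- y) \<ge> 0"
            using \<epsilon>(1)[of n] by (intro add_nonneg_nonneg mult_nonneg_nonneg) auto
          ultimately show ?thesis by blast
        qed
        from mult_left_mono[OF this, of "norm (?g y)"]
        show "norm (?g y * ?d n y) \<le> norm (?g y)"
          unfolding norm_mult[of "?g y"] by simp
      qed
      show "AE y in lborel. (\<lambda>n. ?g y * ?d n y) \<longlonglongrightarrow> ?g y"
      proof (intro AE_I2)
        fix y
        have "(\<lambda>n. ?d n y) \<longlonglongrightarrow> exp (- complex_of_real (0 * exp y + 0 * exp (- y)))"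
          by (intro tendsto_intros \<epsilon>0)
        from tendsto_mult[OF tendsto_const this, of "?g y"]
        show "(\<lambda>n. ?g y * ?d n y) \<longlonglongrightarrow> ?g y" by simp
      qed
    qed measurable
    from tendsto_mult[OF tendsto_const this, of "W * W * exp (z * of_real a)"]
    show ?thesis unfolding I' bessel_conv_def WW by (simp add: mult.assoc)
  qed
  \<comment> \<open>the limit computed with the closed form of the damped kernel\<close>
  define K where "K = (\<lambda>n \<eta> \<theta>. (\<Sum>s\<in>{1, -1}. \<Sum>t\<in>{1, -1}. laplace_pair (2 * z) (Complex (\<epsilon> n) (2 * s * exp \<eta>)) (Complex (\<epsilon> n) (2 * t * exp (a + \<theta>)))) / 4)"
  let ?t = "\<lambda>n y x. D n y * ((h (fst x) * c1 y (fst x)) * (h (snd x) * c2 y (snd x)))"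
  let ?k = "\<lambda>n x. case x of (\<eta>, \<theta>) \<Rightarrow> h \<eta> * h \<theta> * K n \<eta> \<theta>"
  have Hint: "integrable ?M (\<lambda>(\<eta>, \<theta>). h \<eta> * h \<theta>)" by (rule integrable_product_lborel[OF hint hint])
  \<comment> \<open>The cosines are real, hence bounded by 1, and the product of the three other factors is integrable.\<close>
  have tri: "integrable (lborel \<Otimes>\<^sub>M ?M) (\<lambda>(y, x). ?t n y x)" for n
  proof (rule Bochner_Integration.integrable_bound)
    show "integrable (lborel \<Otimes>\<^sub>M ?M) (\<lambda>(y, x). D n y * (case x of (\<eta>, \<theta>) \<Rightarrow> h \<eta> * h \<theta>))"
      using integrable_product_lborel[OF Dint[of n] Hint[unfolded lborel_prod]] unfolding lborel_prod .
    show "AE x in lborel \<Otimes>\<^sub>M ?M. norm (case x of (y, x) \<Rightarrow> ?t n y x)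
       \<le> norm (case x of (y, x) \<Rightarrow> D n y * (case x of (\<eta>, \<theta>) \<Rightarrow> h \<eta> * h \<theta>))"
    proof (intro AE_I2)
      fix x :: "real \<times> real \<times> real"
      obtain y \<eta> \<theta> where x: "x = (y, \<eta>, \<theta>)" by (metis prod_cases3)
      have 1: "norm (c1 y \<eta>) \<le> 1" "norm (c2 y \<theta>) \<le> 1"
        unfolding c1_def c2_def cos_of_real norm_of_real by auto
      have "norm (c1 y \<eta>) * norm (c2 y \<theta>) \<le> 1 * 1" by (intro mult_mono 1) auto
      hence "norm (D n y * (h \<eta> * h \<theta>)) * (norm (c1 y \<eta>) * norm (c2 y \<theta>)) \<le> norm (D n y * (h \<eta> * h \<theta>)) * 1"
        by (intro mult_left_mono) auto
      thus "norm (case x of (y, x) \<Rightarrow> ?t n y x)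
       \<le> norm (case x of (y, x) \<Rightarrow> D n y * (case x of (\<eta>, \<theta>) \<Rightarrow> h \<eta> * h \<theta>))"
        unfolding x by (simp add: norm_mult mult_ac)
    qed
  qed (simp add: D_def c1_def c2_def, measurable)
  interpret LM: pair_sigma_finite "lborel :: real measure" ?M
    unfolding lborel_prod by unfold_locales
  have Kn: "(LBINT y. D n y * (c1 y \<eta> * c2 y \<theta>)) = K n \<eta> \<theta>" for n \<eta> \<theta>
    using damped_cosine_product_integral[OF \<epsilon>(1)[of n], of "2 * z" \<eta> "a + \<theta>"]
    unfolding D_def c1_def c2_def K_def by (simp only: mult.assoc)
  have I2: "I n = (\<integral>x. (?k n x) \<partial>?M)"
    and Kmeas: "(\<lambda>x. (?k n x)) \<in> borel_measurable ?M" for n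
  proof -
    have a: "I n = (\<integral>y. (\<integral>x. ?t n y x \<partial>?M) \<partial>lborel)"
      unfolding I_def
    proof (intro Bochner_Integration.integral_cong refl)
      fix y
      show "D n y * ((LBINT x. h x * c1 y x) * (LBINT x. h x * c2 y x)) = (\<integral>x. ?t n y x \<partial>?M)"
        using integral_product_lborel[OF C1(1)[of y] C2(1)[of y]] by (simp add: case_prod_unfold)
    qed
    have b: "(LBINT y. ?t n y x) = (?k n x)" for x
    proof -
      have "(LBINT y. ?t n y x)
        = (LBINT y. h (fst x) * h (snd x) * (D n y * (c1 y (fst x) * c2 y (snd x))))"
        by (simp only: mult_ac)
      also have "\<dots> = h (fst x) * h (snd x) * K n (fst x) (snd x)"
        by (subst integral_mult_right_zero) (simp only: Kn)
      finally show ?thesis by (simp add: case_prod_unfold)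
    qed
    show "I n = (\<integral>x. (?k n x) \<partial>?M)"
      unfolding a using LM.Fubini_integral[OF tri[of n]] by (simp only: b)
    show "(\<lambda>x. (?k n x)) \<in> borel_measurable ?M"
      using borel_measurable_integrable[OF LM.integrable_snd[OF tri[of n]]] by (simp only: b)
  qed
  have \<nu>: "0 < Re (2 * z)" "Re (2 * z) < 1" using z by auto
  obtain C k where C: "0 \<le> C" and Ck: "\<And>\<epsilon> s t \<eta> \<theta>. 0 < \<epsilon> \<Longrightarrow> \<epsilon> \<le> 1 \<Longrightarrow> \<bar>s\<bar> = 1 \<Longrightarrow> \<bar>t\<bar> = 1 \<Longrightarrow>
     norm (laplace_pair (2 * z) (Complex \<epsilon> (2 * s * exp \<eta>)) (Complex \<epsilon> (2 * t * exp \<theta>)))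
       \<le> C * exp (k * (exp \<eta> + exp \<theta>)) * (exp (- Re (2 * z) * \<eta>) + 1)"
    using laplace_pair_bound[OF \<nu>] by blast
  have K_le: "norm (K n \<eta> \<theta>) \<le> C * exp (k * (exp \<eta> + exp (a + \<theta>))) * (exp (- Re (2 * z) * \<eta>) + 1)" for n \<eta> \<theta>
  proof -
    let ?b = "C * exp (k * (exp \<eta> + exp (a + \<theta>))) * (exp (- Re (2 * z) * \<eta>) + 1)"
    have "norm (\<Sum>s\<in>{1, -1}. \<Sum>t\<in>{1, -1}. laplace_pair (2 * z) (Complex (\<epsilon> n) (2 * s * exp \<eta>)) (Complex (\<epsilon> n) (2 * t * exp (a + \<theta>))))
        \<le> (\<Sum>s\<in>{1, -1::real}. \<Sum>t\<in>{1, -1::real}. ?b)"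
      by (intro sum_norm_le Ck \<epsilon>) auto
    thus ?thesis by (simp add: K_def norm_divide)
  qed
  define b1 where "b1 = (\<lambda>x. exp ((1 - 2 * Re z) * x + (norm w + k) * exp x - (exp x)\<^sup>2) + exp (1 * x + (norm w + k) * exp x - (exp x)\<^sup>2))"
  define b2 where "b2 = (\<lambda>x. exp (1 * x + (norm w + k * exp a) * exp x - (exp x)\<^sup>2))"
  have bint: "integrable lborel b1" "integrable lborel b2"
    unfolding b1_def b2_def by (intro Bochner_Integration.integrable_add integrable_gaussian_weight; use z in simp)+
  have dom: "norm (h \<eta> * h \<theta> * K n \<eta> \<theta>) \<le> C * (b1 \<eta> * b2 \<theta>)" for n \<eta> \<theta>
  proof -
    have "norm (h \<eta> * h \<theta> * K n \<eta> \<theta>) \<le> exp (1 * \<eta> + norm w * exp \<eta> - (exp \<eta>)\<^sup>2) * exp (1 * \<theta> + norm w * exp \<theta> - (exp \<theta>)\<^sup>2)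
        * (C * exp (k * (exp \<eta> + exp (a + \<theta>))) * (exp (- Re (2 * z) * \<eta>) + 1))"
      unfolding norm_mult by (intro mult_mono h_le K_le) auto
    also have "\<dots> = C * (b1 \<eta> * b2 \<theta>)"
    proof -
      have 1: "b1 \<eta> = exp (1 * \<eta> + norm w * exp \<eta> - (exp \<eta>)\<^sup>2) * exp (k * exp \<eta>) * (exp (- Re (2 * z) * \<eta>) + 1)"
        unfolding b1_def distrib_left exp_add[symmetric] mult_1_right by (simp add: algebra_simps)
      have 2: "b2 \<theta> = exp (1 * \<theta> + norm w * exp \<theta> - (exp \<theta>)\<^sup>2) * exp (k * exp (a + \<theta>))"
        unfolding b2_def exp_add[symmetric] by (simp add: exp_add algebra_simps)
      have 3: "exp (k * (exp \<eta> + exp (a + \<theta>))) = exp (k * exp \<eta>) * exp (k * exp (a + \<theta>))"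
        by (simp add: ring_distribs exp_add)
      show ?thesis unfolding 1 2 3 by (simp only: mult_ac)
    qed
    finally show ?thesis .
  qed
  let ?lim = "\<lambda>\<eta> \<theta>. h \<eta> * h \<theta> * (of_real pi / 2 * (exp (z * of_real (a + \<theta> - \<eta>)) * koshliakov_kernel z (exp (\<eta> + (a + \<theta>)))))"
  let ?l = "\<lambda>x. case x of (\<eta>, \<theta>) \<Rightarrow> ?lim \<eta> \<theta>"
  let ?c = "of_real pi / 2 * exp (z * of_real a)"
  let ?N = "\<lambda>x. case x of (\<eta>, \<theta>) \<Rightarrow> koshliakov_integrand z w a \<eta> \<theta>"
  have Klim: "(\<lambda>n. h \<eta> * h \<theta> * K n \<eta> \<theta>) \<longlonglongrightarrow> ?lim \<eta> \<theta>" for \<eta> \<theta>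
  proof (intro tendsto_mult tendsto_const)
    have "(\<lambda>n. K n \<eta> \<theta>) \<longlonglongrightarrow> 2 * of_real pi * exp (z * of_real (a + \<theta> - \<eta>)) * koshliakov_kernel z (exp (\<eta> + (a + \<theta>))) / 4"
      unfolding K_def by (intro tendsto_divide tendsto_const laplace_pair_tendsto_boundary z \<epsilon> \<epsilon>0) auto
    thus "(\<lambda>n. K n \<eta> \<theta>) \<longlonglongrightarrow> of_real pi / 2 * (exp (z * of_real (a + \<theta> - \<eta>)) * koshliakov_kernel z (exp (\<eta> + (a + \<theta>))))"
      by (simp add: field_simps)
  qed
  have limM: "(\<lambda>x. ?l x) \<in> borel_measurable ?M"
    by (rule borel_measurable_LIMSEQ_metric[OF Kmeas]) (use Klim in auto)
  have domint: "integrable ?M (\<lambda>x. C * (case x of (\<eta>, \<theta>) \<Rightarrow> b1 \<eta> * b2 \<theta>))"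
    by (intro integrable_mult_right integrable_product_lborel bint)
  have cv: "AE x in ?M. (\<lambda>n. ?k n x) \<longlonglongrightarrow> (?l x)"
    unfolding case_prod_unfold by (intro AE_I2 Klim)
  have dm: "AE x in ?M. norm (?k n x) \<le> C * (case x of (\<eta>, \<theta>) \<Rightarrow> b1 \<eta> * b2 \<theta>)" for n
    unfolding case_prod_unfold by (intro AE_I2 dom)
  have i: "integrable ?M (\<lambda>x. ?l x)"
    and lim2: "(\<lambda>n. \<integral>x. (?k n x) \<partial>?M) \<longlonglongrightarrow> (\<integral>x. (?l x) \<partial>?M)"
    by (rule integrable_dominated_convergence[OF limM Kmeas domint cv dm] integral_dominated_convergence[OF limM Kmeas domint cv dm])+
  have eq: "(?l x) = ?c * (?N x)" for x
  proof -
    obtain \<eta> \<theta> where x: "x = (\<eta>, \<theta>)" by (metis surj_pair)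
    have "exp (z * of_real (a + \<theta> - \<eta>)) = exp (z * of_real a) * exp (z * of_real (\<theta> - \<eta>))"
      unfolding exp_add[symmetric] by (rule arg_cong[of _ _ exp]) (simp add: algebra_simps)
    moreover have "\<eta> + (a + \<theta>) = a + \<eta> + \<theta>" by simp
    ultimately show ?thesis unfolding x koshliakov_integrand_def h_def by (simp only: prod.case mult_ac)
  qed
  have nz: "?c \<noteq> 0" by simp
  have "integrable ?M (\<lambda>(\<eta>, \<theta>). koshliakov_integrand z w a \<eta> \<theta>)"
  proof -
    have "integrable ?M (\<lambda>x. inverse ?c * (?c * (?N x)))"
      using i unfolding eq by (rule integrable_mult_right)
    moreover have "inverse c * (c * v) = v" if "c \<noteq> 0" for c v :: complex using that by simp
    ultimately show ?thesis by (simp only: nz not_False_eq_True)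
  qed
  moreover have "2 * (\<integral>(\<eta>, \<theta>). koshliakov_integrand z w a \<eta> \<theta> \<partial>?M) = exp (- (w\<^sup>2 / 2)) * bessel_conv z (\<i> * w) a"
  proof -
    have "of_real pi / 4 * exp (- (w\<^sup>2 / 2)) * (exp (z * of_real a) * bessel_conv z (\<i> * w) a)
      = ?c * (\<integral>(\<eta>, \<theta>). koshliakov_integrand z w a \<eta> \<theta> \<partial>?M)"
      using LIMSEQ_unique[OF lim1[unfolded I2] lim2] unfolding eq by simp
    thus ?thesis by (simp add: field_simps)
  qed
  ultimately show ?thesis unfolding double_integral_identity_def by blast
qed

lemma double_integral_identity_uminus:
  assumes z: "\<bar>Re z\<bar> < 1 / 2" and id: "double_integral_identity (- z) w a"
  shows "double_integral_identity z w a"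
proof -
  let ?M = "lborel \<Otimes>\<^sub>M lborel :: (real \<times> real) measure"
  have swap: "koshliakov_integrand (- z) w a \<theta> \<eta> = koshliakov_integrand z w a \<eta> \<theta>" for \<eta> \<theta>
  proof -
    have "a + \<theta> + \<eta> = a + \<eta> + \<theta>" "- z * of_real (\<eta> - \<theta>) = z * of_real (\<theta> - \<eta>)" by (simp_all add: algebra_simps)
    thus ?thesis unfolding koshliakov_integrand_def koshliakov_kernel_uminus[OF z] by (simp only: mult_ac)
  qed
  have i: "integrable ?M (\<lambda>(\<eta>, \<theta>). koshliakov_integrand (- z) w a \<eta> \<theta>)"
    and e: "2 * (\<integral>(\<eta>, \<theta>). koshliakov_integrand (- z) w a \<eta> \<theta> \<partial>?M) = exp (- (w\<^sup>2 / 2)) * bessel_conv (- z) (\<i> * w) a"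
    using id unfolding double_integral_identity_def by auto
  have "integrable ?M (\<lambda>(\<eta>, \<theta>). koshliakov_integrand z w a \<eta> \<theta>)"
    using lborel_pair.integrable_product_swap[OF i] by (simp add: case_prod_unfold swap)
  moreover have "(\<integral>(\<eta>, \<theta>). koshliakov_integrand z w a \<eta> \<theta> \<partial>?M) = (\<integral>(\<eta>, \<theta>). koshliakov_integrand (- z) w a \<eta> \<theta> \<partial>?M)"
    using lborel_pair.integral_product_swap[OF borel_measurable_integrable[OF i]] by (simp add: case_prod_unfold swap)
  ultimately show ?thesis
    using e unfolding double_integral_identity_def bessel_conv_uminus by simp
qed

lemma bessel_conv_tendsto:
  assumes "\<zeta> \<longlonglongrightarrow> z" and "\<And>n. \<bar>Re (\<zeta> n)\<bar> \<le> 1"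
  shows "(\<lambda>n. bessel_conv (\<zeta> n) w a) \<longlonglongrightarrow> bessel_conv z w a"
  unfolding bessel_conv_def
proof (rule integral_dominated_convergence)
  let ?b = "\<lambda>s u. exp (2 * s * u - 1 * exp u - exp a * exp (- u))"
  let ?W = "(exp ((norm w + 1)\<^sup>2))\<^sup>2 * exp \<bar>a\<bar>"
  show "integrable lborel (\<lambda>u. ?W * (?b 1 u + ?b (- 1) u))"
    by (intro integrable_mult_right Bochner_Integration.integrable_add integrable_two_sided_weight) auto
  show "AE u in lborel. norm (gcos w (exp u) * gcos w (exp (a - u)) * exp (\<zeta> n * of_real (2 * u - a))) \<le> ?W * (?b 1 u + ?b (- 1) u)" for n
  proof (intro AE_I2)
    fix u
    let ?r = "Re (\<zeta> n)"
    have 1: "exp (- ?r * a) \<le> exp \<bar>a\<bar>"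
    proof -
      have "- ?r * a \<le> \<bar>?r\<bar> * \<bar>a\<bar>" by (metis abs_ge_self abs_minus_cancel abs_mult)
      also have "\<dots> \<le> 1 * \<bar>a\<bar>" by (intro mult_right_mono assms) auto
      finally show ?thesis by simp
    qed
    have 2: "?b ?r u \<le> ?b 1 u + ?b (- 1) u"
    proof (cases "u \<ge> 0")
      case True
      hence "?r * u \<le> 1 * u" using assms(2)[of n] by (intro mult_right_mono) auto
      hence "?b ?r u \<le> ?b 1 u" by simp
      thus ?thesis by (simp add: add_increasing2)
    next
      case False
      hence "(- ?r) * (- u) \<le> 1 * (- u)" using assms(2)[of n] by (intro mult_right_mono) auto
      hence "?b ?r u \<le> ?b (- 1) u" by (simp add: mult.commute)
      thus ?thesis by (simp add: add_increasing)
    qed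
    have "norm (gcos w (exp u) * gcos w (exp (a - u)) * exp (\<zeta> n * of_real (2 * u - a)))
      \<le> (exp ((norm w + 1)\<^sup>2))\<^sup>2 * exp (- ?r * a) * ?b ?r u"
      by (rule bessel_conv_integrand_le)
    also have "\<dots> \<le> ?W * (?b 1 u + ?b (- 1) u)"
      by (intro mult_mono 1 2 mult_left_mono) auto
    finally show "norm (gcos w (exp u) * gcos w (exp (a - u)) * exp (\<zeta> n * of_real (2 * u - a))) \<le> ?W * (?b 1 u + ?b (- 1) u)" .
  qed
  show "AE u in lborel. (\<lambda>n. gcos w (exp u) * gcos w (exp (a - u)) * exp (\<zeta> n * of_real (2 * u - a)))
     \<longlonglongrightarrow> gcos w (exp u) * gcos w (exp (a - u)) * exp (z * of_real (2 * u - a))"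
    by (intro AE_I2 tendsto_mult tendsto_const tendsto_exp assms)
qed measurable

text \<open>The closed form of the Laplace integrals is established for orders with positive real part, and it
degenerates at $z = 0$. The identity is carried over from $z + \rho/(n+1)$ by dominated convergence.\<close>
lemma double_integral_identity_imaginary:
  assumes z: "Re z = 0"
  shows "double_integral_identity z w a"
proof -
  let ?M = "lborel \<Otimes>\<^sub>M lborel :: (real \<times> real) measure"
  obtain \<rho> C where \<rho>: "0 < \<rho>" "\<rho> \<le> 1 / 8" and C: "C \<ge> 0"
    and bd: "\<And>z' r. z' \<in> cball z \<rho> \<Longrightarrow> norm (koshliakov_kernel z' (exp r)) \<le> C * exp (\<bar>r\<bar> / 8) * exp (8 * exp (r / 2))"
    using koshliakov_kernel_locally_bounded[OF z] by blast
  define \<zeta> where "\<zeta> = (\<lambda>n. z + of_real (\<rho> * inverse (real (Suc n))))"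
  have lim: "\<zeta> \<longlonglongrightarrow> z"
  proof -
    have "\<zeta> \<longlonglongrightarrow> z + of_real (\<rho> * 0)"
      unfolding \<zeta>_def by (intro tendsto_intros LIMSEQ_inverse_real_of_nat)
    thus ?thesis by simp
  qed
  have iv: "0 < inverse (real (Suc n))" "inverse (real (Suc n)) \<le> 1" for n by (auto simp: field_simps)
  have rho_n: "0 < \<rho> * inverse (real (Suc n))" "\<rho> * inverse (real (Suc n)) \<le> \<rho>" for n
    using \<rho> iv[of n] mult_left_mono[OF iv(2)[of n], of \<rho>] by (auto simp del: of_nat_Suc)
  have cb: "\<zeta> n \<in> cball z \<rho>" for n
    using rho_n[of n] by (simp add: \<zeta>_def dist_norm del: of_real_mult of_nat_Suc)
  have re: "0 < Re (\<zeta> n)" "Re (\<zeta> n) \<le> 1 / 8" for n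
  proof -
    have "Re (\<zeta> n) = \<rho> * inverse (real (Suc n))" using z unfolding \<zeta>_def plus_complex.sel Re_complex_of_real by simp
    thus "0 < Re (\<zeta> n)" "Re (\<zeta> n) \<le> 1 / 8" using rho_n[of n] \<rho>(2) by linarith+
  qed
  have id: "double_integral_identity (\<zeta> n) w a" for n
    using re[of n] by (intro double_integral_identity_positive) auto
  let ?F = "\<lambda>z x. case x of (\<eta>, \<theta>) \<Rightarrow> koshliakov_integrand z w a \<eta> \<theta>"
  define b where "b = (\<lambda>x. exp ((5 / 4) * x + (norm w + 4 * exp (a / 2)) * exp x - (exp x)\<^sup>2) + exp ((3 / 4) * x + (norm w + 4 * exp (a / 2)) * exp x - (exp x)\<^sup>2))"
  have bint: "integrable lborel b"
    unfolding b_def by (intro Bochner_Integration.integrable_add integrable_gaussian_weight) auto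
  let ?g = "\<lambda>x. exp (1 * x + norm w * exp x - (exp x)\<^sup>2)"
  let ?e = "\<lambda>x::real. \<bar>x\<bar> / 8"
  have dom: "norm (koshliakov_integrand (\<zeta> n) w a \<eta> \<theta>) \<le> C * exp (\<bar>a\<bar> / 8) * (b \<eta> * b \<theta>)" for n \<eta> \<theta>
  proof -
    let ?k = "4 * exp (a / 2)"
    have g: "norm (complex_of_real (exp x) * gcos w (exp x)) \<le> ?g x" for x
      using norm_gcos_mellin_integrand_le[of w x 1] by (simp add: norm_mult mult.commute)
    have e: "norm (exp (\<zeta> n * of_real (\<theta> - \<eta>))) \<le> exp (\<bar>\<eta>\<bar> / 8 + \<bar>\<theta>\<bar> / 8)"
    proof -
      have "Re (\<zeta> n) * (\<theta> - \<eta>) \<le> Re (\<zeta> n) * (\<bar>\<eta>\<bar> + \<bar>\<theta>\<bar>)" using re[of n] by (intro mult_left_mono) auto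
      also have "\<dots> \<le> 1 / 8 * (\<bar>\<eta>\<bar> + \<bar>\<theta>\<bar>)" using re[of n] by (intro mult_right_mono) auto
      finally show ?thesis by simp
    qed
    have k: "norm (koshliakov_kernel (\<zeta> n) (exp (a + \<eta> + \<theta>))) \<le> C * exp (?e a + ?e \<eta> + ?e \<theta>) * exp (?k * (exp \<eta> + exp \<theta>))"
    proof -
      have "8 * exp ((a + \<eta> + \<theta>) / 2) \<le> ?k * (exp \<eta> + exp \<theta>)"
      proof -
        have sq: "exp \<eta> = exp (\<eta> / 2) * exp (\<eta> / 2)" "exp \<theta> = exp (\<theta> / 2) * exp (\<theta> / 2)" by (simp_all flip: exp_add)
        have "0 \<le> (exp (\<eta> / 2) - exp (\<theta> / 2))\<^sup>2" by simp
        hence "2 * (exp (\<eta> / 2) * exp (\<theta> / 2)) \<le> exp \<eta> + exp \<theta>"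
          unfolding sq by (simp add: power2_eq_square algebra_simps)
        from mult_left_mono[OF this, of "4 * exp (a / 2)"]
        show ?thesis by (simp add: add_divide_distrib exp_add mult_ac)
      qed
      moreover have "\<bar>a + \<eta> + \<theta>\<bar> / 8 \<le> \<bar>a\<bar> / 8 + \<bar>\<eta>\<bar> / 8 + \<bar>\<theta>\<bar> / 8"
        using abs_triangle_ineq[of "a + \<eta>" \<theta>] abs_triangle_ineq[of a \<eta>] by argo
      ultimately have "C * exp (\<bar>a + \<eta> + \<theta>\<bar> / 8) * exp (8 * exp ((a + \<eta> + \<theta>) / 2)) \<le> C * exp (?e a + ?e \<eta> + ?e \<theta>) * exp (?k * (exp \<eta> + exp \<theta>))"
        using C by (intro mult_mono mult_left_mono) auto
      with bd[OF cb, of n "a + \<eta> + \<theta>"] show ?thesis by linarith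
    qed
    have b_ge: "?g x * exp (\<bar>x\<bar> / 4) * exp (?k * exp x) \<le> b x" for x
    proof -
      have "exp (\<bar>x\<bar> / 4) \<le> exp (x / 4) + exp (- x / 4)" by (cases "x \<ge> 0") auto
      hence "(?g x * exp (?k * exp x)) * exp (\<bar>x\<bar> / 4)
        \<le> (?g x * exp (?k * exp x)) * (exp (x / 4) + exp (- x / 4))"
        by (intro mult_left_mono) auto
      also have "\<dots> = b x"
        unfolding b_def distrib_left exp_add[symmetric]
        by (intro arg_cong2[of _ _ _ _ "(+)"] arg_cong[of _ _ exp]) (simp_all add: algebra_simps)
      finally show ?thesis by (simp only: mult_ac)
    qed
    have "norm (koshliakov_integrand (\<zeta> n) w a \<eta> \<theta>) \<le> ?g \<eta> * ?g \<theta> *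
      (exp (\<bar>\<eta>\<bar> / 8 + \<bar>\<theta>\<bar> / 8) * (C * exp (?e a + ?e \<eta> + ?e \<theta>) * exp (?k * (exp \<eta> + exp \<theta>))))"
      unfolding koshliakov_integrand_def norm_mult[of "_ * _" "_ * _"] norm_mult[of "exp _" "koshliakov_kernel _ _"]
      using C by (intro mult_mono g e k) auto
    also have "\<dots> = C * exp (\<bar>a\<bar> / 8) * ((?g \<eta> * exp (\<bar>\<eta>\<bar> / 4) * exp (?k * exp \<eta>)) *
       (?g \<theta> * exp (\<bar>\<theta>\<bar> / 4) * exp (?k * exp \<theta>)))"
    proof -
      have 1: "exp (\<bar>x\<bar> / 4) = exp (\<bar>x\<bar> / 8) * exp (\<bar>x\<bar> / 8)" for x :: real by (simp flip: exp_add)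
      have 2: "exp (?k * (exp \<eta> + exp \<theta>)) = exp (?k * exp \<eta>) * exp (?k * exp \<theta>)" by (simp only: distrib_left exp_add)
      show ?thesis unfolding 1 2 exp_add[of "\<bar>\<eta>\<bar> / 8"] exp_add[of "\<bar>a\<bar> / 8 + \<bar>\<eta>\<bar> / 8"] exp_add[of "\<bar>a\<bar> / 8"] by (simp only: mult_ac)
    qed
    also have "\<dots> \<le> C * exp (\<bar>a\<bar> / 8) * (b \<eta> * b \<theta>)"
      using C by (intro mult_left_mono mult_mono b_ge) (auto simp: b_def add_nonneg_nonneg)
    finally show ?thesis .
  qed
  have ptw: "(\<lambda>n. koshliakov_integrand (\<zeta> n) w a \<eta> \<theta>) \<longlonglongrightarrow> koshliakov_integrand z w a \<eta> \<theta>" for \<eta> \<theta>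
  proof -
    have "isCont (\<lambda>z. koshliakov_kernel z (exp (a + \<eta> + \<theta>))) z"
    proof (rule continuous_on_interior[OF holomorphic_on_imp_continuous_on[OF holomorphic_koshliakov_kernel]])
      show "z \<in> interior {z. \<bar>Re z\<bar> < 1 / 2}" unfolding interior_open[OF open_strip] using z by simp
    qed
    hence "(\<lambda>n. koshliakov_kernel (\<zeta> n) (exp (a + \<eta> + \<theta>))) \<longlonglongrightarrow> koshliakov_kernel z (exp (a + \<eta> + \<theta>))"
      by (rule isCont_tendsto_compose[OF _ lim])
    thus ?thesis unfolding koshliakov_integrand_def by (intro tendsto_mult tendsto_const tendsto_exp lim)
  qed
  have m1: "?F z \<in> borel_measurable ?M" by (rule measurable_koshliakov_integrand) (use z in simp)
  have m2: "?F (\<zeta> n) \<in> borel_measurable ?M" for n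
    by (rule measurable_koshliakov_integrand) (use re[of n] in simp)
  have di: "integrable ?M (\<lambda>x. C * exp (\<bar>a\<bar> / 8) * (case x of (\<eta>, \<theta>) \<Rightarrow> b \<eta> * b \<theta>))"
    by (intro integrable_mult_right integrable_product_lborel bint)
  have cv: "AE x in ?M. (\<lambda>n. ?F (\<zeta> n) x) \<longlonglongrightarrow> ?F z x"
    unfolding case_prod_unfold by (intro AE_I2 ptw)
  have dm: "AE x in ?M. norm (?F (\<zeta> n) x) \<le> C * exp (\<bar>a\<bar> / 8) * (case x of (\<eta>, \<theta>) \<Rightarrow> b \<eta> * b \<theta>)" for n
    unfolding case_prod_unfold by (intro AE_I2 dom)
  have i: "integrable ?M (?F z)"
    and l: "(\<lambda>n. \<integral>x. ?F (\<zeta> n) x \<partial>?M) \<longlonglongrightarrow> (\<integral>x. ?F z x \<partial>?M)"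
    by (rule integrable_dominated_convergence[OF m1 m2 di cv dm] integral_dominated_convergence[OF m1 m2 di cv dm])+
  have "(\<lambda>n. exp (- (w\<^sup>2 / 2)) * bessel_conv (\<zeta> n) (\<i> * w) a) \<longlonglongrightarrow> exp (- (w\<^sup>2 / 2)) * bessel_conv z (\<i> * w) a"
  proof (intro tendsto_mult tendsto_const bessel_conv_tendsto lim)
    show "\<bar>Re (\<zeta> n)\<bar> \<le> 1" for n using re[of n] by simp
  qed
  moreover have "exp (- (w\<^sup>2 / 2)) * bessel_conv (\<zeta> n) (\<i> * w) a = 2 * (\<integral>x. ?F (\<zeta> n) x \<partial>?M)" for n
    using id[of n] unfolding double_integral_identity_def by simp
  ultimately have "2 * (\<integral>x. ?F z x \<partial>?M) = exp (- (w\<^sup>2 / 2)) * bessel_conv z (\<i> * w) a"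
    using LIMSEQ_unique[OF tendsto_mult[OF tendsto_const[of 2] l]] by simp
  with i show ?thesis unfolding double_integral_identity_def by blast
qed

lemma double_integral_identity_strip:
  assumes "\<bar>Re z\<bar> < 1 / 2"
  shows "double_integral_identity z w a"
proof -
  consider "Re z > 0" | "Re z = 0" | "Re (- z) > 0" by (cases "Re z" "0 :: real" rule: linorder_cases) auto
  thus ?thesis
  proof cases
    case 1 thus ?thesis using assms by (intro double_integral_identity_positive) auto
  next
    case 2 thus ?thesis by (rule double_integral_identity_imaginary)
  next
    case 3 thus ?thesis using assms
      by (intro double_integral_identity_uminus[OF assms] double_integral_identity_positive) auto
  qed
qed

section \<open>The Koshliakov transform\<close>

text \<open>The shear $(\eta,\theta) \mapsto (\theta, \eta + \theta)$ preserves Lebesgue measure and turns the double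
integral into the integral of the convolution against the kernel.\<close>
lemma koshliakov_transform_bessel_conv:
  assumes z: "\<bar>Re z\<bar> < 1 / 2"
  shows "integrable lborel (\<lambda>r. of_real (exp r) * bessel_conv z w r * koshliakov_kernel z (exp (a + r)))"
    and "2 * (LBINT r. of_real (exp r) * bessel_conv z w r * koshliakov_kernel z (exp (a + r)))
       = exp (- (w\<^sup>2 / 2)) * bessel_conv z (\<i> * w) a"
proof -
  let ?k = "koshliakov_integrand z w a"
  note [measurable] = measurable_koshliakov_integrand[OF z, of w a]
  have id: "double_integral_identity z w a" by (rule double_integral_identity_strip[OF z])
  have i: "integrable (lborel \<Otimes>\<^sub>M lborel) (\<lambda>(\<eta>, \<theta>). ?k \<eta> \<theta>)"
    using id by (simp add: double_integral_identity_def)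
  define G where "G = (\<lambda>u r. ?k (r - u) u)"
  have Gm: "(\<lambda>(u, r). G u r) \<in> borel_measurable (lborel \<Otimes>\<^sub>M lborel)"
  proof -
    have "(\<lambda>p::real \<times> real. (snd p - fst p, fst p)) \<in> measurable (lborel \<Otimes>\<^sub>M lborel) (lborel \<Otimes>\<^sub>M lborel)" by measurable
    from measurable_compose[OF this measurable_koshliakov_integrand[OF z, of w a]]
    show ?thesis by (simp add: G_def case_prod_unfold)
  qed
  have Gint: "integrable (lborel \<Otimes>\<^sub>M lborel) (\<lambda>(u, r). G u r)"
  proof (rule lborel_pair.Fubini_integrable[OF Gm])
    have "AE u in lborel. integrable lborel (\<lambda>\<eta>. ?k \<eta> u)" by (rule lborel_pair.AE_integrable_snd[OF i])
    thus "AE u in lborel. integrable lborel (\<lambda>r. case (u, r) of (u, r) \<Rightarrow> G u r)"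
    proof eventually_elim
      case (elim u)
      thus ?case using lborel_integrable_shift[of "\<lambda>\<eta>. ?k \<eta> u" "- u"] by (simp add: G_def)
    qed
    have "integrable (lborel \<Otimes>\<^sub>M lborel) (\<lambda>(\<eta>, \<theta>). norm (?k \<eta> \<theta>))"
      using integrable_norm[OF i] by (simp add: case_prod_unfold)
    hence "integrable lborel (\<lambda>u. LBINT \<eta>. norm (?k \<eta> u))" by (rule lborel_pair.integrable_snd)
    moreover have "(LBINT \<eta>. norm (?k \<eta> u)) = (LBINT r. norm (case (u, r) of (u, r) \<Rightarrow> G u r))" for u
      using lborel_integral_shift[of "\<lambda>\<eta>. norm (?k \<eta> u)" "- u"] by (simp add: G_def)
    ultimately show "integrable lborel (\<lambda>u. LBINT r. norm (case (u, r) of (u, r) \<Rightarrow> G u r))" by simp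
  qed
  have inner: "(LBINT u. G u r) = of_real (exp r) * bessel_conv z w r * koshliakov_kernel z (exp (a + r))" for r
  proof -
    have "G u r = of_real (exp r) * koshliakov_kernel z (exp (a + r)) * (gcos w (exp u) * gcos w (exp (r - u)) * exp (z * of_real (2 * u - r)))" for u
    proof -
      have "complex_of_real (exp (r - u)) * of_real (exp u) = of_real (exp r)"
        by (simp flip: of_real_mult exp_add)
      moreover have "u - (r - u) = 2 * u - r" "a + (r - u) + u = a + r" by simp_all
      moreover have "A * g * (B * h) * (E * K) = A * B * K * (h * g * E)" for A B g h E K :: complex
        by (simp only: mult_ac)
      ultimately show ?thesis unfolding G_def koshliakov_integrand_def by (simp only:)
    qed
    hence "(LBINT u. G u r) = of_real (exp r) * koshliakov_kernel z (exp (a + r)) * bessel_conv z w r"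
      unfolding bessel_conv_def by simp
    thus ?thesis by (simp only: mult_ac)
  qed
  show "integrable lborel (\<lambda>r. of_real (exp r) * bessel_conv z w r * koshliakov_kernel z (exp (a + r)))"
    using lborel_pair.integrable_snd[OF Gint] unfolding inner .
  have "(LBINT r. of_real (exp r) * bessel_conv z w r * koshliakov_kernel z (exp (a + r))) = (LBINT u. (LBINT r. G u r))"
    unfolding inner[symmetric] by (rule lborel_pair.Fubini_integral[OF Gint])
  also have "(\<lambda>u. LBINT r. G u r) = (\<lambda>u. LBINT \<eta>. ?k \<eta> u)"
  proof
    fix u show "(LBINT r. G u r) = (LBINT \<eta>. ?k \<eta> u)"
      using lborel_integral_shift[of "\<lambda>\<eta>. ?k \<eta> u" "- u"] by (simp add: G_def)
  qed
  also have "(LBINT u. (LBINT \<eta>. ?k \<eta> u)) = (\<integral>(\<eta>, \<theta>). ?k \<eta> \<theta> \<partial>(lborel \<Otimes>\<^sub>M lborel))"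
    by (rule lborel_pair.integral_snd[OF i])
  finally show "2 * (LBINT r. of_real (exp r) * bessel_conv z w r * koshliakov_kernel z (exp (a + r)))
       = exp (- (w\<^sup>2 / 2)) * bessel_conv z (\<i> * w) a"
    using id by (simp add: double_integral_identity_def)
qed

lemma koshliakov_transform_gen_bessel_K:
  assumes z: "\<bar>Re z\<bar> < 1 / 2" and \<beta>: "\<beta> > 0" and x: "x > 0" and c: "c > \<bar>Re z\<bar>" and d: "d > \<bar>Re z\<bar>"
  shows "set_integrable lborel {0<..} (\<lambda>t. of_real \<beta> * gen_bessel_K d z w (2 * \<beta> * t) * koshliakov_kernel z (x * t))"
    and "2 * (LINT t:{0<..}|lborel. of_real \<beta> * gen_bessel_K d z w (2 * \<beta> * t) * koshliakov_kernel z (x * t))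
       = exp (- (w\<^sup>2 / 2)) * gen_bessel_K c z (\<i> * w) (2 * (x / \<beta>))"
proof -
  define a where "a = ln x - ln \<beta>"
  define \<phi> where "\<phi> = (\<lambda>r. of_real (exp r) * bessel_conv z w r * koshliakov_kernel z (exp (a + r)))"
  let ?f = "\<lambda>t. of_real \<beta> * gen_bessel_K d z w (2 * \<beta> * t) * koshliakov_kernel z (x * t)"
  have f_exp: "?f (exp y) = of_real \<beta> * bessel_conv z w (ln \<beta> + y) * koshliakov_kernel z (exp (ln x + y))" for y
  proof -
    have "2 * \<beta> * exp y = 2 * exp (ln \<beta> + y)" "x * exp y = exp (ln x + y)" using \<beta> x by (simp_all add: exp_add)
    thus ?thesis by (simp only: gen_bessel_K_eq_bessel_conv[OF d])
  qed
  have eq: "of_real (exp y) * ?f (exp y) = \<phi> (ln \<beta> + y)" for y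
  proof -
    have "complex_of_real (exp (ln \<beta> + y)) = of_real \<beta> * of_real (exp y)" using \<beta> by (simp add: exp_add)
    moreover have "a + (ln \<beta> + y) = ln x + y" by (simp add: a_def)
    ultimately show ?thesis unfolding f_exp \<phi>_def by (simp only: mult_ac)
  qed
  have meas: "(\<lambda>y. ?f (exp y)) \<in> borel_measurable borel"
  proof -
    have [measurable]: "bessel_conv z w \<in> borel_measurable borel"
      unfolding bessel_conv_def by measurable
    note [measurable] = measurable_koshliakov_kernel_exp[OF z]
    have "(\<lambda>y. koshliakov_kernel z (exp (ln x + y))) \<in> borel_measurable borel"
      by (rule measurable_compose[OF _ measurable_koshliakov_kernel_exp[OF z]]) measurable
    thus ?thesis unfolding f_exp by measurable
  qed
  have int: "integrable lborel (\<lambda>y. \<phi> (ln \<beta> + y))"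
    unfolding lborel_integrable_shift unfolding \<phi>_def by (rule koshliakov_transform_bessel_conv(1)[OF z])
  show "set_integrable lborel {0<..} ?f"
    using int unfolding set_integral_exp_substitution(1)[OF meas] eq .
  have "(LINT t:{0<..}|lborel. ?f t) = (LBINT r. \<phi> r)"
    unfolding set_integral_exp_substitution(2)[OF meas] eq by (rule lborel_integral_shift)
  hence "2 * (LINT t:{0<..}|lborel. ?f t) = exp (- (w\<^sup>2 / 2)) * bessel_conv z (\<i> * w) a"
    using koshliakov_transform_bessel_conv(2)[OF z, of w a] by (simp only: \<phi>_def)
  also have "bessel_conv z (\<i> * w) a = gen_bessel_K c z (\<i> * w) (2 * exp a)"
    by (rule gen_bessel_K_eq_bessel_conv[OF c, symmetric])
  also have "exp a = x / \<beta>" using \<beta> x by (simp add: a_def exp_diff)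
  finally show "2 * (LINT t:{0<..}|lborel. ?f t) = exp (- (w\<^sup>2 / 2)) * gen_bessel_K c z (\<i> * w) (2 * (x / \<beta>))" .
qed

theorem theorem1p1:
  fixes z w :: complex and x \<alpha> \<beta> c d :: real
  assumes "- (1 / 2) < Re z" and "Re z < 1 / 2"
    and "x > 0"
    and "\<alpha> > 0" and "\<beta> > 0" and "\<alpha> * \<beta> = 1"
    and "c > \<bar>Re z\<bar>" and "d > \<bar>Re z\<bar>"
  defines "f \<equiv> \<lambda>t. exp (- (w\<^sup>2 / 2)) * gen_bessel_K c z (\<i> * w) (2 * \<alpha> * t)"
    and "g \<equiv> \<lambda>t. of_real \<beta> * gen_bessel_K d z w (2 * \<beta> * t)"
  shows "set_integrable lborel {0<..} (\<lambda>t. g t * koshliakov_kernel z (x * t))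
       \<and> f x = 2 * (LINT t:{0<..}|lborel. g t * koshliakov_kernel z (x * t))
       \<and> set_integrable lborel {0<..} (\<lambda>t. f t * koshliakov_kernel z (x * t))
       \<and> g x = 2 * (LINT t:{0<..}|lborel. f t * koshliakov_kernel z (x * t))"
proof -
  have z: "\<bar>Re z\<bar> < 1 / 2" using assms(1,2) by auto
  have xa: "x / \<beta> = \<alpha> * x" "x / \<alpha> = \<beta> * x"
    using \<open>\<alpha> > 0\<close> \<open>\<beta> > 0\<close> \<open>\<alpha> * \<beta> = 1\<close> by (simp_all add: field_simps)
  note g_transform = koshliakov_transform_gen_bessel_K[OF z \<open>\<beta> > 0\<close> \<open>x > 0\<close> assms(7) assms(8), of w]
  note f_transform = koshliakov_transform_gen_bessel_K[OF z \<open>\<alpha> > 0\<close> \<open>x > 0\<close> assms(8) assms(7), of "\<i> * w"]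
  \<comment> \<open>The first relation for \<open>\<i> * w\<close>, with \<open>\<alpha>\<close> and \<open>\<beta>\<close> exchanged, becomes the second one after multiplication by this constant.\<close>
  define \<gamma> where "\<gamma> = exp (- (w\<^sup>2 / 2)) * of_real \<beta>"
  have ab: "complex_of_real \<beta> * of_real \<alpha> = 1"
    using \<open>\<alpha> * \<beta> = 1\<close> by (metis mult.commute of_real_1 of_real_mult)
  have f_eq: "f t * koshliakov_kernel z (x * t) = \<gamma> * (of_real \<alpha> * gen_bessel_K c z (\<i> * w) (2 * \<alpha> * t) * koshliakov_kernel z (x * t))" for t
  proof -
    have "\<gamma> * (of_real \<alpha> * A * B) = exp (- (w\<^sup>2 / 2)) * A * B" for A B
    proof -
      have "\<gamma> * (of_real \<alpha> * A * B) = (of_real \<beta> * of_real \<alpha>) * (exp (- (w\<^sup>2 / 2)) * A * B)"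
        unfolding \<gamma>_def by (simp only: mult_ac)
      thus ?thesis by (simp only: ab mult_1_left)
    qed
    thus ?thesis unfolding f_def by (simp only:)
  qed
  have "gen_bessel_K d z (\<i> * (\<i> * w)) (2 * (\<beta> * x)) = gen_bessel_K d z w (2 * \<beta> * x)"
    by (simp add: gen_bessel_K_def gen_bessel_integrand_def power_mult_distrib mult.assoc)
  moreover have "exp (- (w\<^sup>2 / 2)) * exp (- ((\<i> * w)\<^sup>2 / 2)) = 1"
    by (simp add: power_mult_distrib flip: exp_add)
  ultimately have g_eq: "\<gamma> * (exp (- ((\<i> * w)\<^sup>2 / 2)) * gen_bessel_K d z (\<i> * (\<i> * w)) (2 * (x / \<alpha>))) = g x"
  proof -
    assume a: "gen_bessel_K d z (\<i> * (\<i> * w)) (2 * (\<beta> * x)) = gen_bessel_K d z w (2 * \<beta> * x)"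
      and b: "exp (- (w\<^sup>2 / 2)) * exp (- ((\<i> * w)\<^sup>2 / 2)) = 1"
    have "\<gamma> * (exp (- ((\<i> * w)\<^sup>2 / 2)) * K) = (exp (- (w\<^sup>2 / 2)) * exp (- ((\<i> * w)\<^sup>2 / 2))) * (of_real \<beta> * K)" for K
      unfolding \<gamma>_def by (simp only: mult_ac)
    thus ?thesis unfolding b g_def xa a by simp
  qed
  have "set_integrable lborel {0<..} (\<lambda>t. g t * koshliakov_kernel z (x * t))"
    unfolding g_def by (rule g_transform(1))
  moreover have "f x = 2 * (LINT t:{0<..}|lborel. g t * koshliakov_kernel z (x * t))"
    unfolding g_def g_transform(2) f_def xa by (simp add: mult.assoc)
  moreover have "set_integrable lborel {0<..} (\<lambda>t. f t * koshliakov_kernel z (x * t))"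
    unfolding f_eq by (intro set_integrable_mult_right f_transform(1))
  moreover have "g x = 2 * (LINT t:{0<..}|lborel. f t * koshliakov_kernel z (x * t))"
    unfolding f_eq g_eq[symmetric] f_transform(2)[symmetric] by simp
  ultimately show ?thesis by blast
qed

end
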